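(* Assume the learning-rate assumption and the smoothness assumption stated in the context. Let $\bar\rho$ be a stationary solution of $\partial_t\rho_t=2\zeta(t)\nabla_\omega\cdot\big(\rho_t\nabla_\omega\Phi(\omega;\rho_t)\big)$. Assume that there exist $r>0$ and $\kappa>0$ such that for every $\rho$ satisfying $W_2(\rho,\bar\rho)<r$ and every coupling $\pi\in\Pi(\rho,\bar\rho)$, $$\int\big\langle\omega-\omega',\nabla_\omega\Phi(\omega;\rho)-\nabla_\omega\Phi(\omega';\bar\rho)\big\rangle\,\pi(d\omega,d\omega')\ge\kappa\int\|\omega-\omega'\|^2\,\pi(d\omega,d\omega').$$ If $\rho_t$ is a solution of the PDE with $W_2(\rho_0,\bar\rho)<r$ and the trajectory remains in this $W_2$-ball (i.e. $W_2(\rho_t,\bar\rho)<r$ for all $t\ge0$), then for all $t\ge0$ $$W_2(\rho_t,\bar\rho)^2\le W_2(\rho_0,\bar\rho)^2\exp\Big(-4\kappa\int_0^t\zeta(s)\,ds\Big).$$ Consequently, $$W_2(\rho_t,\bar\rho)\le W_2(\rho_0,\bar\rho)\exp\Big(-2\kappa\int_0^t\zeta(s)\,ds\Big).$$ If moreover $\zeta(t)\ge\zeta_->0$ for all $t\ge0$, the convergence is exponential in $t$.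
   Context: Model. Fix positive integers $L,d_x,d_k,d_v$ and a fixed matrix $W_{\mathrm{out}}\in\mathbb R^{d_x\times d_v}$. A head parameter is $\omega=(W_Q,W_K,W_V,W_O)\in\mathbb R^{d_x\times d_k}\times\mathbb R^{d_x\times d_k}\times\mathbb R^{d_x\times d_k}\times\mathbb R^{d_k\times d_x}$, identified with a vector in $\mathbb R^{d_\omega}$. For an input $X\in\mathbb R^{L\times d_x}$ (rows are tokens), the causally masked attention matrix $A_\omega(X)\in\mathbb R^{L\times L}$ has entries $$A_\omega(X)_{rs}=\frac{\exp\big((XW_QW_K^\top X^\top)_{rs}/\sqrt{d_k}\big)}{\sum_{s'\le r}\exp\big((XW_QW_K^\top X^\top)_{rs'}/\sqrt{d_k}\big)}\ (s\le r),\qquad A_\omega(X)_{rs}=0\ (s>r).$$ $\psi_l(X;\omega)\in\mathbb R^{d_v}$ is the $l$-th row of $A_\omega(X)XW_VW_OW_{\mathrm{out}}$, $l=1,\dots,L$. Data and first variation. $X$ is a random input and $Y_l(X)\in\mathbb R^{d_v}$ is a one-hot label for each $l$; $\mathbb E_X$ is expectation over $X$. $\mathrm{softmax}_j(z)=e^{z_j}/\sum_m e^{z_m}$. For a probability measure $\rho$ on $\mathbb R^{d_\omega}$, $z_l^\rho(X)=\int\psi_l(X;\omega)\,\rho(d\omega)$, and $$\Phi(\omega;\rho)=\mathbb E_X\Big[\frac1L\sum_{l=1}^L\big\langle\mathrm{softmax}(z_l^\rho(X))-Y_l(X),\psi_l(X;\omega)\big\rangle\Big].$$ Solutions. A weak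 solution of the PDE is a narrowly continuous curve $t\mapsto\rho_t\in\mathcal P(K)$ such that for every $f\in C^1(K)$, $\frac{d}{dt}\int f\,d\rho_t=-2\zeta(t)\int\langle\nabla f(\omega),\nabla_\omega\Phi(\omega;\rho_t)\rangle\,\rho_t(d\omega)$ in the sense of distributions in time; equivalently $\rho_t$ is the law of $W_t$ with $\dot W_t=-2\zeta(t)\nabla_\omega\Phi(W_t;\rho_t)$, $W_0\sim\rho_0$. $\bar\rho\in\mathcal P(K)$ is a stationary solution if the constant curve $\rho_t\equiv\bar\rho$ is a weak solution. $W_2$ is the 2-Wasserstein distance and $\Pi(\rho,\bar\rho)$ the set of couplings of $\rho$ and $\bar\rho$. Learning-rate assumption. $\zeta:[0,\infty)\to[0,\infty)$ is bounded and Lipschitz, and $\int_0^\infty\zeta(t)\,dt=\infty$. Smoothness assumption. $K\subset\mathbb R^{d_\omega}$ and $K_x\subset\mathbb R^{d_x}$ are compact, all measures considered are supported in $K$, all input tokens lie in $K_x$ (so $X\in K_x^L$), the maps $\omega\mapsto\psi_l(X;\omega)$ are $C^3$ on $K$ for all $l$ and almost every $X$, and there is $B_\psi<\infty$ with $$\sup_{X\in K_x^L,\,1\le l\le L,\,\omega\in K}\big(\|\psi_l(X;\omega)\|+\|\nabla_\omega\psi_l(X;\omega)\|+\|\nabla^2_\omega\psi_l(X;\omega)\|+\|\nabla^3_\omega\psi_l(X;\omega)\|\big)\le B_\psi.$$ *)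

theory Defs
  imports "HOL-Probability.Probability"
begin

section \<open>Measures, couplings and the 2-Wasserstein distance\<close>

definition prob_on :: "'a::topological_space set \<Rightarrow> 'a measure set" where
  "prob_on K = {\<rho>. prob_space \<rho> \<and> sets \<rho> = sets borel \<and> emeasure \<rho> K = 1}"

definition couplings :: "'a::euclidean_space measure \<Rightarrow> 'a measure \<Rightarrow> ('a \<times> 'a) measure set" where
  "couplings \<mu> \<nu> = {\<pi>. prob_space \<pi> \<and> sets \<pi> = sets borel \<and>
     distr \<pi> borel fst = \<mu> \<and> distr \<pi> borel snd = \<nu>}"

text \<open>The transport cost is taken in the extended non-negative reals. The final conversion to a
  real number is harmless for measures with finite second moment, in particular on
  \<^term>\<open>prob_on K\<close> with \<^term>\<open>K\<close> compact.\<close>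

definition W2 :: "'a::euclidean_space measure \<Rightarrow> 'a measure \<Rightarrow> real" where
  "W2 \<mu> \<nu> = sqrt (enn2real
     (INF \<pi>\<in>couplings \<mu> \<nu>. \<integral>\<^sup>+p. ennreal ((norm (fst p - snd p))\<^sup>2) \<partial>\<pi>))"

definition narrowly_continuous :: "(real \<Rightarrow> 'a::topological_space measure) \<Rightarrow> bool" where
  "narrowly_continuous \<rho> \<longleftrightarrow> (\<forall>g :: 'a \<Rightarrow> real. continuous_on UNIV g \<and> bounded (range g) \<longrightarrow>
     continuous_on {0..} (\<lambda>t. \<integral>\<omega>. g \<omega> \<partial>\<rho> t))"


section \<open>Derivatives\<close>

definition grad :: "('a::real_inner \<Rightarrow> real) \<Rightarrow> 'a \<Rightarrow> 'a" where
  "grad f x = (THE D. GDERIV f x :> D)"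

definition C1 :: "('a::real_inner \<Rightarrow> real) \<Rightarrow> bool" where
  "C1 f \<longleftrightarrow> (\<forall>x. f differentiable (at x)) \<and> continuous_on UNIV (grad f)"

text \<open>The Frechet derivative as a bounded linear map. Iterating it gives the higher derivatives,
  measured in operator norm.\<close>

definition frechet :: "('a::real_normed_vector \<Rightarrow> 'b::real_normed_vector) \<Rightarrow> 'a \<Rightarrow> ('a \<Rightarrow>\<^sub>L 'b)" where
  "frechet f x = Blinfun (frechet_derivative f (at x))"

text \<open>Being of class C3 on a set that need not be open means: on some open neighbourhood of it.\<close>

definition C3_on :: "'a::real_normed_vector set \<Rightarrow> ('a \<Rightarrow> 'b::real_normed_vector) \<Rightarrow> bool" where
  "C3_on S f \<longleftrightarrow> (\<exists>U. open U \<and> S \<subseteq> U \<and>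
     (\<forall>x\<in>U. f differentiable (at x)) \<and>
     (\<forall>x\<in>U. frechet f differentiable (at x)) \<and>
     (\<forall>x\<in>U. frechet (frechet f) differentiable (at x)) \<and>
     continuous_on U (frechet (frechet (frechet f))))"

text \<open>Smooth test functions with compact support in the open half-line of positive times.\<close>

definition time_test :: "(real \<Rightarrow> real) \<Rightarrow> bool" where
  "time_test \<phi> \<longleftrightarrow> (\<forall>n t. (deriv ^^ n) \<phi> differentiable (at t)) \<and>
     (\<exists>a b. 0 < a \<and> a \<le> b \<and> (\<forall>t. t \<notin> {a..b} \<longrightarrow> \<phi> t = 0))"


section \<open>The attention model\<close>

text \<open>The dimensions are cardinalities of index types: \<open>'l\<close> for the \<open>L\<close> token positions, linearly
  ordered because of the causal mask, \<open>'x\<close> for \<open>d\<^sub>x\<close>, \<open>'k\<close> for \<open>d\<^sub>k\<close>, \<open>'v\<close> for \<open>d\<^sub>v\<close>. A head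
  \<open>(W\<^sub>Q, W\<^sub>K, W\<^sub>V, W\<^sub>O)\<close> lives in a product of matrix spaces, whose library inner product is the
  Euclidean one on the space of all entries. In \<^typ>\<open>real^'b^'a\<close> the index \<open>'a\<close> runs over rows.\<close>

type_synonym ('x, 'l) input = "real^'x^'l"

type_synonym ('x, 'k) head = "(real^'k^'x) \<times> (real^'k^'x) \<times> (real^'k^'x) \<times> (real^'x^'k)"

definition attn_logit :: "real^'k^'x \<Rightarrow> real^'k^'x \<Rightarrow> ('x, 'l::finite) input \<Rightarrow> 'l \<Rightarrow> 'l \<Rightarrow> real" where
  "attn_logit WQ WK X r s =
     (X ** WQ ** transpose WK ** transpose X) $ r $ s / sqrt (real CARD('k))"

definition attn :: "real^'k^'x \<Rightarrow> real^'k^'x \<Rightarrow> ('x, 'l) input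
    \<Rightarrow> real^('l::{finite,linorder})^('l::{finite,linorder})" where
  "attn WQ WK X = (\<chi> r s. if s \<le> r
     then exp (attn_logit WQ WK X r s) / (\<Sum>s'\<in>{..r}. exp (attn_logit WQ WK X r s')) else 0)"

definition psi :: "real^'v^'x \<Rightarrow> 'l::{finite,linorder} \<Rightarrow> ('x, 'l) input \<Rightarrow> ('x, 'k::finite) head \<Rightarrow> real^'v" where
  "psi Wout l X = (\<lambda>(WQ, WK, WV, WO). row l (attn WQ WK X ** X ** WV ** WO ** Wout))"

definition softmax :: "real^'v \<Rightarrow> real^'v" where
  "softmax z = (\<chi> j. exp (z $ j) / (\<Sum>m\<in>UNIV. exp (z $ m)))"

definition one_hot :: "real^'v \<Rightarrow> bool" where
  "one_hot y \<longleftrightarrow> (\<exists>j. y = axis j 1)"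

definition mean_logit ::
    "real^'v^'x \<Rightarrow> 'l::{finite,linorder} \<Rightarrow> ('x, 'l) input \<Rightarrow> ('x, 'k::finite) head measure \<Rightarrow> real^'v" where
  "mean_logit Wout l X \<rho> = (\<integral>\<omega>. psi Wout l X \<omega> \<partial>\<rho>)"

text \<open>\<open>D\<close> is the law of the random input \<open>X\<close>, and \<open>Y l X\<close> the label at position \<open>l\<close>.\<close>

definition Phi :: "real^'v^'x \<Rightarrow> ('x, 'l::{finite,linorder}) input measure
    \<Rightarrow> ('l \<Rightarrow> ('x, 'l) input \<Rightarrow> real^'v)
    \<Rightarrow> ('x, 'k::finite) head \<Rightarrow> ('x, 'k) head measure \<Rightarrow> real" where
  "Phi Wout D Y \<omega> \<rho> = (\<integral>X. 1 / real CARD('l) *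
     (\<Sum>l\<in>UNIV. (softmax (mean_logit Wout l X \<rho>) - Y l X) \<bullet> psi Wout l X \<omega>) \<partial>D)"

abbreviation grad_Phi :: "real^'v^'x \<Rightarrow> ('x, 'l::{finite,linorder}) input measure
    \<Rightarrow> ('l \<Rightarrow> ('x, 'l) input \<Rightarrow> real^'v)
    \<Rightarrow> ('x, 'k::finite) head \<Rightarrow> ('x, 'k) head measure \<Rightarrow> ('x, 'k) head" where
  "grad_Phi Wout D Y \<omega> \<rho> \<equiv> grad (\<lambda>\<omega>'. Phi Wout D Y \<omega>' \<rho>) \<omega>"


section \<open>The mean-field equation\<close>

text \<open>The equation is tested against \<open>f \<in> C\<^sup>1(K)\<close>, read as the restrictions to \<open>K\<close> of C1 functions
  on the whole space, and holds as an identity of distributions on positive times, the time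
  derivative having been moved onto the test function \<open>\<phi>\<close>. \<open>V \<omega> \<rho>\<close> stands for the spatial gradient
  of the first variation.\<close>

definition weak_solution :: "'a::euclidean_space set \<Rightarrow> (real \<Rightarrow> real) \<Rightarrow> ('a \<Rightarrow> 'a measure \<Rightarrow> 'a)
    \<Rightarrow> (real \<Rightarrow> 'a measure) \<Rightarrow> bool" where
  "weak_solution K \<zeta> V \<rho> \<longleftrightarrow>
     (\<forall>t\<ge>0. \<rho> t \<in> prob_on K) \<and> narrowly_continuous \<rho> \<and>
     (\<forall>f \<phi>. C1 f \<and> time_test \<phi> \<longrightarrow>
        - (LINT t:{0<..}|lborel. deriv \<phi> t * (\<integral>\<omega>. f \<omega> \<partial>\<rho> t)) =
        (LINT t:{0<..}|lborel. \<phi> t * (- 2 * \<zeta> t * (\<integral>\<omega>. grad f \<omega> \<bullet> V \<omega> (\<rho> t) \<partial>\<rho> t))))"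

definition stationary_solution :: "'a::euclidean_space set \<Rightarrow> (real \<Rightarrow> real)
    \<Rightarrow> ('a \<Rightarrow> 'a measure \<Rightarrow> 'a) \<Rightarrow> 'a measure \<Rightarrow> bool" where
  "stationary_solution K \<zeta> V \<rho> \<longleftrightarrow> weak_solution K \<zeta> V (\<lambda>_. \<rho>)"


section \<open>Standing assumptions\<close>

definition learning_rate :: "(real \<Rightarrow> real) \<Rightarrow> bool" where
  "learning_rate \<zeta> \<longleftrightarrow> (\<forall>t\<ge>0. 0 \<le> \<zeta> t) \<and> bounded (\<zeta> ` {0..}) \<and>
     (\<exists>C. C-lipschitz_on {0..} \<zeta>) \<and> (\<integral>\<^sup>+t\<in>{0..}. ennreal (\<zeta> t) \<partial>lborel) = \<infinity>"

definition smoothness :: "real^'v^'x \<Rightarrow> ('x, 'l::{finite,linorder}) input measure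
    \<Rightarrow> ('x, 'k::finite) head set \<Rightarrow> (real^'x) set \<Rightarrow> bool" where
  "smoothness Wout D K Kx \<longleftrightarrow> compact K \<and> compact Kx \<and>
     (AE X in D. \<forall>l. X $ l \<in> Kx) \<and>
     (AE X in D. \<forall>l. C3_on K (psi Wout l X)) \<and>
     (\<exists>B. \<forall>(X :: ('x, 'l) input) l. \<forall>\<omega>\<in>K. (\<forall>i. X $ i \<in> Kx) \<longrightarrow>
        norm (psi Wout l X \<omega>) + norm (frechet (psi Wout l X) \<omega>)
        + norm (frechet (frechet (psi Wout l X)) \<omega>)
        + norm (frechet (frechet (frechet (psi Wout l X))) \<omega>) \<le> B)"

definition data_law :: "('x::finite, 'l::{finite,linorder}) input measure
    \<Rightarrow> ('l \<Rightarrow> ('x, 'l) input \<Rightarrow> real^'v) \<Rightarrow> bool" where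
  "data_law D Y \<longleftrightarrow> prob_space D \<and> sets D = sets borel \<and>
     (\<forall>l. Y l \<in> borel_measurable D) \<and> (AE X in D. \<forall>l. one_hot (Y l X))"

end

theory Submission
  imports Defs
begin

text \<open>The proof is Lagrangian. On \<open>K\<close> the velocity is extended to a bounded field on the whole space
  with bounded and Lipschitz derivative, which has a global flow. A weak solution is the
  push-forward of its initial datum under this flow: a test function composed with one Euler step
  of the flow is a test function with only slightly larger constants, so telescoping over the Euler
  scheme compares the solution with the transported measure, with vanishing error.
  Hence every coupling of the initial datum with the stationary measure is transported by the pair
  of flows to a coupling at time \<open>t\<close>, and along this curve of couplings the monotonicity assumption
  makes the quadratic cost decay. The infimum over initial couplings gives the claim, without
  optimal plans.\<close>

section \<open>Smooth steps\<close>

text \<open>Freezing the measure inside the velocity turns the nonlinear equation into a linear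
  continuity equation with a given field, so only uniqueness for a linear equation is at stake. The
  usual duality argument composes a test function with the flow, which requires the flow to be
  differentiable in its initial point with Lipschitz derivative. An Euler step is an explicit map
  whose derivative involves only the field, and composing with it multiplies the constant of a test
  function by at most \<open>(1 + C * h) ^ 3\<close>. Over T / h steps the constants grow by at most
  \<open>exp (3 * (C * T))\<close>, while each step errs by a small multiple of h. The stationary
  measure receives a flow of its own: its velocity is not shown to vanish, and only the invariance
  of the measure under that flow enters. The factor 4 in the rate is a product of two factors 2, one
  from the velocity - 2 \<zeta> grad Phi and one from differentiating a squared distance.\<close>

definition flat :: "real poly \<Rightarrow> real \<Rightarrow> real" where
  "flat p x = (if x > 0 then poly p (1 / x) * exp (- (1 / x)) else 0)"

lemma poly_mult_exp_tendsto_0: "((\<lambda>y::real. poly p y * exp (- y)) \<longlongrightarrow> 0) at_top"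
proof -
  have "((\<lambda>y::real. \<Sum>i\<le>degree p. coeff p i * (y ^ i / exp y)) \<longlongrightarrow> (\<Sum>i\<le>degree p. coeff p i * 0)) at_top"
    by (intro tendsto_sum tendsto_mult_left tendsto_power_div_exp_0)
  then show ?thesis
    by (simp add: poly_altdef sum_distrib_right exp_minus divide_inverse mult.assoc)
qed

text \<open>Differentiating p(1/x) exp(-1/x) gives (1/x)^2 (p - p')(1/x) exp(-1/x), and
  \<open>[:0, 0, 1:]\<close> is the factor (1/x)^2. Indexing the classical flat function by a
  polynomial makes the family closed under derivatives, also at 0.\<close>

lemma DERIV_flat:
  "(flat p has_field_derivative flat ([:0, 0, 1:] * (p - pderiv p)) x) (at x)"
proof -
  consider "x > 0" | "x < 0" | "x = 0" by linarith
  then show ?thesis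
  proof cases
    case 1
    have "((\<lambda>x. poly p (1 / x) * exp (- (1 / x))) has_field_derivative
        flat ([:0, 0, 1:] * (p - pderiv p)) x) (at x)"
      using 1 by (auto simp: flat_def algebra_simps power2_eq_square divide_simps
          intro!: derivative_eq_intros DERIV_chain2[where f = "poly p", OF poly_DERIV])
    then show ?thesis
      by (rule DERIV_cong_ev[THEN iffD1, OF refl _ refl, rotated])
        (use 1 in \<open>auto simp: flat_def intro!: eventually_mono[OF eventually_nhds_in_open[of "{0<..}"]]\<close>)
  next
    case 2
    have "((\<lambda>x. 0) has_field_derivative flat ([:0, 0, 1:] * (p - pderiv p)) x) (at x)"
      using 2 by (auto simp: flat_def)
    then show ?thesis
      by (rule DERIV_cong_ev[THEN iffD1, OF refl _ refl, rotated])
        (use 2 in \<open>auto simp: flat_def intro!: eventually_mono[OF eventually_nhds_in_open[of "{..<0}"]]\<close>)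
  next
    case 3
    \<comment> \<open>The substitution y = 1/x turns the difference quotient at 0 into a polynomial
      times exp(-y); \<open>pCons 0 p\<close> carries the extra factor 1/x of the quotient.\<close>
    have "((\<lambda>y. poly (pCons 0 p) y * exp (- y)) \<longlongrightarrow> 0) at_top"
      by (rule poly_mult_exp_tendsto_0)
    then have "((\<lambda>x. poly (pCons 0 p) (inverse x) * exp (- inverse x)) \<longlongrightarrow> 0) (at_right 0)"
      by (rule filterlim_compose[OF _ filterlim_inverse_at_top_right])
    then have "((\<lambda>x. flat p x / x) \<longlongrightarrow> 0) (at_right 0)"
      by (rule Lim_transform_eventually)
        (auto simp: flat_def eventually_at_filter field_simps)
    moreover have "((\<lambda>x. flat p x / x) \<longlongrightarrow> 0) (at_left 0)"
      by (rule Lim_transform_eventually[OF tendsto_const])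
        (auto simp: flat_def eventually_at_filter)
    ultimately have "((\<lambda>x. flat p x / x) \<longlongrightarrow> 0) (at 0)"
      by (simp add: filterlim_split_at)
    then show ?thesis
      using 3 by (simp add: has_field_derivative_iff flat_def)
  qed
qed

text \<open>A class of functions that is closed under differentiation, hence consists of smooth functions.\<close>

inductive_set bumps :: "(real \<Rightarrow> real) set" where
  bumps_base: "(\<lambda>x. flat p (x - a) * flat q (b - x)) \<in> bumps"
| bumps_add: "f \<in> bumps \<Longrightarrow> g \<in> bumps \<Longrightarrow> (\<lambda>x. f x + g x) \<in> bumps"

lemma DERIV_bump_base:
  "((\<lambda>x. flat p (x - a) * flat q (b - x)) has_field_derivative
     flat ([:0, 0, 1:] * (p - pderiv p)) (x - a) * flat q (b - x) +
     flat p (x - a) * flat (- ([:0, 0, 1:] * (q - pderiv q))) (b - x)) (at x)"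
proof -
  have *: "flat (- r) y = - flat r y" for r y by (simp add: flat_def)
  show ?thesis
    unfolding * by (auto intro!: derivative_eq_intros DERIV_chain2[OF DERIV_flat])
qed

lemma DERIV_bumps:
  assumes "f \<in> bumps" shows "\<exists>f'\<in>bumps. \<forall>x. (f has_field_derivative f' x) (at x)"
  using assms
proof induction
  case (bumps_base p a q b)
  show ?case
    by (intro bexI[where x = "\<lambda>x. flat ([:0, 0, 1:] * (p - pderiv p)) (x - a) * flat q (b - x) +
     flat p (x - a) * flat (- ([:0, 0, 1:] * (q - pderiv q))) (b - x)"] allI DERIV_bump_base bumps.intros)
next
  case (bumps_add f g)
  then obtain f' g' where "f'\<in>bumps" "g'\<in>bumps" "\<And>x. (f has_field_derivative f' x) (at x)"
     "\<And>x. (g has_field_derivative g' x) (at x)" by blast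
  then show ?case
    by (intro bexI[where x = "\<lambda>x. f' x + g' x"] allI DERIV_add bumps.intros)
qed

lemma deriv_funpow_bumps: "f \<in> bumps \<Longrightarrow> (deriv ^^ n) f \<in> bumps"
proof (induction n)
  case (Suc n)
  then obtain g where "g \<in> bumps" "\<And>x. ((deriv ^^ n) f has_field_derivative g x) (at x)"
    using DERIV_bumps by blast
  moreover from this(2) have "deriv ((deriv ^^ n) f) = g"
    by (intro ext DERIV_imp_deriv)
  ultimately show ?case by simp
qed simp

lemma differentiable_bumps: "f \<in> bumps \<Longrightarrow> f differentiable (at x)"
  using DERIV_bumps[of f] by (auto simp: real_differentiable_def)

text \<open>A smooth step is not in \<open>bumps\<close>, since members of \<open>bumps\<close>
  vanish far to the right; membership of its derivative is enough for smoothness.\<close>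

lemma differentiable_deriv_funpow:
  assumes f: "\<And>x. (f has_field_derivative f' x) (at x)" and f': "f' \<in> bumps"
  shows "(deriv ^^ n) f differentiable (at x)"
proof (cases n)
  case 0
  then show ?thesis using f by (auto simp: real_differentiable_def)
next
  case (Suc m)
  have "deriv f = f'" by (intro ext DERIV_imp_deriv f)
  then show ?thesis
    by (simp add: Suc funpow_swap1[of deriv] differentiable_bumps[OF deriv_funpow_bumps[OF f']] del: funpow.simps add: funpow.simps(2)[of m deriv])
qed

definition bump :: "real \<Rightarrow> real \<Rightarrow> real \<Rightarrow> real" where
  "bump a b x = flat 1 (x - a) * flat 1 (b - x)"

text \<open>A mollified Heaviside function. For x < a the interval is empty and the integral is 0,
  so one formula serves the whole line.\<close>

definition smooth_step :: "real \<Rightarrow> real \<Rightarrow> real \<Rightarrow> real" where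
  "smooth_step a b x = integral {a..x} (bump a b) / integral {a..b} (bump a b)"

lemma bump_nonneg: "0 \<le> bump a b x"
  by (simp add: bump_def flat_def)

lemma bump_eq_0: "x \<le> a \<or> b \<le> x \<Longrightarrow> bump a b x = 0"
  by (auto simp: bump_def flat_def)

lemma bump_in_bumps: "(\<lambda>x. c * bump a b x) \<in> bumps"
proof -
  have "(\<lambda>x. c * bump a b x) = (\<lambda>x. flat [:c:] (x - a) * flat 1 (b - x))"
    by (auto simp: bump_def flat_def fun_eq_iff)
  then show ?thesis by (simp add: bumps.intros)
qed

lemma continuous_on_bump: "continuous_on S (bump a b)"
  using bump_in_bumps[of 1 a b] differentiable_bumps
  by (fastforce intro!: differentiable_imp_continuous_on differentiable_at_imp_differentiable_on)

lemma integrable_bump: "bump a b integrable_on {c..d}"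
  by (intro integrable_continuous_real continuous_on_bump)

lemma integral_bump_pos:
  assumes "a < b" shows "integral {a..b} (bump a b) > 0"
proof -
  have "integral {a..b} (bump a b) \<noteq> 0"
  proof
    assume "integral {a..b} (bump a b) = 0"
    then have "bump a b ((a + b) / 2) = 0"
      using assms by (subst (asm) integral_eq_0_iff) (auto simp: continuous_on_bump bump_nonneg)
    then show False using assms by (simp add: bump_def flat_def)
  qed
  moreover have "integral {a..b} (bump a b) \<ge> 0"
    by (intro integral_nonneg integrable_bump bump_nonneg)
  ultimately show ?thesis by simp
qed

text \<open>Moving the left endpoint away from a makes the primitive differentiable by the
  fundamental theorem at points x \<le> a as well, where {a..x} is degenerate.\<close>

lemma integral_bump_extend:
  assumes "c \<le> a" "c \<le> x" shows "integral {c..x} (bump a b) = integral {a..x} (bump a b)"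
proof (cases "a \<le> x")
  case True
  have "integral {c..a} (bump a b) = integral {c..a} (\<lambda>_. 0)"
    by (intro integral_cong) (auto simp: bump_eq_0)
  then show ?thesis
    using Henstock_Kurzweil_Integration.integral_combine[OF assms(1) True integrable_bump[of a b]] by simp
next
  case False
  have "integral {c..x} (bump a b) = integral {c..x} (\<lambda>_. 0)"
    using False by (intro integral_cong) (auto simp: bump_eq_0)
  then show ?thesis using False by simp
qed

lemma DERIV_smooth_step:
  assumes "a < b"
  shows "(smooth_step a b has_field_derivative bump a b x / integral {a..b} (bump a b)) (at x)"
proof -
  \<comment> \<open>With c strictly below both a and x, the point x is interior to {c..x + 1} and
    the one-sided derivative becomes a full one.\<close>
  define c where "c = min a x - 1"
  have "((\<lambda>u. integral {c..u} (bump a b)) has_vector_derivative bump a b x) (at x within {c..x + 1})"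
    by (rule integral_has_vector_derivative[OF continuous_on_bump]) (auto simp: c_def)
  then have "((\<lambda>u. integral {c..u} (bump a b)) has_field_derivative bump a b x) (at x)"
    by (subst (asm) at_within_interior) (auto simp: c_def has_real_derivative_iff_has_vector_derivative)
  then have "((\<lambda>u. integral {a..u} (bump a b)) has_field_derivative bump a b x) (at x)"
    by (rule DERIV_cong_ev[THEN iffD1, OF refl _ refl, rotated])
      (auto simp: c_def integral_bump_extend intro!: eventually_mono[OF eventually_nhds_in_open[of "{c<..}"]])
  then have "((\<lambda>u. integral {a..u} (bump a b) / integral {a..b} (bump a b)) has_field_derivative bump a b x / integral {a..b} (bump a b)) (at x)"
    by (rule DERIV_cdivide)
  then show ?thesis by (simp add: smooth_step_def[abs_def])
qed

lemma smooth_step_le: "x \<le> a \<Longrightarrow> smooth_step a b x = 0"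
  by (cases "x = a") (auto simp: smooth_step_def)

lemma smooth_step_ge:
  assumes "a < b" "b \<le> x" shows "smooth_step a b x = 1"
proof -
  have "integral {b..x} (bump a b) = integral {b..x} (\<lambda>_. 0)"
    by (intro integral_cong) (auto simp: bump_eq_0)
  then have "integral {a..x} (bump a b) = integral {a..b} (bump a b)"
    using assms Henstock_Kurzweil_Integration.integral_combine[of a b x "bump a b"] integrable_bump by simp
  then show ?thesis
    using integral_bump_pos[OF assms(1)] by (simp add: smooth_step_def)
qed

lemma smooth_step_bounds:
  assumes "a < b" shows "0 \<le> smooth_step a b x" "smooth_step a b x \<le> 1"
proof -
  have mono: "mono (smooth_step a b)"
  proof (rule monoI)
    fix x y :: real assume "x \<le> y"
    then show "smooth_step a b x \<le> smooth_step a b y"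
      by (rule DERIV_nonneg_imp_nondecreasing)
        (use DERIV_smooth_step[OF assms] integral_bump_pos[OF assms] bump_nonneg in
          \<open>meson divide_nonneg_pos\<close>)
  qed
  show "0 \<le> smooth_step a b x"
    using monoD[OF mono, of "min a x" x] by (simp add: smooth_step_le)
  show "smooth_step a b x \<le> 1"
    using monoD[OF mono, of x "max b x"] assms by (simp add: smooth_step_ge)
qed

section \<open>Distributional derivatives in time\<close>

text \<open>A smooth approximation of the indicator of [s, t]: it rises just after s and falls just
  after t. The condition 0 < s keeps its support in positive times, and its derivative is a
  difference of two mollifiers located at s and t.\<close>

lemma time_test_smooth_step_diff:
  assumes "0 < s" "s < t" "0 < e"
  defines "\<phi> \<equiv> \<lambda>x. smooth_step s (s + e) x - smooth_step t (t + e) x"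
  shows "time_test \<phi>"
    and "deriv \<phi> = (\<lambda>x. bump s (s + e) x / integral {s..s + e} (bump s (s + e)) -
           bump t (t + e) x / integral {t..t + e} (bump t (t + e)))" (is "_ = ?d")
proof -
  have D: "(\<phi> has_field_derivative ?d x) (at x)" for x
    unfolding \<phi>_def using assms(3) by (intro DERIV_diff DERIV_smooth_step) auto
  then show "deriv \<phi> = ?d"
    by (intro ext DERIV_imp_deriv)
  have "?d \<in> bumps"
    using bumps_add[OF bump_in_bumps[of "1 / integral {s..s + e} (bump s (s + e))" s "s + e"]
        bump_in_bumps[of "- 1 / integral {t..t + e} (bump t (t + e))" t "t + e"]]
    by simp
  then have "\<forall>n x. (deriv ^^ n) \<phi> differentiable (at x)"
    using differentiable_deriv_funpow[OF D] by blast
  moreover have "\<forall>x. x \<notin> {s..t + e} \<longrightarrow> \<phi> x = 0"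
    using assms(2,3) by (auto simp: \<phi>_def not_le smooth_step_le smooth_step_ge)
  ultimately show "time_test \<phi>"
    unfolding time_test_def using assms by (intro conjI exI[of _ s] exI[of _ "t + e"]) auto
qed

text \<open>Passes from the Lebesgue integral of the weak formulation to the gauge integral over a
  compact interval, where splitting and norm bounds are carried out.\<close>

lemma set_integral_compact_support:
  fixes g :: "real \<Rightarrow> real"
  assumes "continuous_on {u..v} g" "0 < u" "\<And>x. x \<notin> {u..v} \<Longrightarrow> g x = 0"
  shows "set_integrable lborel {0<..} g" "(LINT x:{0<..}|lborel. g x) = integral {u..v} g"
proof -
  have eq: "(\<lambda>x. indicator {0<..} x *\<^sub>R g x) = (\<lambda>x. indicator {u..v} x *\<^sub>R g x)"
    using assms(2,3) by (auto simp: fun_eq_iff indicator_def)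
  have int: "set_integrable lborel {u..v} g"
    by (rule borel_integrable_atLeastAtMost') (rule assms(1))
  then show "set_integrable lborel {0<..} g"
    by (simp only: set_integrable_def eq)
  show "(LINT x:{0<..}|lborel. g x) = integral {u..v} g"
    using set_borel_integral_eq_integral(2)[OF int] by (simp only: set_lebesgue_integral_def eq)
qed

text \<open>The normalised bump is a probability density on {a..b}, so averaging against it cannot
  leave a closed interval that contains all values of F.\<close>

lemma bump_average:
  fixes F :: "real \<Rightarrow> real"
  assumes "a < b" and cont: "continuous_on {a..b} F" and close: "\<And>x. x \<in> {a..b} \<Longrightarrow> \<bar>F x - y\<bar> \<le> e"
  shows "\<bar>integral {a..b} (\<lambda>x. bump a b x / integral {a..b} (bump a b) * F x) - y\<bar> \<le> e"
proof -
  define c where "c = integral {a..b} (bump a b)"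
  have c: "c > 0" unfolding c_def by (rule integral_bump_pos) fact
  have int: "(\<lambda>x. bump a b x / c * G x) integrable_on {a..b}" if "continuous_on {a..b} G" for G
    using c by (intro integrable_continuous_real continuous_intros continuous_on_bump that) auto
  have one: "integral {a..b} (\<lambda>x. bump a b x / c * z) = z" for z
    using c by (simp add: c_def)
  have "integral {a..b} (\<lambda>x. bump a b x / c * F x) - y =
      integral {a..b} (\<lambda>x. bump a b x / c * (F x - y))"
    unfolding right_diff_distrib
    by (subst Henstock_Kurzweil_Integration.integral_diff) (auto simp only: one intro!: int cont continuous_intros)
  also have "\<bar>\<dots>\<bar> \<le> integral {a..b} (\<lambda>x. bump a b x / c * e)"
    unfolding real_norm_def[symmetric]
  proof (rule integral_norm_bound_integral)
    fix x assume "x \<in> {a..b}"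
    then show "norm (bump a b x / c * (F x - y)) \<le> bump a b x / c * e"
      using close[of x] c bump_nonneg[of a b x] by (simp add: abs_mult mult_left_mono divide_right_mono)
  qed (intro int cont continuous_intros)+
  also have "\<dots> = e" by (rule one)
  finally show ?thesis by (simp add: c_def)
qed

lemma continuous_within_right:
  fixes F :: "real \<Rightarrow> real"
  assumes "continuous_on {0..} F" "0 \<le> s" "0 < e"
  shows "\<exists>d>0. \<forall>x. s \<le> x \<and> x \<le> s + d \<longrightarrow> \<bar>F x - F s\<bar> \<le> e"
proof -
  obtain d where d: "d > 0" "\<And>x. x \<in> {0..} \<Longrightarrow> dist x s < d \<Longrightarrow> dist (F x) (F s) < e"
    using assms unfolding continuous_on_iff by (metis atLeast_iff)
  have "\<bar>F x - F s\<bar> \<le> e" if "s \<le> x \<and> x \<le> s + d / 2" for x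
    using d(2)[of x] that d(1) assms(2) by (auto simp: dist_real_def)
  then show ?thesis using d(1) by (intro exI[of _ "d / 2"]) auto
qed

text \<open>Testing with the smoothed indicator of [s, t] localises the left side at F s and F t.
  The total error 4 d consists of two averaging errors and two short ramps, each at most d.\<close>

lemma weak_derivative_imp_integral_pos:
  fixes F a :: "real \<Rightarrow> real"
  assumes F: "continuous_on {0..} F" and a: "continuous_on {0..} a"
    and weak: "\<And>\<phi>. time_test \<phi> \<Longrightarrow>
      - (LINT t:{0<..}|lborel. deriv \<phi> t * F t) = (LINT t:{0<..}|lborel. \<phi> t * a t)"
    and st: "0 < s" "s < t"
  shows "F t - F s = integral {s..t} a"
proof -
  have sub: "continuous_on {u..v} F" "continuous_on {u..v} a" if "0 \<le> u" for u v
    using that by (auto intro: continuous_on_subset[OF F] continuous_on_subset[OF a])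
  have "compact (a ` {0..t + 1})"
    by (intro compact_continuous_image sub) auto
  then obtain A where A: "A > 0" "\<And>x. x \<in> {0..t+1} \<Longrightarrow> \<bar>a x\<bar> \<le> A"
    using compact_imp_bounded[of "a ` {0..t + 1}"] unfolding bounded_pos by force
  have bound: "\<bar>F t - F s - integral {s..t} a\<bar> \<le> 4 * d" if d: "d > 0" for d
  proof -
    obtain d1 where d1: "d1 > 0" "\<And>x. s \<le> x \<and> x \<le> s + d1 \<Longrightarrow> \<bar>F x - F s\<bar> \<le> d"
      using continuous_within_right[OF F _ d, of s] st by auto
    obtain d2 where d2: "d2 > 0" "\<And>x. t \<le> x \<and> x \<le> t + d2 \<Longrightarrow> \<bar>F x - F t\<bar> \<le> d"
      using continuous_within_right[OF F _ d, of t] st by auto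
    \<comment> \<open>The ramp length: below d1 and d2 for the two averages, below d / A so that a
      ramp contributes at most d, below t - s so that the ramps do not overlap, and below 1 so that
      the bound A on {0..t+1} applies.\<close>
    define e where "e = Min {1, d1, d2, d / A, t - s}"
    have e: "e > 0" "e \<le> 1" "e \<le> d1" "e \<le> d2" "e \<le> d / A" "e \<le> t - s"
      unfolding e_def using A(1) d d1(1) d2(1) st by auto
    then have Ae: "A * e \<le> d"
      using A(1) by (simp add: field_simps)
    define \<phi> where "\<phi> = (\<lambda>x. smooth_step s (s + e) x - smooth_step t (t + e) x)"
    note tt = time_test_smooth_step_diff[OF st e(1), folded \<phi>_def]
    define b where "b = (\<lambda>u x. bump u (u + e) x / integral {u..u + e} (bump u (u + e)) * F x)"
    have b: "set_integrable lborel {0<..} (b u)" "(LINT x:{0<..}|lborel. b u x) = integral {u..u+e} (b u)"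
      if "u > 0" for u
    proof -
      have *: "continuous_on {u..u+e} (b u)"
        unfolding b_def using that e(1) integral_bump_pos[of u "u + e"]
        by (intro continuous_intros continuous_on_bump sub) auto
      show "set_integrable lborel {0<..} (b u)" "(LINT x:{0<..}|lborel. b u x) = integral {u..u+e} (b u)"
        by (rule set_integral_compact_support[OF *]; use that in \<open>force simp: b_def bump_eq_0\<close>)+
    qed
    have "(LINT x:{0<..}|lborel. deriv \<phi> x * F x) = (LINT x:{0<..}|lborel. b s x - b t x)"
      by (simp add: tt(2) b_def algebra_simps)
    also have "\<dots> = integral {s..s+e} (b s) - integral {t..t+e} (b t)"
      using st b by (subst set_integral_diff) auto
    finally have 1: "(LINT x:{0<..}|lborel. \<phi> x * a x) = integral {t..t+e} (b t) - integral {s..s+e} (b s)"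
      using weak[OF tt(1)] by simp
    have 2: "\<bar>integral {t..t+e} (b t) - F t\<bar> \<le> d"
      unfolding b_def using e st d2 by (intro bump_average sub) auto
    have 3: "\<bar>integral {s..s+e} (b s) - F s\<bar> \<le> d"
      unfolding b_def using e st d1 by (intro bump_average sub) auto
    have cont\<phi>: "continuous_on S \<phi>" for S
      using tt(1) unfolding time_test_def
      by (metis differentiable_imp_continuous_on differentiable_at_imp_differentiable_on funpow_0)
    have cont\<phi>a: "continuous_on {u..v} (\<lambda>x. \<phi> x * a x)" if "0 \<le> u" for u v
      by (intro continuous_intros cont\<phi> sub that)
    have \<phi>_bounds: "\<bar>\<phi> x\<bar> \<le> 1" "\<bar>\<phi> x - 1\<bar> \<le> 1" if "x \<le> t + e" "s \<le> x" "x < s + e \<or> t \<le> x" for x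
    proof -
      have *: "0 \<le> smooth_step s (s + e) x" "smooth_step s (s + e) x \<le> 1"
        "0 \<le> smooth_step t (t + e) x" "smooth_step t (t + e) x \<le> 1"
        using smooth_step_bounds e(1) by auto
      have "x \<le> t \<Longrightarrow> smooth_step t (t + e) x = 0" "t \<le> x \<Longrightarrow> smooth_step s (s + e) x = 1"
        using smooth_step_le smooth_step_ge e by auto
      then show "\<bar>\<phi> x\<bar> \<le> 1" "\<bar>\<phi> x - 1\<bar> \<le> 1"
        using * that st e by (cases "t \<le> x"; auto simp: \<phi>_def)+
    qed
    have "(LINT x:{0<..}|lborel. \<phi> x * a x) = integral {s..t+e} (\<lambda>x. \<phi> x * a x)"
      by (rule set_integral_compact_support) (use st e in \<open>auto simp: \<phi>_def not_le smooth_step_le smooth_step_ge intro!: cont\<phi>a[unfolded \<phi>_def]\<close>)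
    also have "\<dots> = integral {s..t} (\<lambda>x. \<phi> x * a x) + integral {t..t+e} (\<lambda>x. \<phi> x * a x)"
      using st e by (subst Henstock_Kurzweil_Integration.integral_combine) (auto intro!: integrable_continuous_real cont\<phi>a)
    finally have 4: "(LINT x:{0<..}|lborel. \<phi> x * a x) - integral {s..t} a =
        (integral {s..t} (\<lambda>x. \<phi> x * a x) - integral {s..t} a) + integral {t..t+e} (\<lambda>x. \<phi> x * a x)"
      by simp
    have "integral {s..t} (\<lambda>x. \<phi> x * a x) - integral {s..t} a = integral {s..t} (\<lambda>x. \<phi> x * a x - a x)"
      using st by (subst Henstock_Kurzweil_Integration.integral_diff) (auto intro!: integrable_continuous_real cont\<phi>a sub)
    also have "\<dots> = integral {s..s+e} (\<lambda>x. \<phi> x * a x - a x) + integral {s+e..t} (\<lambda>x. \<phi> x * a x - a x)"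
      using st e by (subst Henstock_Kurzweil_Integration.integral_combine)
        (auto intro!: integrable_continuous_real continuous_intros cont\<phi>a sub)
    also have "integral {s+e..t} (\<lambda>x. \<phi> x * a x - a x) = integral {s+e..t} (\<lambda>x. 0)"
      using e by (intro integral_cong) (auto simp: \<phi>_def smooth_step_le smooth_step_ge)
    finally have 5: "integral {s..t} (\<lambda>x. \<phi> x * a x) - integral {s..t} a = integral {s..s+e} (\<lambda>x. \<phi> x * a x - a x)"
      by simp
    have "norm (integral {s..s+e} (\<lambda>x. \<phi> x * a x - a x)) \<le> A * (s + e - s)"
    proof (rule integral_bound)
      show "norm (\<phi> x * a x - a x) \<le> A" if "x \<in> {s..s+e}" for x
      proof -
        have "\<bar>\<phi> x - 1\<bar> \<le> 1"
        proof (cases "x < s + e")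
          case True
          then show ?thesis using that st e by (intro \<phi>_bounds) auto
        next
          case False
          then show ?thesis using that st e by (auto simp: \<phi>_def smooth_step_le smooth_step_ge)
        qed
        then have "\<bar>\<phi> x - 1\<bar> * \<bar>a x\<bar> \<le> 1 * A"
          using that st e A(2)[of x] by (intro mult_mono) auto
        then show ?thesis by (simp add: abs_mult[symmetric] algebra_simps)
      qed
    qed (use st e in \<open>auto intro!: continuous_intros cont\<phi>a sub\<close>)
    moreover have "norm (integral {t..t+e} (\<lambda>x. \<phi> x * a x)) \<le> A * (t + e - t)"
    proof (rule integral_bound)
      show "norm (\<phi> x * a x) \<le> A" if "x \<in> {t..t+e}" for x
      proof -
        have "\<bar>\<phi> x\<bar> \<le> 1" using that st e by (intro \<phi>_bounds) auto
        then have "\<bar>\<phi> x\<bar> * \<bar>a x\<bar> \<le> 1 * A"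
          using that st e A(2)[of x] by (intro mult_mono) auto
        then show ?thesis by (simp add: abs_mult)
      qed
    qed (use st e in \<open>auto intro!: continuous_intros cont\<phi>a sub\<close>)
    ultimately show ?thesis
      using 1 2 3 4 5 Ae by simp
  qed
  have "\<bar>F t - F s - integral {s..t} a\<bar> \<le> 0 + d" if "d > 0" for d
    using bound[of "d / 4"] that by linarith
  then have "\<bar>F t - F s - integral {s..t} a\<bar> \<le> 0"
    by (rule field_le_epsilon)
  then show ?thesis by linarith
qed

text \<open>Time tests vanish near 0, so s = 0 is out of their direct reach; it is obtained as a
  limit of later starting times, using continuity of F and of the indefinite integral.\<close>

theorem weak_derivative_imp_integral:
  fixes F a :: "real \<Rightarrow> real"
  assumes F: "continuous_on {0..} F" and a: "continuous_on {0..} a"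
    and weak: "\<And>\<phi>. time_test \<phi> \<Longrightarrow>
      - (LINT t:{0<..}|lborel. deriv \<phi> t * F t) = (LINT t:{0<..}|lborel. \<phi> t * a t)"
    and st: "0 \<le> s" "s \<le> t"
  shows "F t - F s = integral {s..t} a"
proof (cases "s = t")
  case False
  then have st': "s < t" using st by simp
  have int: "a integrable_on {u..v}" if "0 \<le> u" for u v
    using that by (intro integrable_continuous_real continuous_on_subset[OF a]) auto
  have eq: "F t - F u = integral {s..t} a - integral {s..u} a" if "u \<in> {s<..<t}" for u
  proof -
    have "integral {s..u} a + integral {u..t} a = integral {s..t} a"
      using that st by (intro Henstock_Kurzweil_Integration.integral_combine int) auto
    then show ?thesis
      using weak_derivative_imp_integral_pos[OF F a weak, of u t] that st by auto
  qed
  have nb: "at s within {s<..<t} \<noteq> bot"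
    using st' by (simp add: trivial_limit_within islimpt_greaterThanLessThan1)
  have "(F \<longlongrightarrow> F s) (at s within {s<..<t})"
    using F st by (auto simp: continuous_on_def intro: tendsto_within_subset)
  then have F_lim: "((\<lambda>u. F t - F u) \<longlongrightarrow> F t - F s) (at s within {s<..<t})"
    by (rule tendsto_diff[OF tendsto_const])
  have "((\<lambda>u. integral {s..u} a) \<longlongrightarrow> integral {s..s} a) (at s within {s<..<t})"
  proof (rule tendsto_within_subset)
    show "((\<lambda>u. integral {s..u} a) \<longlongrightarrow> integral {s..s} a) (at s within {s..t})"
      using indefinite_integral_continuous_1[OF int[OF st(1)], of t] st'
      unfolding continuous_on_def by (metis atLeastAtMost_iff less_imp_le order_refl)
  qed auto
  then have "((\<lambda>u. integral {s..t} a - integral {s..u} a) \<longlongrightarrow> integral {s..t} a - integral {s..s} a) (at s within {s<..<t})"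
    by (rule tendsto_diff[OF tendsto_const])
  moreover have "((\<lambda>u. integral {s..t} a - integral {s..u} a) \<longlongrightarrow> F t - F s) (at s within {s<..<t})"
    using F_lim by (rule Lim_transform_eventually) (auto simp: eventually_at_filter eq)
  ultimately show ?thesis
    using tendsto_unique[OF nb] by auto
qed simp

section \<open>Vector fields with Lipschitz derivative\<close>

text \<open>One constant governs both the gradient and its Lipschitz bound, because this single
  number is what is tracked along the Euler scheme. The values of u are left unbounded.\<close>

definition C11 :: "real \<Rightarrow> ('a::euclidean_space \<Rightarrow> real) \<Rightarrow> ('a \<Rightarrow> 'a) \<Rightarrow> bool" where
  "C11 Q u G \<longleftrightarrow> (\<forall>x. GDERIV u x :> G x) \<and> (\<forall>x. norm (G x) \<le> Q) \<and>
     (\<forall>x y. norm (G x - G y) \<le> Q * norm (x - y))"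

lemma
  assumes "C11 Q u G"
  shows C11_GDERIV: "GDERIV u x :> G x"
    and C11_bound: "norm (G x) \<le> Q"
    and C11_Lipschitz: "norm (G x - G y) \<le> Q * norm (x - y)"
  using assms by (auto simp: C11_def)

lemma C11_nonneg: "C11 Q u G \<Longrightarrow> 0 \<le> Q"
  by (meson C11_bound norm_ge_zero order_trans)

lemma GDERIV_bound:
  fixes u :: "'a::euclidean_space \<Rightarrow> real"
  assumes "convex S" "\<And>x. x \<in> S \<Longrightarrow> GDERIV u x :> G x" "\<And>x. x \<in> S \<Longrightarrow> norm (G x) \<le> Q"
    and "x \<in> S" "y \<in> S"
  shows "\<bar>u x - u y\<bar> \<le> Q * norm (x - y)"
proof -
  have "onorm (\<lambda>h. h \<bullet> G z) \<le> Q" if "z \<in> S" for z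
    using assms(3)[OF that] Cauchy_Schwarz_ineq2[of _ "G z"]
    by (intro onorm_le) (metis mult.commute mult_right_mono norm_ge_zero order_trans real_norm_def)
  then have "norm (u x - u y) \<le> Q * norm (x - y)"
    using assms by (intro differentiable_bound[where f' = "\<lambda>z h. h \<bullet> G z" and S = S])
      (auto simp: gderiv_def intro: has_derivative_at_withinI)
  then show ?thesis by simp
qed

lemma C11_value_Lipschitz: "C11 Q u G \<Longrightarrow> \<bar>u x - u y\<bar> \<le> Q * norm (x - y)"
  by (rule GDERIV_bound[of UNIV]) (auto simp: C11_def)

text \<open>The mean value inequality is applied to u minus its linear part at x, whose gradient G y
  - G x is at most Q |v| on the ball of radius |v|.\<close>

lemma C11_remainder:
  assumes "C11 Q u G"
  shows "\<bar>u (x + v) - u x - G x \<bullet> v\<bar> \<le> Q * (norm v)\<^sup>2"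
proof -
  have "\<bar>(u (x + v) - (x + v) \<bullet> G x) - (u x - x \<bullet> G x)\<bar> \<le> Q * norm v * norm (x + v - x)"
  proof (rule GDERIV_bound[where S = "cball x (norm v)" and G = "\<lambda>y. G y - G x"])
    show "GDERIV (\<lambda>y. u y - y \<bullet> G x) y :> G y - G x" for y
      using C11_GDERIV[OF assms, of y] unfolding gderiv_def
      by (auto intro!: derivative_eq_intros simp: inner_diff_right)
    show "norm (G y - G x) \<le> Q * norm v" if "y \<in> cball x (norm v)" for y
    proof -
      have "norm (y - x) \<le> norm v"
        using that by (simp add: dist_norm norm_minus_commute)
      then show ?thesis
        using C11_Lipschitz[OF assms, of y x] C11_nonneg[OF assms]
        by (meson mult_left_mono order_trans)
    qed
  qed (auto simp: dist_norm)
  then show ?thesis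
    by (simp add: inner_add_left inner_commute power2_eq_square algebra_simps)
qed

lemma GDERIV_continuous_on: "(\<And>x. GDERIV u x :> G x) \<Longrightarrow> continuous_on S u"
  unfolding gderiv_def by (rule has_derivative_continuous_on) (rule has_derivative_at_withinI)

lemma C11_continuous_on: "C11 Q u G \<Longrightarrow> continuous_on S u"
  by (rule GDERIV_continuous_on) (rule C11_GDERIV)

lemma Lipschitz_continuous_on:
  fixes f :: "'a::real_normed_vector \<Rightarrow> 'b::real_normed_vector"
  assumes "\<And>x y. norm (f x - f y) \<le> Q * norm (x - y)"
  shows "continuous_on S f"
proof (rule continuous_on_subset[OF lipschitz_on_continuous_on])
  have "norm (f x - f y) \<le> \<bar>Q\<bar> * norm (x - y)" for x y
    using assms[of x y] by (meson abs_ge_self mult_right_mono norm_ge_zero order_trans)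
  then show "\<bar>Q\<bar>-lipschitz_on UNIV f"
    by (auto simp: lipschitz_on_def dist_norm)
qed auto

lemma C11_grad_continuous_on: "C11 Q u G \<Longrightarrow> continuous_on S G"
  by (rule Lipschitz_continuous_on) (rule C11_Lipschitz)

text \<open>The field is described by its components because \<open>C11\<close> speaks of scalar
  functions; \<open>G t i\<close> is the i-th row of the Jacobian. Continuity in time is uniform in
  space, on each bounded time interval.\<close>

locale C11_field =
  fixes b :: "real \<Rightarrow> 'a::euclidean_space \<Rightarrow> 'a" and G :: "real \<Rightarrow> 'a \<Rightarrow> 'a \<Rightarrow> 'a" and M :: real
  assumes component_C11: "0 \<le> t \<Longrightarrow> i \<in> Basis \<Longrightarrow> C11 M (\<lambda>x. b t x \<bullet> i) (G t i)"
    and component_bound: "0 \<le> t \<Longrightarrow> i \<in> Basis \<Longrightarrow> \<bar>b t x \<bullet> i\<bar> \<le> M"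
    and time_uniform: "0 < e \<Longrightarrow> \<exists>d>0. \<forall>s\<in>{0..T}. \<forall>t\<in>{0..T}. \<bar>s - t\<bar> < d \<longrightarrow>
          (\<forall>x. norm (b s x - b t x) \<le> e)"
begin

text \<open>Summing component bounds over the basis gives a single constant that bounds the field,
  its Lipschitz constant, the transposed Jacobian and the Lipschitz constant of the latter.\<close>

definition C :: real where "C = M * DIM('a)"

lemma sum_Basis_le: "(\<And>i. i \<in> Basis \<Longrightarrow> f i \<le> M * c) \<Longrightarrow> (\<Sum>i\<in>(Basis::'a set). f i) \<le> C * c"
  using sum_bounded_above[of "Basis :: 'a set" f "M * c"] by (simp add: C_def mult_ac)

lemma bound: "0 \<le> t \<Longrightarrow> norm (b t x) \<le> C"
  using sum_Basis_le[of "\<lambda>i. \<bar>b t x \<bullet> i\<bar>" 1] component_bound norm_le_l1[of "b t x"] by force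

lemma C_nonneg: "0 \<le> C"
  using bound[of 0 0] norm_ge_zero order_trans by blast

lemma Lipschitz: "0 \<le> t \<Longrightarrow> norm (b t x - b t y) \<le> C * norm (x - y)"
  using sum_Basis_le[of "\<lambda>i. \<bar>(b t x - b t y) \<bullet> i\<bar>" "norm (x - y)"]
    C11_value_Lipschitz[OF component_C11, of t] norm_le_l1[of "b t x - b t y"]
  by (force simp: inner_diff_left)

text \<open>The sum is the transposed Jacobian of \<open>b t\<close> at x applied to v, the operator
  that the chain rule produces in \<open>C11_Euler_step\<close>.\<close>

lemma adjoint_bound:
  assumes "0 \<le> t" shows "norm (\<Sum>i\<in>Basis. (v \<bullet> i) *\<^sub>R G t i x) \<le> C * norm v"
proof -
  have "norm ((v \<bullet> i) *\<^sub>R G t i x) \<le> M * norm v" if "i \<in> Basis" for i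
    using mult_mono[OF Basis_le_norm[OF that, of v] C11_bound[OF component_C11[OF assms that]], of x]
    by (simp add: mult_ac)
  then show ?thesis
    by (intro order_trans[OF norm_sum] sum_Basis_le)
qed

lemma adjoint_Lipschitz:
  assumes "0 \<le> t"
  shows "norm ((\<Sum>i\<in>Basis. (v \<bullet> i) *\<^sub>R G t i x) - (\<Sum>i\<in>Basis. (v \<bullet> i) *\<^sub>R G t i y))
    \<le> C * (norm v * norm (x - y))"
proof -
  have "norm ((v \<bullet> i) *\<^sub>R (G t i x - G t i y)) \<le> M * (norm v * norm (x - y))" if "i \<in> Basis" for i
    using mult_mono[OF Basis_le_norm[OF that, of v] C11_Lipschitz[OF component_C11[OF assms that]], of x y]
    by (simp add: mult_ac)
  then show ?thesis
    unfolding sum_subtractf[symmetric] scaleR_diff_right[symmetric]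
    by (intro order_trans[OF norm_sum] sum_Basis_le)
qed

lemma field_has_derivative:
  assumes "0 \<le> t"
  shows "(b t has_derivative (\<lambda>v. \<Sum>i\<in>Basis. (v \<bullet> G t i x) *\<^sub>R i)) (at x)"
proof -
  have "((\<lambda>x. \<Sum>i\<in>Basis. (b t x \<bullet> i) *\<^sub>R i) has_derivative (\<lambda>v. \<Sum>i\<in>Basis. (v \<bullet> G t i x) *\<^sub>R i)) (at x)"
    using C11_GDERIV[OF component_C11[OF assms], of _ x] unfolding gderiv_def
    by (intro has_derivative_sum has_derivative_scaleR_left) auto
  then show ?thesis by (simp add: euclidean_representation)
qed

text \<open>With P x = x + h b t x, the gradient of u o P is the identity plus h times the
  transposed Jacobian, applied to Gu (P x). The Lipschitz estimate yields (1 + C h)^2 + C h, and the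
  cube is a convenient bound for it. What matters is growth by 1 + O(h) per step.\<close>

lemma C11_Euler_step:
  assumes u: "C11 Q u Gu" and t: "0 \<le> t" and h: "0 \<le> h"
  shows "\<exists>Gu'. C11 (Q * (1 + C * h) ^ 3) (\<lambda>x. u (x + h *\<^sub>R b t x)) Gu'"
proof (intro exI)
  define P where "P x = x + h *\<^sub>R b t x" for x
  define A where "A v x = (\<Sum>i\<in>Basis. (v \<bullet> i) *\<^sub>R G t i x)" for v x
  let ?G = "\<lambda>x. Gu (P x) + h *\<^sub>R A (Gu (P x)) x"
  have Q: "0 \<le> Q" by (rule C11_nonneg[OF u])
  have Ch: "0 \<le> C * h" using C_nonneg h by simp
  have A1: "norm (A v x) \<le> C * norm v" for v x
    unfolding A_def by (rule adjoint_bound[OF t])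
  have A2: "norm (A v x - A v y) \<le> C * (norm v * norm (x - y))" for v x y
    unfolding A_def by (rule adjoint_Lipschitz[OF t])
  have A3: "A v x - A w x = A (v - w) x" for v w x
    by (simp add: A_def inner_diff_left scaleR_diff_left sum_subtractf)
  have P: "norm (P x - P y) \<le> (1 + C * h) * norm (x - y)" for x y
  proof -
    have "norm (P x - P y) \<le> norm (x - y) + h * norm (b t x - b t y)"
      unfolding P_def using h norm_triangle_ineq[of "x - y" "h *\<^sub>R (b t x - b t y)"]
      by (simp add: add_diff_add scaleR_diff_right[symmetric])
    also have "\<dots> \<le> norm (x - y) + h * (C * norm (x - y))"
      using Lipschitz[OF t] h by (intro add_left_mono mult_left_mono)
    finally show ?thesis by (simp add: algebra_simps)
  qed
  have GP: "norm (Gu (P x) - Gu (P y)) \<le> Q * ((1 + C * h) * norm (x - y))" for x y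
    by (rule order_trans[OF C11_Lipschitz[OF u] mult_left_mono[OF P Q]])
  show "C11 (Q * (1 + C * h) ^ 3) (\<lambda>x. u (x + h *\<^sub>R b t x)) ?G"
    unfolding C11_def
  proof (intro conjI allI)
    fix x
    have "((\<lambda>x. u (P x)) has_derivative (\<lambda>v. (v + h *\<^sub>R (\<Sum>i\<in>Basis. (v \<bullet> G t i x) *\<^sub>R i)) \<bullet> Gu (P x))) (at x)"
      unfolding P_def
      by (rule has_derivative_compose[OF has_derivative_add[OF has_derivative_ident
            has_derivative_scaleR_right[OF field_has_derivative[OF t]]] C11_GDERIV[OF u, unfolded gderiv_def]])
    moreover have "(v + h *\<^sub>R (\<Sum>i\<in>Basis. (v \<bullet> G t i x) *\<^sub>R i)) \<bullet> Gu (P x) = v \<bullet> ?G x" for v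
      by (simp add: A_def inner_add_left inner_add_right inner_sum_left inner_sum_right
          inner_commute[of "Gu (P x)"] mult_ac)
    ultimately show "GDERIV (\<lambda>x. u (x + h *\<^sub>R b t x)) x :> ?G x"
      by (simp add: gderiv_def P_def)
  next
    fix x
    have "norm (?G x) \<le> norm (Gu (P x)) + h * norm (A (Gu (P x)) x)"
      using h norm_triangle_ineq[of "Gu (P x)" "h *\<^sub>R A (Gu (P x)) x"] by simp
    also have "\<dots> \<le> Q + h * (C * Q)"
      using C11_bound[OF u, of "P x"] A1[of "Gu (P x)" x] C_nonneg h
      by (intro add_mono mult_left_mono) (auto intro: order_trans mult_left_mono)
    also have "\<dots> = Q * (1 + C * h) ^ 1" by (simp add: algebra_simps)
    also have "\<dots> \<le> Q * (1 + C * h) ^ 3"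
      using Q Ch by (intro mult_left_mono power_increasing) auto
    finally show "norm (?G x) \<le> Q * (1 + C * h) ^ 3" .
  next
    fix x y :: 'a
    define n where "n = norm (x - y)"
    have n: "0 \<le> n" by (simp add: n_def)
    \<comment> \<open>Adding and subtracting the transposed Jacobian at x applied to Gu (P y)
      separates the variation of the gradient of u from the variation of the Jacobian.\<close>
    have "?G x - ?G y = (Gu (P x) - Gu (P y)) + h *\<^sub>R (A (Gu (P x) - Gu (P y)) x) +
        h *\<^sub>R (A (Gu (P y)) x - A (Gu (P y)) y)"
      by (simp add: A3[symmetric] algebra_simps)
    also have "norm \<dots> \<le> norm (Gu (P x) - Gu (P y)) + h * norm (A (Gu (P x) - Gu (P y)) x) +
        h * norm (A (Gu (P y)) x - A (Gu (P y)) y)"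
      using h by (intro order_trans[OF norm_triangle_ineq] add_mono) auto
    also have "\<dots> \<le> norm (Gu (P x) - Gu (P y)) + h * (C * norm (Gu (P x) - Gu (P y))) + h * (C * (Q * n))"
    proof -
      have "C * (norm (Gu (P y)) * n) \<le> C * (Q * n)"
        using C_nonneg n C11_bound[OF u] by (intro mult_left_mono mult_right_mono)
      then show ?thesis
        using h A1[of "Gu (P x) - Gu (P y)" x] A2[of "Gu (P y)" x y]
        by (intro add_mono mult_left_mono) (auto simp: n_def)
    qed
    also have "\<dots> = (1 + C * h) * norm (Gu (P x) - Gu (P y)) + (C * h) * (Q * n)"
      by (simp add: algebra_simps)
    also have "\<dots> \<le> (1 + C * h) * (Q * ((1 + C * h) * n)) + (C * h) * (Q * n)"
      using GP[of x y] Ch Q by (intro add_mono mult_left_mono) (auto simp: n_def)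
    also have "\<dots> = Q * n * ((1 + C * h)\<^sup>2 + C * h)" by (simp add: algebra_simps power2_eq_square)
    also have "\<dots> \<le> Q * n * (1 + C * h) ^ 3"
    proof (intro mult_left_mono)
      have "0 \<le> (C * h) * (C * h) * 2 + (C * h) ^ 3" using Ch by simp
      then show "(1 + C * h)\<^sup>2 + C * h \<le> (1 + C * h) ^ 3"
        by (simp add: power2_eq_square power3_eq_cube algebra_simps)
    qed (use Q n in simp)
    finally show "norm (?G x - ?G y) \<le> Q * (1 + C * h) ^ 3 * norm (x - y)"
      by (simp add: n_def mult_ac)
  qed
qed

lemma continuous_along:
  assumes y: "continuous_on {0..} y"
  shows "continuous_on {0..} (\<lambda>s. b s (y s))"
proof (rule continuous_onI)
  fix s e :: real assume s: "s \<in> {0..}" and e: "0 < e"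
  obtain d1 where d1: "d1 > 0" "\<And>s' t x. s' \<in> {0..s+1} \<Longrightarrow> t \<in> {0..s+1} \<Longrightarrow> \<bar>s' - t\<bar> < d1 \<Longrightarrow> norm (b s' x - b t x) \<le> e / 2"
    using time_uniform[of "e / 2" "s + 1"] e by auto
  have "e / (2 * (C + 1)) > 0" using e C_nonneg by simp
  then obtain d2 where d2: "d2 > 0" "\<And>t. t \<in> {0..} \<Longrightarrow> dist t s < d2 \<Longrightarrow> dist (y t) (y s) < e / (2 * (C + 1))"
    using y s unfolding continuous_on_iff by metis
  have "dist (b t (y t)) (b s (y s)) \<le> e" if t: "t \<in> {0..}" "dist t s < min 1 (min d1 d2)" for t
  proof -
    have "norm (b t (y t) - b s (y t)) \<le> e / 2"
      using t s by (intro d1(2)) (auto simp: dist_real_def)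
    moreover have "norm (b s (y t) - b s (y s)) \<le> e / 2"
    proof -
      have "norm (b s (y t) - b s (y s)) \<le> C * norm (y t - y s)" using s by (intro Lipschitz) auto
      also have "\<dots> \<le> (C + 1) * (e / (2 * (C + 1)))"
        using d2(2)[OF t(1)] t(2) C_nonneg by (intro mult_mono) (auto simp: dist_norm)
      also have "\<dots> = e / 2" using C_nonneg by (simp add: field_simps)
      finally show ?thesis .
    qed
    ultimately show ?thesis
      using norm_triangle_ineq[of "b t (y t) - b s (y t)" "b s (y t) - b s (y s)"]
      by (simp add: dist_norm)
  qed
  then show "\<exists>d>0. \<forall>x'\<in>{0..}. dist x' s < d \<longrightarrow> dist (b x' (y x')) (b s (y s)) \<le> e"
    using d1(1) d2(1) by (intro exI[of _ "min 1 (min d1 d2)"]) auto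
qed

lemma integrable_along:
  assumes "continuous_on {0..} y" "0 \<le> s"
  shows "(\<lambda>s. b s (y s)) integrable_on {s..t}"
  using assms by (intro integrable_continuous_real continuous_on_subset[OF continuous_along]) auto

lemma integral_along_Lipschitz:
  assumes y: "continuous_on {0..} y" and st: "0 \<le> s" "s \<le> t"
  shows "norm (integral {0..t} (\<lambda>s. b s (y s)) - integral {0..s} (\<lambda>s. b s (y s))) \<le> C * (t - s)"
proof -
  have "integral {0..t} (\<lambda>s. b s (y s)) - integral {0..s} (\<lambda>s. b s (y s)) = integral {s..t} (\<lambda>s. b s (y s))"
    using Henstock_Kurzweil_Integration.integral_combine[OF st integrable_along[OF y]]
    by (simp add: algebra_simps)
  moreover have "norm (integral {s..t} (\<lambda>s. b s (y s))) \<le> C * (t - s)"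
    using st by (intro integral_bound continuous_on_subset[OF continuous_along[OF y]]) (auto intro: bound)
  ultimately show ?thesis by simp
qed

end

section \<open>Flows and Euler schemes\<close>

lemma
  fixes K :: "'a::t2_space set"
  assumes "\<rho> \<in> prob_on K" "compact K"
  shows prob_on_prob_space: "prob_space \<rho>"
    and sets_prob_on: "sets \<rho> = sets borel"
    and AE_prob_on: "AE x in \<rho>. x \<in> K"
proof -
  show p: "prob_space \<rho>" and s: "sets \<rho> = sets borel"
    using assms by (auto simp: prob_on_def)
  interpret prob_space \<rho> by (rule p)
  have "K \<in> events" using assms(2) by (simp add: s borel_closed compact_imp_closed)
  then show "AE x in \<rho>. x \<in> K"
    using assms(1) by (intro AE_prob_1) (simp add: prob_on_def measure_def)
qed

lemma borel_measurable_prob_on: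
  assumes "\<rho> \<in> prob_on K" "continuous_on UNIV g"
  shows "g \<in> borel_measurable \<rho>"
  using borel_measurable_continuous_onI[OF assms(2)] assms(1)
  by (simp add: prob_on_def cong: measurable_cong_sets)

lemma integrable_prob_on:
  fixes g :: "'a::t2_space \<Rightarrow> 'b::{banach, second_countable_topology}"
  assumes \<rho>: "\<rho> \<in> prob_on K" "compact K" and g: "continuous_on UNIV g"
  shows "integrable \<rho> g"
proof -
  interpret prob_space \<rho> using \<rho> by (rule prob_on_prob_space)
  obtain B where "\<And>x. x \<in> K \<Longrightarrow> norm (g x) \<le> B"
    using compact_imp_bounded[OF compact_continuous_image[OF continuous_on_subset[OF g subset_UNIV] \<rho>(2)]]
    unfolding bounded_iff by auto
  then show ?thesis
    using AE_prob_on[OF \<rho>] by (intro integrable_const_bound[where B = B] borel_measurable_prob_on[OF \<rho>(1) g]) auto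
qed

lemma integral_prob_on_bound:
  fixes g :: "'a::t2_space \<Rightarrow> 'b::{banach, second_countable_topology}"
  assumes \<rho>: "\<rho> \<in> prob_on K" "compact K" and g: "continuous_on UNIV g" and B: "\<And>x. x \<in> K \<Longrightarrow> norm (g x) \<le> B"
  shows "norm (\<integral>x. g x \<partial>\<rho>) \<le> B"
proof -
  interpret prob_space \<rho> using \<rho> by (rule prob_on_prob_space)
  have "norm (\<integral>x. g x \<partial>\<rho>) \<le> (\<integral>x. norm (g x) \<partial>\<rho>)" by simp
  also have "\<dots> \<le> (\<integral>x. B \<partial>\<rho>)"
    using AE_prob_on[OF \<rho>] integrable_prob_on[OF \<rho> g] B by (intro integral_mono_AE) auto
  finally show ?thesis by (simp add: prob_space)
qed

lemma compact_partition_of_unity: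
  fixes K :: "'a::metric_space set"
  assumes "compact K" "0 < e"
  obtains X \<phi> where "finite X" "X \<subseteq> K" "\<And>z. z \<in> X \<Longrightarrow> continuous_on UNIV (\<phi> z)" "\<And>z. z \<in> X \<Longrightarrow> bounded (range (\<phi> z))"
    "\<And>z x. z \<in> X \<Longrightarrow> 0 \<le> (\<phi> z x :: real)" "\<And>z x. z \<in> X \<Longrightarrow> \<phi> z x \<noteq> 0 \<Longrightarrow> dist x z < e"
    "\<And>x. x \<in> K \<Longrightarrow> (\<Sum>z\<in>X. \<phi> z x) = 1"
proof -
  obtain X where X: "finite X" "X \<subseteq> K" "K \<subseteq> (\<Union>z\<in>X. ball z (e / 2))"
    using compactE_image[OF assms(1), of K "\<lambda>z. ball z (e / 2)"] assms(2) by force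
  define w where "w z x = max 0 (e - dist x z)" for z x :: 'a
  \<comment> \<open>On K the centres form an e/2-net, so the sum is at least e/2 and the maximum is
    inactive. Off K the maximum keeps the denominator positive, so the weights are continuous and
    bounded on the whole space.\<close>
  define W where "W x = max (e / 2) (\<Sum>z\<in>X. w z x)" for x
  have W: "W x \<ge> e / 2" "W x > 0" for x using assms(2) by (auto simp: W_def max_def)
  have w: "0 \<le> w z x" "w z x \<le> e" for z x using assms(2) by (auto simp: w_def)
  have cont: "continuous_on UNIV (w z)" for z unfolding w_def by (intro continuous_intros)
  show thesis
  proof (rule that[of X "\<lambda>z x. w z x / W x"])
    show "continuous_on UNIV (\<lambda>x. w z x / W x)" for z
      using W(2) less_imp_neq[OF W(2)] unfolding W_def by (intro continuous_intros cont) (auto simp: W_def)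
    have "\<bar>w z x / W x\<bar> \<le> 2" for z x
      using w[of z x] W[of x] by (simp add: abs_of_nonneg divide_le_eq)
    then show "bounded (range (\<lambda>x. w z x / W x))" for z
      by (auto simp: bounded_iff)
    show "(\<Sum>z\<in>X. w z x / W x) = 1" if "x \<in> K" for x
    proof -
      have "x \<in> (\<Union>z\<in>X. ball z (e / 2))" using X(3) that by (rule subsetD)
      then obtain z where z: "z \<in> X" "dist z x < e / 2" by (elim UN_E) simp
      have "e / 2 \<le> w z x" using z by (simp add: w_def dist_commute max_def)
      also have "\<dots> \<le> (\<Sum>z\<in>X. w z x)" using z X(1) w by (intro member_le_sum) auto
      finally have "W x = (\<Sum>z\<in>X. w z x)" by (simp add: W_def)
      then show ?thesis using W(2)[of x] by (simp add: sum_divide_distrib[symmetric])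
    qed
    show "dist x z < e" if "w z x / W x \<noteq> 0" for z x
      using that W(2)[of x] by (auto simp: w_def max_def split: if_splits)
  qed (use X w W(2) in \<open>auto intro: divide_nonneg_pos\<close>)
qed

text \<open>Narrow continuity in time is uniform over equi-Lipschitz integrands, because a partition of
  unity reduces those to finitely many.\<close>

lemma narrowly_continuous_equi_Lipschitz:
  fixes \<rho> :: "real \<Rightarrow> 'a::euclidean_space measure"
  assumes K: "compact K" and \<rho>: "\<And>t. 0 \<le> t \<Longrightarrow> \<rho> t \<in> prob_on K" and cont: "narrowly_continuous \<rho>"
    and L: "0 \<le> L" and e: "0 < e"
  shows "\<exists>d>0. \<forall>s\<in>{0..T}. \<forall>t\<in>{0..T}. \<bar>s - t\<bar> < d \<longrightarrow>
      (\<forall>g::'a \<Rightarrow> real. (\<forall>x. \<bar>g x\<bar> \<le> L) \<and> (\<forall>x y. \<bar>g x - g y\<bar> \<le> L * norm (x - y)) \<longrightarrow>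
         \<bar>(\<integral>x. g x \<partial>\<rho> s) - (\<integral>x. g x \<partial>\<rho> t)\<bar> \<le> e)"
proof -
  \<comment> \<open>Replacing g by its values at the centres costs L \<epsilon> \<le> e/4 at each of
    the two times; adding 1 to L avoids division by zero.\<close>
  define \<epsilon> where "\<epsilon> = e / (4 * (L + 1))"
  have \<epsilon>: "\<epsilon> > 0" "L * \<epsilon> \<le> e / 4" using e L by (auto simp: \<epsilon>_def field_simps)
  obtain X and \<phi> :: "'a \<Rightarrow> 'a \<Rightarrow> real" where X: "finite X" "X \<subseteq> K" "\<And>z. z \<in> X \<Longrightarrow> continuous_on UNIV (\<phi> z)" "\<And>z. z \<in> X \<Longrightarrow> bounded (range (\<phi> z))"
    "\<And>z x. z \<in> X \<Longrightarrow> 0 \<le> \<phi> z x" "\<And>z x. z \<in> X \<Longrightarrow> \<phi> z x \<noteq> 0 \<Longrightarrow> dist x z < \<epsilon>"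
    "\<And>x. x \<in> K \<Longrightarrow> (\<Sum>z\<in>X. \<phi> z x) = 1"
    by (rule compact_partition_of_unity[OF K \<epsilon>(1)]) (rule that, assumption+)
  \<comment> \<open>The remaining half of e is shared among the weights of the partition, each
    multiplied by a value of g that is at most L + 1.\<close>
  define \<eta> where "\<eta> = e / (2 * (L + 1) * (card X + 1))"
  have \<eta>: "\<eta> > 0" using e L by (simp add: \<eta>_def)
  have "\<exists>d>0. \<forall>s\<in>{0..T}. \<forall>t\<in>{0..T}. \<bar>s - t\<bar> < d \<longrightarrow> \<bar>(\<integral>x. \<phi> z x \<partial>\<rho> s) - (\<integral>x. \<phi> z x \<partial>\<rho> t)\<bar> < \<eta>"
    if "z \<in> X" for z
  proof -
    have *: "continuous_on {0..} (\<lambda>t. \<integral>x. \<phi> z x \<partial>\<rho> t)"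
      using cont[unfolded narrowly_continuous_def, rule_format, of "\<phi> z"] X(3,4)[OF that] by simp
    have "uniformly_continuous_on {0..T} (\<lambda>t. \<integral>x. \<phi> z x \<partial>\<rho> t)"
      by (intro compact_uniformly_continuous continuous_on_subset[OF *]) auto
    then show ?thesis
      using \<eta> unfolding uniformly_continuous_on_def dist_real_def by (simp add: abs_minus_commute)
  qed
  then obtain d where d: "\<And>z. z \<in> X \<Longrightarrow> d z > 0" "\<And>z s t. z \<in> X \<Longrightarrow> s \<in> {0..T} \<Longrightarrow> t \<in> {0..T} \<Longrightarrow> \<bar>s - t\<bar> < d z \<Longrightarrow>
      \<bar>(\<integral>x. \<phi> z x \<partial>\<rho> s) - (\<integral>x. \<phi> z x \<partial>\<rho> t)\<bar> < \<eta>"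
    by metis
  define d0 where "d0 = Min (insert 1 (d ` X))"
  have d0: "d0 > 0" "\<And>z. z \<in> X \<Longrightarrow> d0 \<le> d z"
    using X(1) d(1) by (auto simp: d0_def)
  show ?thesis
  proof (intro exI[of _ d0] conjI d0(1) ballI impI allI)
    fix s t and g :: "'a \<Rightarrow> real"
    assume st: "s \<in> {0..T}" "t \<in> {0..T}" "\<bar>s - t\<bar> < d0"
    assume "(\<forall>x. \<bar>g x\<bar> \<le> L) \<and> (\<forall>x y. \<bar>g x - g y\<bar> \<le> L * norm (x - y))"
    then have gL: "\<bar>g x\<bar> \<le> L" "\<bar>g x - g y\<bar> \<le> L * norm (x - y)" for x y by auto
    have g_cont: "continuous_on UNIV g" by (rule Lipschitz_continuous_on[of g L]) (use gL in simp)
    define S where "S x = (\<Sum>z\<in>X. g z * \<phi> z x)" for x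
    have S_cont: "continuous_on UNIV S" unfolding S_def by (intro continuous_intros X)
    have near: "\<bar>(\<integral>x. g x \<partial>\<rho> u) - (\<Sum>z\<in>X. g z * (\<integral>x. \<phi> z x \<partial>\<rho> u))\<bar> \<le> e / 4" if u: "0 \<le> u" for u
    proof -
      have "\<bar>g x - S x\<bar> \<le> L * \<epsilon>" if x: "x \<in> K" for x
      proof -
        have "g x - S x = (\<Sum>z\<in>X. (g x - g z) * \<phi> z x)"
          using X(7)[OF x] by (simp add: S_def left_diff_distrib sum_subtractf sum_distrib_left[symmetric])
        also have "\<bar>\<dots>\<bar> \<le> (\<Sum>z\<in>X. L * \<epsilon> * \<phi> z x)"
        proof (intro sum_abs[THEN order_trans] sum_mono)
          fix z assume z: "z \<in> X"
          show "\<bar>(g x - g z) * \<phi> z x\<bar> \<le> L * \<epsilon> * \<phi> z x"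
          proof (cases "\<phi> z x = 0")
            case False
            have "\<bar>g x - g z\<bar> \<le> L * \<epsilon>"
              using gL(2)[of x z] X(6)[OF z False] L mult_left_mono[of "norm (x - z)" \<epsilon> L] by (simp add: dist_norm)
            then show ?thesis using X(5)[OF z, of x] by (simp add: abs_mult mult_right_mono)
          qed simp
        qed
        finally show ?thesis using X(7)[OF x] by (simp add: sum_distrib_left[symmetric])
      qed
      then have "norm (\<integral>x. g x - S x \<partial>\<rho> u) \<le> L * \<epsilon>"
        by (intro integral_prob_on_bound[OF \<rho>[OF u] K]) (auto intro!: continuous_intros g_cont S_cont)
      moreover have "(\<integral>x. S x \<partial>\<rho> u) = (\<Sum>z\<in>X. g z * (\<integral>x. \<phi> z x \<partial>\<rho> u))"
        unfolding S_def using integrable_prob_on[OF \<rho>[OF u] K X(3)] by simp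
      ultimately show ?thesis
        using \<epsilon>(2) integrable_prob_on[OF \<rho>[OF u] K g_cont] integrable_prob_on[OF \<rho>[OF u] K S_cont] by simp
    qed
    have "(\<Sum>z\<in>X. g z * (\<integral>x. \<phi> z x \<partial>\<rho> s)) - (\<Sum>z\<in>X. g z * (\<integral>x. \<phi> z x \<partial>\<rho> t)) =
        (\<Sum>z\<in>X. g z * ((\<integral>x. \<phi> z x \<partial>\<rho> s) - (\<integral>x. \<phi> z x \<partial>\<rho> t)))"
      by (simp add: sum_subtractf right_diff_distrib)
    also have "\<bar>\<dots>\<bar> \<le> (\<Sum>z\<in>X. \<bar>g z * ((\<integral>x. \<phi> z x \<partial>\<rho> s) - (\<integral>x. \<phi> z x \<partial>\<rho> t))\<bar>)"
      by (rule sum_abs)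
    also have "\<dots> \<le> (\<Sum>z\<in>X. (L + 1) * \<eta>)"
      unfolding abs_mult
    proof (intro sum_mono mult_mono)
      fix z assume z: "z \<in> X"
      show "\<bar>g z\<bar> \<le> L + 1" using gL(1)[of z] by simp
      show "\<bar>(\<integral>x. \<phi> z x \<partial>\<rho> s) - (\<integral>x. \<phi> z x \<partial>\<rho> t)\<bar> \<le> \<eta>"
        using d(2)[OF z st(1,2)] d0(2)[OF z] st(3) by simp
    qed (use L in auto)
    also have "\<dots> \<le> (card X + 1) * ((L + 1) * \<eta>)"
      using L \<eta> by (simp add: mult_right_mono)
    also have "\<dots> = e / 2"
    proof -
      have "L + 1 \<noteq> 0" "real (card X) + 1 \<noteq> 0" using L by linarith+
      then show ?thesis by (simp add: \<eta>_def del: distrib_right_numeral) (simp add: field_simps)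
    qed
    finally show "\<bar>(\<integral>x. g x \<partial>\<rho> s) - (\<integral>x. g x \<partial>\<rho> t)\<bar> \<le> e"
      using near[of s] near[of t] st(1,2) unfolding atLeastAtMost_iff by linarith
  qed
qed

section \<open>Existence of a global flow and the error of its Euler scheme\<close>

lemma integral_exp_mult:
  assumes "0 < (l::real)" "0 \<le> t"
  shows "integral {0..t} (\<lambda>s. exp (l * s)) = (exp (l * t) - 1) / l"
proof -
  have "((\<lambda>s. exp (l * s)) has_integral exp (l * t) / l - exp (l * 0) / l) {0..t}"
    using assms by (intro fundamental_theorem_of_calculus)
      (auto intro!: derivative_eq_intros simp: has_real_derivative_iff_has_vector_derivative[symmetric])
  then show ?thesis by (simp add: integral_unique diff_divide_distrib)
qed

context C11_field begin

lemma ex_flow: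
  shows "\<exists>X. continuous_on {0..} X \<and> (\<forall>t\<ge>0. X t = x + integral {0..t} (\<lambda>s. b s (X s)))"
proof -
  \<comment> \<open>The weight \<open>exp (- l * t)\<close> turns the Picard operator into a contraction on the whole half-line.\<close>
  define l where "l = C + 1"
  have l: "l > 0" using C_nonneg by (simp add: l_def)
  define y where "y Z s = x + exp (l * s) *\<^sub>R apply_bcontfun Z s" for Z s
  define I where "I Z t = integral {0..t} (\<lambda>s. b s (y Z s))" for Z t
  \<comment> \<open>The unknown Z is the weighted deviation of the curve from x. Bounded continuous
    functions live on the whole line, so negative times are folded to 0. Integrating the weight
    gains 1 / l, which gives the contraction factor C / (C + 1).\<close>
  define op where "op Z t = exp (- (l * max 0 t)) *\<^sub>R I Z (max 0 t)" for Z t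
  have y_cont: "continuous_on S (y Z)" for Z S
    unfolding y_def by (intro continuous_intros continuous_on_subset[OF continuous_on_apply_bcontfun]) auto
  have I_Lip: "norm (I Z t - I Z s) \<le> C * (t - s)" if "0 \<le> s" "s \<le> t" for Z s t
    unfolding I_def by (rule integral_along_Lipschitz[OF y_cont that])
  have I_bound: "norm (I Z t) \<le> C * t" if "0 \<le> t" for Z t
    using I_Lip[of 0 t Z] that by (simp add: I_def)
  have I_cont: "continuous_on UNIV (\<lambda>t. I Z (max 0 t))" for Z
  proof (rule Lipschitz_continuous_on)
    fix s t :: real
    have *: "norm (I Z (max 0 t) - I Z (max 0 s)) \<le> C * norm (t - s)" if "s \<le> t" for s t
      using I_Lip[of "max 0 s" "max 0 t" Z] that mult_left_mono[OF _ C_nonneg, of "max 0 t - max 0 s" "t - s"] by force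
    show "norm (I Z (max 0 s) - I Z (max 0 t)) \<le> C * norm (s - t)"
      using *[of s t] *[of t s] by (cases "s \<le> t") (auto simp: norm_minus_commute)
  qed
  have op_bcontfun: "op Z \<in> bcontfun" for Z
  proof (rule bcontfun_normI[where b = "C / l"])
    show "continuous_on UNIV (op Z)"
      unfolding op_def by (intro continuous_intros I_cont)
    show "norm (op Z t) \<le> C / l" for t
    proof -
      define u where "u = max 0 t"
      have u: "0 \<le> u" by (simp add: u_def)
      have "l * u \<le> exp (l * u)" using exp_ge_add_one_self[of "l * u"] by linarith
      then have "exp (- (l * u)) * u \<le> 1 / l" using l by (simp add: exp_minus field_simps)
      then have "C * (exp (- (l * u)) * u) \<le> C * (1 / l)" by (rule mult_left_mono) (rule C_nonneg)
      moreover have "norm (op Z t) \<le> exp (- (l * u)) * (C * u)"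
        using I_bound[OF u, of Z] by (simp add: op_def u_def mult_left_mono)
      ultimately show ?thesis by (simp add: mult_ac)
    qed
  qed
  have "\<exists>!Z. Bcontfun (op Z) = Z"
  proof (rule banach_fix_type[where c = "C / l"])
    show "0 \<le> C / l" "C / l < 1" using C_nonneg by (auto simp: l_def)
    show "\<forall>Z Z'. dist (Bcontfun (op Z)) (Bcontfun (op Z')) \<le> C / l * dist Z Z'"
    proof (intro allI dist_bound)
      fix Z Z' :: "real \<Rightarrow>\<^sub>C 'a" and t :: real
      define u where "u = max 0 t"
      have u: "0 \<le> u" by (simp add: u_def)
      have int: "(\<lambda>s. b s (y Z s)) integrable_on {0..u}" for Z
        by (rule integrable_along[OF y_cont]) simp
      have "norm (I Z u - I Z' u) = norm (integral {0..u} (\<lambda>s. b s (y Z s) - b s (y Z' s)))"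
        unfolding I_def by (subst Henstock_Kurzweil_Integration.integral_diff) (auto intro: int)
      also have "\<dots> \<le> integral {0..u} (\<lambda>s. (C * dist Z Z') * exp (l * s))"
      proof (rule integral_norm_bound_integral)
        fix s assume s: "s \<in> {0..u}"
        have "norm (b s (y Z s) - b s (y Z' s)) \<le> C * norm (y Z s - y Z' s)"
          using s by (intro Lipschitz) auto
        also have "norm (y Z s - y Z' s) = exp (l * s) * dist (apply_bcontfun Z s) (apply_bcontfun Z' s)"
          by (simp add: y_def dist_norm scaleR_diff_right[symmetric])
        also have "C * \<dots> \<le> C * (exp (l * s) * dist Z Z')"
          using C_nonneg dist_bounded by (intro mult_left_mono) auto
        finally show "norm (b s (y Z s) - b s (y Z' s)) \<le> (C * dist Z Z') * exp (l * s)" by (simp add: mult_ac)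
      qed (intro int Henstock_Kurzweil_Integration.integrable_diff integrable_continuous_real continuous_intros)+
      also have "\<dots> = C * dist Z Z' * ((exp (l * u) - 1) / l)"
        by (simp add: integral_exp_mult[OF l u])
      also have "\<dots> \<le> C * dist Z Z' * (exp (l * u) / l)"
        using C_nonneg l by (intro mult_left_mono divide_right_mono) auto
      finally have "exp (- (l * u)) * norm (I Z u - I Z' u) \<le> exp (- (l * u)) * (C * dist Z Z' * (exp (l * u) / l))"
        by (rule mult_left_mono) simp
      also have "\<dots> = C / l * dist Z Z'" by (simp add: exp_minus)
      finally show "dist (apply_bcontfun (Bcontfun (op Z)) t) (apply_bcontfun (Bcontfun (op Z')) t) \<le> C / l * dist Z Z'"
        by (simp add: Bcontfun_inverse op_bcontfun op_def u_def dist_norm scaleR_diff_right[symmetric])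
    qed
  qed
  then obtain Z where Z: "Bcontfun (op Z) = Z" by blast
  have "apply_bcontfun Z t = op Z t" for t
    using arg_cong[OF Z, of apply_bcontfun] by (simp add: Bcontfun_inverse op_bcontfun)
  then have "y Z t = x + integral {0..t} (\<lambda>s. b s (y Z s))" if "0 \<le> t" for t
    using that by (simp add: y_def[of Z t] op_def I_def scaleR_scaleR exp_add[symmetric] del: scaleR_scaleR)
      (simp add: exp_add[symmetric])
  then show ?thesis using y_cont by blast
qed

text \<open>The solution curve is chosen separately for each x, so no dependence on x is built in;
  measurability in x comes later from the Euler scheme.\<close>

definition flow :: "real \<Rightarrow> 'a \<Rightarrow> 'a" where
  "flow t x = (SOME X. continuous_on {0..} X \<and> (\<forall>t\<ge>0. X t = x + integral {0..t} (\<lambda>s. b s (X s)))) t"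

lemma flow_continuous: "continuous_on {0..} (\<lambda>t. flow t x)"
  and flow_integral: "0 \<le> t \<Longrightarrow> flow t x = x + integral {0..t} (\<lambda>s. b s (flow s x))"
  using someI_ex[OF ex_flow[of x]] unfolding flow_def by auto

lemma flow_0: "flow 0 x = x"
  using flow_integral[of 0 x] by simp

lemma flow_increment:
  assumes "0 \<le> s" "s \<le> t"
  shows "flow t x - flow s x = integral {s..t} (\<lambda>u. b u (flow u x))"
  using Henstock_Kurzweil_Integration.integral_combine[OF assms integrable_along[OF flow_continuous]]
    flow_integral[of s x] flow_integral[of t x] assms
  by (simp add: algebra_simps)

lemma flow_time_Lipschitz: "0 \<le> s \<Longrightarrow> s \<le> t \<Longrightarrow> norm (flow t x - flow s x) \<le> C * (t - s)"
  using integral_along_Lipschitz[OF flow_continuous, of s t x] by (simp add: flow_integral[of _ x])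

lemma flow_has_vector_derivative:
  assumes "0 \<le> t"
  shows "((\<lambda>t. flow t x) has_vector_derivative b t (flow t x)) (at t within {0..})"
proof -
  have "((\<lambda>u. integral {0..u} (\<lambda>s. b s (flow s x))) has_vector_derivative b t (flow t x)) (at t within {0..t + 1})"
    using assms by (intro integral_has_vector_derivative continuous_on_subset[OF continuous_along[OF flow_continuous]]) auto
  then have "((\<lambda>u. x + integral {0..u} (\<lambda>s. b s (flow s x))) has_vector_derivative b t (flow t x)) (at t within {0..t + 1})"
    by (auto intro!: derivative_eq_intros)
  then have "((\<lambda>t. flow t x) has_vector_derivative b t (flow t x)) (at t within {0..t + 1})"
    by (rule has_vector_derivative_transform[rotated 2]) (use assms in \<open>auto simp: flow_integral[of _ x]\<close>)
  moreover have "at t within {0..t + 1} = at t within {0..}"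
    using assms by (intro at_within_nhd[of _ "{..<t + 1}"]) auto
  ultimately show ?thesis by simp
qed

fun euler :: "real \<Rightarrow> nat \<Rightarrow> 'a \<Rightarrow> 'a" where
  "euler h 0 x = x"
| "euler h (Suc k) x = euler h k x + h *\<^sub>R b (k * h) (euler h k x)"

lemma continuous_on_euler: "0 \<le> h \<Longrightarrow> continuous_on S (euler h k)"
proof (induction k arbitrary: S)
  case (Suc k)
  have b: "continuous_on UNIV (b (k * h))" by (rule Lipschitz_continuous_on[OF Lipschitz]) (use Suc in auto)
  have E: "continuous_on S (euler h k)" by (rule Suc.IH) (rule Suc.prems)
  show ?case
    using continuous_on_add[OF E continuous_on_scaleR[OF continuous_on_const continuous_on_compose2[OF b E subset_UNIV]]]
    by simp
qed (simp add: continuous_on_id)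

text \<open>A step commits the local defect h (e + C C h): e pays for freezing time, and C C h for
  the distance the trajectory moves within the step. Earlier errors are amplified by 1 + C h, the
  discrete Gronwall factor.\<close>

lemma euler_error:
  assumes h: "0 \<le> h" and T: "real N * h \<le> T"
    and e: "\<And>s t x. s \<in> {0..T} \<Longrightarrow> t \<in> {0..T} \<Longrightarrow> \<bar>s - t\<bar> \<le> h \<Longrightarrow> norm (b s x - b t x) \<le> e"
  shows "k \<le> N \<Longrightarrow> norm (euler h k x - flow (k * h) x) \<le> k * h * (e + C * C * h) * (1 + C * h) ^ k"
proof (induction k)
  case 0 then show ?case by (simp add: flow_0)
next
  case (Suc k)
  define t where "t = k * h"
  have "real (Suc k) * h \<le> real N * h" using Suc.prems h by (intro mult_right_mono) auto
  then have t: "0 \<le> t" "t + h \<le> T" using h T by (auto simp: t_def algebra_simps)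
  have Ch: "0 \<le> C * h" using C_nonneg h by simp
  have e0: "0 \<le> e" using e[of t t] t h norm_ge_zero order_trans by (metis abs_zero add_increasing2 atLeastAtMost_iff diff_self le_add_same_cancel1 order_trans)
  let ?E = "euler h k x" and ?X = "\<lambda>s. flow s x"
  have step: "norm (?X (t + h) - ?X t - h *\<^sub>R b t (?X t)) \<le> (e + C * C * h) * h"
  proof -
    have "?X (t + h) - ?X t - h *\<^sub>R b t (?X t) = integral {t..t+h} (\<lambda>s. b s (?X s) - b t (?X t))"
      using t h by (subst Henstock_Kurzweil_Integration.integral_diff)
        (auto intro!: integrable_along flow_continuous simp: flow_increment)
    also have "norm \<dots> \<le> (e + C * C * h) * (t + h - t)"
    proof (rule integral_bound)
      fix s assume s: "s \<in> {t..t + h}"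
      have "norm (b s (?X s) - b t (?X s)) \<le> e" using s t h by (intro e) auto
      moreover have "norm (b t (?X s) - b t (?X t)) \<le> C * (C * h)"
      proof -
        have "norm (?X s - ?X t) \<le> C * h"
          using flow_time_Lipschitz[of t s x] s t C_nonneg mult_left_mono[of "s - t" h C] by auto
        then show ?thesis using Lipschitz[OF t(1), of "?X s" "?X t"] C_nonneg mult_left_mono order_trans by blast
      qed
      ultimately show "norm (b s (?X s) - b t (?X t)) \<le> e + C * C * h"
        using norm_triangle_ineq[of "b s (?X s) - b t (?X s)" "b t (?X s) - b t (?X t)"] by (simp add: mult_ac)
    qed (use t h in \<open>auto intro!: continuous_intros continuous_on_subset[OF continuous_along[OF flow_continuous]]\<close>)
    finally show ?thesis by simp
  qed
  have "norm (euler h (Suc k) x - ?X (t + h)) =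
      norm ((?E - ?X t) + h *\<^sub>R (b t ?E - b t (?X t)) - (?X (t + h) - ?X t - h *\<^sub>R b t (?X t)))"
    by (simp add: t_def algebra_simps)
  also have "\<dots> \<le> norm (?E - ?X t) + h * norm (b t ?E - b t (?X t)) + (e + C * C * h) * h"
  proof (rule order_trans[OF norm_triangle_ineq4 add_mono[OF _ step]])
    show "norm ((?E - ?X t) + h *\<^sub>R (b t ?E - b t (?X t))) \<le> norm (?E - ?X t) + h * norm (b t ?E - b t (?X t))"
      using h norm_triangle_ineq[of "?E - ?X t" "h *\<^sub>R (b t ?E - b t (?X t))"] by simp
  qed
  also have "\<dots> \<le> norm (?E - ?X t) + h * (C * norm (?E - ?X t)) + (e + C * C * h) * h"
    using Lipschitz[OF t(1)] h by (intro add_mono mult_left_mono order_refl)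
  also have "\<dots> = norm (?E - ?X t) * (1 + C * h) + h * (e + C * C * h) * 1"
    by (simp add: algebra_simps)
  also have "\<dots> \<le> (k * h * (e + C * C * h) * (1 + C * h) ^ k) * (1 + C * h) + h * (e + C * C * h) * (1 + C * h) ^ Suc k"
    using Suc.IH Suc.prems Ch h e0 C_nonneg unfolding t_def
    by (intro add_mono mult_right_mono mult_left_mono one_le_power) (auto intro!: mult_nonneg_nonneg add_nonneg_nonneg)
  also have "\<dots> = real (Suc k) * h * (e + C * C * h) * (1 + C * h) ^ Suc k"
    by (simp add: algebra_simps)
  finally show ?case by (simp add: t_def algebra_simps)
qed

end

section \<open>Transport along the flow\<close>

locale C11_field_curve = C11_field b G M for b :: "real \<Rightarrow> 'a::euclidean_space \<Rightarrow> 'a" and G M +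
  fixes K :: "'a set" and \<rho> :: "real \<Rightarrow> 'a measure"
  assumes K: "compact K" and prob_on_K: "0 \<le> t \<Longrightarrow> \<rho> t \<in> prob_on K" and narrow: "narrowly_continuous \<rho>"
begin

lemma continuous_on_field: "0 \<le> t \<Longrightarrow> continuous_on S (b t)"
  by (rule Lipschitz_continuous_on) (rule Lipschitz)

text \<open>The modulus d must not depend on u, because the test function changes at every Euler
  step; only the factor Q may. First the field is moved from s to t under the measure at s, then the
  measure is moved with a fixed integrand.\<close>

lemma rate_modulus:
  assumes e: "0 < e"
  shows "\<exists>d>0. \<forall>s\<in>{0..T}. \<forall>t\<in>{0..T}. \<bar>s - t\<bar> < d \<longrightarrow> (\<forall>Q u Gu. C11 Q u Gu \<longrightarrow>
     \<bar>(\<integral>x. Gu x \<bullet> b s x \<partial>\<rho> s) - (\<integral>x. Gu x \<bullet> b t x \<partial>\<rho> t)\<bar> \<le> e * Q)"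
proof -
  obtain d1 where d1: "d1 > 0" "\<And>s t x. s \<in> {0..T} \<Longrightarrow> t \<in> {0..T} \<Longrightarrow> \<bar>s - t\<bar> < d1 \<Longrightarrow> norm (b s x - b t x) \<le> e / 2"
    using time_uniform[of "e / 2" T] e by auto
  obtain d2 where d2: "d2 > 0" "\<And>s t g. s \<in> {0..T} \<Longrightarrow> t \<in> {0..T} \<Longrightarrow> \<bar>s - t\<bar> < d2 \<Longrightarrow>
      (\<And>x. \<bar>g x\<bar> \<le> 2 * C) \<Longrightarrow> (\<And>x y. \<bar>g x - g y\<bar> \<le> 2 * C * norm (x - y)) \<Longrightarrow>
      \<bar>(\<integral>x. g x \<partial>\<rho> s) - (\<integral>x. g x \<partial>\<rho> t)\<bar> \<le> e / 2"
    using narrowly_continuous_equi_Lipschitz[OF K prob_on_K narrow, of "2 * C" "e / 2" T] e C_nonneg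
    by (auto simp: Ball_def)
  show ?thesis
  proof (intro exI[of _ "min d1 d2"] conjI ballI impI allI)
    fix s t Q and u :: "'a \<Rightarrow> real" and Gu
    assume st: "s \<in> {0..T}" "t \<in> {0..T}" "\<bar>s - t\<bar> < min d1 d2" and u: "C11 Q u Gu"
    have t: "0 \<le> t" and s: "0 \<le> s" using st by auto
    note contG = C11_grad_continuous_on[OF u]
    have int: "integrable (\<rho> s) (\<lambda>x. Gu x \<bullet> b s x)" "integrable (\<rho> s) (\<lambda>x. Gu x \<bullet> b t x)"
      by (intro integrable_prob_on[OF prob_on_K[OF s] K] continuous_intros contG continuous_on_field s t)+
    show "\<bar>(\<integral>x. Gu x \<bullet> b s x \<partial>\<rho> s) - (\<integral>x. Gu x \<bullet> b t x \<partial>\<rho> t)\<bar> \<le> e * Q"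
    proof (cases "Q = 0")
      case True
      then have "Gu x = 0" for x using C11_bound[OF u, of x] by simp
      then show ?thesis using True by simp
    next
      case False
      then have Q: "Q > 0" using C11_nonneg[OF u] by simp
      have "norm (\<integral>x. Gu x \<bullet> (b s x - b t x) \<partial>\<rho> s) \<le> Q * (e / 2)"
      proof (rule integral_prob_on_bound[OF prob_on_K[OF s] K])
        fix x
        have "norm (Gu x) * norm (b s x - b t x) \<le> Q * (e / 2)"
          using C11_bound[OF u, of x] d1(2)[of s t x] st Q by (intro mult_mono) auto
        then show "norm (Gu x \<bullet> (b s x - b t x)) \<le> Q * (e / 2)"
          using Cauchy_Schwarz_ineq2[of "Gu x" "b s x - b t x"] by simp
      qed (intro continuous_intros contG continuous_on_field s t)
      then have 1: "\<bar>(\<integral>x. Gu x \<bullet> b s x \<partial>\<rho> s) - (\<integral>x. Gu x \<bullet> b t x \<partial>\<rho> s)\<bar> \<le> Q * (e / 2)"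
        using int by (simp add: inner_diff_right)
      \<comment> \<open>Division by Q puts the integrand into one class with sup and Lipschitz bound
        2 C, to which the equi-Lipschitz form of narrow continuity applies.\<close>
      have "\<bar>(\<integral>x. Gu x \<bullet> b t x / Q \<partial>\<rho> s) - (\<integral>x. Gu x \<bullet> b t x / Q \<partial>\<rho> t)\<bar> \<le> e / 2"
      proof (rule d2(2)[OF st(1,2)])
        show "\<bar>Gu x \<bullet> b t x / Q\<bar> \<le> 2 * C" for x
        proof -
          have "\<bar>Gu x \<bullet> b t x\<bar> \<le> Q * C"
            using Cauchy_Schwarz_ineq2[of "Gu x" "b t x"] mult_mono[OF C11_bound[OF u, of x] bound[OF t, of x]] Q by simp
          also have "\<dots> \<le> 2 * C * Q" using Q C_nonneg by simp
          finally show ?thesis using Q by (simp add: abs_divide divide_le_eq)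
        qed
        show "\<bar>Gu x \<bullet> b t x / Q - Gu y \<bullet> b t y / Q\<bar> \<le> 2 * C * norm (x - y)" for x y
        proof -
          have "Gu x \<bullet> b t x - Gu y \<bullet> b t y = (Gu x - Gu y) \<bullet> b t x + Gu y \<bullet> (b t x - b t y)"
            by (simp add: inner_diff_left inner_diff_right)
          also have "\<bar>\<dots>\<bar> \<le> (Q * norm (x - y)) * C + Q * (C * norm (x - y))"
          proof (intro abs_triangle_ineq[THEN order_trans] add_mono Cauchy_Schwarz_ineq2[THEN order_trans] mult_mono)
          qed (use C11_bound[OF u] C11_Lipschitz[OF u] bound[OF t] Lipschitz[OF t] Q in auto)
          also have "\<dots> = 2 * C * norm (x - y) * Q" by simp
          finally show ?thesis
            using Q by (simp add: diff_divide_distrib[symmetric] abs_divide divide_le_eq)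
        qed
      qed (use st in auto)
      then have 2: "\<bar>(\<integral>x. Gu x \<bullet> b t x \<partial>\<rho> s) - (\<integral>x. Gu x \<bullet> b t x \<partial>\<rho> t)\<bar> \<le> Q * (e / 2)"
        using Q by (simp add: diff_divide_distrib[symmetric] abs_divide divide_le_eq mult_ac)
      have "\<bar>(\<integral>x. Gu x \<bullet> b s x \<partial>\<rho> s) - (\<integral>x. Gu x \<bullet> b t x \<partial>\<rho> t)\<bar> \<le> Q * (e / 2) + Q * (e / 2)"
        using 1 2 by linarith
      then show ?thesis by (simp add: mult_ac)
    qed
  qed (use d1(1) d2(1) in auto)
qed

lemma rate_continuous:
  assumes u: "C11 Q u Gu"
  shows "continuous_on {0..} (\<lambda>t. \<integral>x. Gu x \<bullet> b t x \<partial>\<rho> t)"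
proof (rule continuous_onI)
  fix t e :: real assume t: "t \<in> {0..}" and e: "0 < e"
  have Q: "0 \<le> Q" by (rule C11_nonneg[OF u])
  have "e / (Q + 1) > 0" using Q e by simp
  then obtain d where d: "d > 0" "\<And>s. s \<in> {0..t+1} \<Longrightarrow> \<bar>s - t\<bar> < d \<Longrightarrow>
     \<bar>(\<integral>x. Gu x \<bullet> b s x \<partial>\<rho> s) - (\<integral>x. Gu x \<bullet> b t x \<partial>\<rho> t)\<bar> \<le> e / (Q + 1) * Q"
    using rate_modulus[of "e / (Q + 1)" "t + 1"] u t by force
  have "e / (Q + 1) * Q \<le> e" using Q e by (simp add: field_simps)
  then show "\<exists>d>0. \<forall>s\<in>{0..}. dist s t < d \<longrightarrow> dist (\<integral>x. Gu x \<bullet> b s x \<partial>\<rho> s) (\<integral>x. Gu x \<bullet> b t x \<partial>\<rho> t) \<le> e"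
    using d by (intro exI[of _ "min d 1"]) (force simp: dist_real_def)
qed

end

text \<open>Here b is a given field, so the equation is linear in the curve of measures.\<close>

locale continuity_equation = C11_field_curve +
  assumes weak: "C11 Q u Gu \<Longrightarrow> 0 \<le> s \<Longrightarrow> s \<le> t \<Longrightarrow>
    (\<integral>x. u x \<partial>\<rho> t) - (\<integral>x. u x \<partial>\<rho> s) = integral {s..t} (\<lambda>\<tau>. \<integral>x. Gu x \<bullet> b \<tau> x \<partial>\<rho> \<tau>)"
begin

text \<open>Both integrals are compared with their common first-order expansion: the equation yields
  it for the measure at time t + h up to the modulus of the rate, and Taylor expansion yields it for
  the composed test function up to Q (h C)^2.\<close>

lemma Euler_step_error:
  assumes e: "0 < e"
  shows "\<exists>d>0. \<forall>Q u Gu t h. C11 Q u Gu \<longrightarrow> 0 \<le> t \<longrightarrow> 0 \<le> h \<longrightarrow> h < d \<longrightarrow> t + h \<le> T \<longrightarrow>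
    \<bar>(\<integral>x. u x \<partial>\<rho> (t + h)) - (\<integral>x. u (x + h *\<^sub>R b t x) \<partial>\<rho> t)\<bar> \<le> h * e * Q"
proof -
  obtain d where d: "d > 0" "\<And>s t Q u Gu. s \<in> {0..T} \<Longrightarrow> t \<in> {0..T} \<Longrightarrow> \<bar>s - t\<bar> < d \<Longrightarrow> C11 Q u Gu \<Longrightarrow>
     \<bar>(\<integral>x. Gu x \<bullet> b s x \<partial>\<rho> s) - (\<integral>x. Gu x \<bullet> b t x \<partial>\<rho> t)\<bar> \<le> e / 2 * Q"
    using rate_modulus[of "e / 2" T] e by (auto simp: Ball_def)
  \<comment> \<open>The second entry makes h C^2 at most e/2, so the Taylor error is at most half of
    h e Q; the modulus d accounts for the other half.\<close>
  define d' where "d' = min d (e / (2 * (C\<^sup>2 + 1)))"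
  have C2: "0 < 2 * (C\<^sup>2 + 1)" using zero_le_power2[of C] by (simp add: add_nonneg_pos del: zero_le_power2)
  have d': "d' > 0" using d(1) e C2 by (simp add: d'_def)
  show ?thesis
  proof (intro exI[of _ d'] conjI d' allI impI)
    fix Q and u :: "'a \<Rightarrow> real" and Gu t h
    assume u: "C11 Q u Gu" and t: "0 \<le> t" and h: "0 \<le> h" "h < d'" and T: "t + h \<le> T"
    have Q: "0 \<le> Q" by (rule C11_nonneg[OF u])
    have hC: "h * C\<^sup>2 \<le> e / 2"
    proof -
      have "h * C\<^sup>2 \<le> h * (C\<^sup>2 + 1)" using h by (intro mult_left_mono) auto
      also have "\<dots> \<le> e / (2 * (C\<^sup>2 + 1)) * (C\<^sup>2 + 1)"
        using h C2 by (intro mult_right_mono) (auto simp: d'_def)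
      also have "\<dots> = e / 2" using C2 by (simp add: field_simps)
      finally show ?thesis .
    qed
    define r where "r s = (\<integral>x. Gu x \<bullet> b s x \<partial>\<rho> s)" for s
    have r_cont: "continuous_on {t..t+h} r"
      unfolding r_def using t by (intro continuous_on_subset[OF rate_continuous[OF u]]) auto
    have "(\<integral>x. u x \<partial>\<rho> (t + h)) - (\<integral>x. u x \<partial>\<rho> t) - h * r t = integral {t..t+h} (\<lambda>s. r s - r t)"
      using h weak[OF u, of t "t + h", folded r_def] t
      by (subst Henstock_Kurzweil_Integration.integral_diff) (auto intro!: integrable_continuous_real r_cont)
    also have "norm \<dots> \<le> e / 2 * Q * (t + h - t)"
    proof (rule integral_bound)
      show "norm (r s - r t) \<le> e / 2 * Q" if "s \<in> {t..t+h}" for s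
        using d(2)[of s t, OF _ _ _ u] that t h T by (simp add: r_def d'_def)
    qed (use h r_cont in \<open>auto intro!: continuous_intros\<close>)
    finally have 1: "\<bar>(\<integral>x. u x \<partial>\<rho> (t + h)) - (\<integral>x. u x \<partial>\<rho> t) - h * r t\<bar> \<le> e / 2 * Q * h" by simp
    note cont = C11_continuous_on[OF u] C11_grad_continuous_on[OF u] continuous_on_field[OF t]
    have cont': "continuous_on UNIV (\<lambda>x. u (x + h *\<^sub>R b t x))"
      by (rule continuous_on_compose2[OF cont(1)[of UNIV]]) (auto intro!: continuous_intros cont)
    have "norm (\<integral>x. u (x + h *\<^sub>R b t x) - u x - h * (Gu x \<bullet> b t x) \<partial>\<rho> t) \<le> Q * (h * (h * C\<^sup>2))"
    proof (rule integral_prob_on_bound[OF prob_on_K[OF t] K])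
      fix x
      have "norm (u (x + h *\<^sub>R b t x) - u x - h * (Gu x \<bullet> b t x)) \<le> Q * (h * norm (b t x))\<^sup>2"
        using C11_remainder[OF u, of x "h *\<^sub>R b t x"] h by simp
      also have "\<dots> \<le> Q * (h * C)\<^sup>2"
        using bound[OF t, of x] h Q by (intro mult_left_mono power_mono) auto
      finally show "norm (u (x + h *\<^sub>R b t x) - u x - h * (Gu x \<bullet> b t x)) \<le> Q * (h * (h * C\<^sup>2))"
        by (simp add: power2_eq_square mult_ac)
    qed (intro continuous_intros cont cont')
    also have "(\<integral>x. u (x + h *\<^sub>R b t x) - u x - h * (Gu x \<bullet> b t x) \<partial>\<rho> t) =
        (\<integral>x. u (x + h *\<^sub>R b t x) \<partial>\<rho> t) - (\<integral>x. u x \<partial>\<rho> t) - h * r t"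
      unfolding r_def
      by (subst Bochner_Integration.integral_diff Bochner_Integration.integral_mult_right_zero;
          (intro Bochner_Integration.integrable_diff integrable_prob_on[OF prob_on_K[OF t] K] continuous_intros cont cont')?)+ simp
    finally have 2: "\<bar>(\<integral>x. u (x + h *\<^sub>R b t x) \<partial>\<rho> t) - (\<integral>x. u x \<partial>\<rho> t) - h * r t\<bar> \<le> Q * (h * (h * C\<^sup>2))" by simp
    have 3: "Q * (h * (h * C\<^sup>2)) \<le> Q * (h * (e / 2))"
      using hC h Q by (intro mult_left_mono) auto
    have "\<bar>(\<integral>x. u x \<partial>\<rho> (t + h)) - (\<integral>x. u (x + h *\<^sub>R b t x) \<partial>\<rho> t)\<bar> \<le> e / 2 * Q * h + Q * (h * (e / 2))"
      using 1 2 3 by linarith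
    then show "\<bar>(\<integral>x. u x \<partial>\<rho> (t + h)) - (\<integral>x. u (x + h *\<^sub>R b t x) \<partial>\<rho> t)\<bar> \<le> h * e * Q"
      by (simp add: algebra_simps)
  qed
qed

text \<open>The last step is peeled off the measure and moved onto the test function. The induction
  hypothesis is then needed for u o P with constant Q (1 + C h)^3, which is why u, Q and the
  gradient are generalised.\<close>

lemma Euler_transport_error:
  assumes h: "0 \<le> h"
    and step: "\<And>Q u Gu t. C11 Q u Gu \<Longrightarrow> 0 \<le> t \<Longrightarrow> t + h \<le> T \<Longrightarrow>
      \<bar>(\<integral>x. u x \<partial>\<rho> (t + h)) - (\<integral>x. u (x + h *\<^sub>R b t x) \<partial>\<rho> t)\<bar> \<le> h * e * Q"
    and e: "0 \<le> e"
  shows "C11 Q u Gu \<Longrightarrow> real k * h \<le> T \<Longrightarrow>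
     \<bar>(\<integral>x. u x \<partial>\<rho> (k * h)) - (\<integral>x. u (euler h k x) \<partial>\<rho> 0)\<bar> \<le> k * h * e * Q * (1 + C * h) ^ (3 * k)"
proof (induction k arbitrary: Q u Gu)
  case (Suc k)
  let ?t = "k * h" and ?P = "\<lambda>x. x + h *\<^sub>R b (k * h) x"
  have t: "0 \<le> ?t" "?t + h \<le> T" "real (Suc k) * h = ?t + h" using h Suc.prems by (auto simp: algebra_simps)
  have Ch: "0 \<le> C * h" using C_nonneg h by simp
  have Q: "0 \<le> Q" by (rule C11_nonneg[OF Suc.prems(1)])
  obtain Gu' where u': "C11 (Q * (1 + C * h) ^ 3) (\<lambda>x. u (?P x)) Gu'"
    using C11_Euler_step[OF Suc.prems(1) t(1) h] by blast
  have "\<bar>(\<integral>x. u x \<partial>\<rho> (?t + h)) - (\<integral>x. u (?P x) \<partial>\<rho> ?t)\<bar> \<le> h * e * Q"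
    by (rule step[OF Suc.prems(1) t(1,2)])
  moreover have "h * e * Q * 1 \<le> h * e * Q * (1 + C * h) ^ (3 * Suc k)"
    using h e Q Ch by (intro mult_left_mono one_le_power) auto
  moreover have "\<bar>(\<integral>x. u (?P x) \<partial>\<rho> ?t) - (\<integral>x. u (?P (euler h k x)) \<partial>\<rho> 0)\<bar>
      \<le> k * h * e * (Q * (1 + C * h) ^ 3) * (1 + C * h) ^ (3 * k)"
    using t h by (intro Suc.IH[OF u']) auto
  moreover have "k * h * e * (Q * (1 + C * h) ^ 3) * (1 + C * h) ^ (3 * k) = k * h * e * Q * (1 + C * h) ^ (3 * Suc k)"
    by (simp add: power_add)
  ultimately have "\<bar>(\<integral>x. u x \<partial>\<rho> (?t + h)) - (\<integral>x. u (?P (euler h k x)) \<partial>\<rho> 0)\<bar> \<le>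
      h * e * Q * (1 + C * h) ^ (3 * Suc k) + k * h * e * Q * (1 + C * h) ^ (3 * Suc k)" by linarith
  also have "\<dots> = (h + k * h) * e * Q * (1 + C * h) ^ (3 * Suc k)"
    by (simp only: distrib_right)
  also have "h + k * h = ?t + h" by simp
  finally show ?case
    by (simp only: t(3)[symmetric] euler.simps)
qed simp

end

context C11_field begin

lemma euler_tendsto_flow:
  assumes T: "0 < T"
  shows "(\<lambda>N. euler (T / real (Suc N)) (Suc N) x) \<longlonglongrightarrow> flow T x"
proof (rule metric_LIMSEQ_I)
  fix \<epsilon> :: real assume \<epsilon>: "0 < \<epsilon>"
  \<comment> \<open>The same e bounds the time modulus and C C h, so the scheme errs by at most T (2
    e) exp(C T) = \<epsilon> / 2.\<close>
  define e where "e = \<epsilon> / (4 * T * exp (C * T))"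
  have e: "e > 0" using \<epsilon> T by (simp add: e_def)
  obtain d where d: "d > 0" "\<And>s t x. s \<in> {0..T} \<Longrightarrow> t \<in> {0..T} \<Longrightarrow> \<bar>s - t\<bar> < d \<Longrightarrow> norm (b s x - b t x) \<le> e"
    using time_uniform[OF e, of T] by auto
  have "(\<lambda>N. T / real (Suc N)) \<longlonglongrightarrow> 0"
    by (rule LIMSEQ_Suc) (rule lim_const_over_n)
  then have ev: "\<forall>\<^sub>F N in sequentially. T / real (Suc N) < y" if "0 < y" for y
    using that by (rule order_tendstoD)
  have "e / (C * C + 1) > 0" using e by (intro divide_pos_pos) (auto intro: add_nonneg_pos)
  from ev[OF this] ev[OF d(1)] have "\<forall>\<^sub>F N in sequentially. dist (euler (T / real (Suc N)) (Suc N) x) (flow T x) < \<epsilon>"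
  proof eventually_elim
    case (elim N)
    define h where "h = T / real (Suc N)"
    have h: "0 < h" "real (Suc N) * h = T" using T by (auto simp: h_def)
    have CC: "C * C * h \<le> e"
    proof -
      have "(C * C + 1) * h \<le> e"
        using elim(1) by (simp add: h_def less_divide_eq less_imp_le add_nonneg_pos mult.commute)
      then show ?thesis using h by (simp add: distrib_right)
    qed
    have "norm (euler h (Suc N) x - flow (real (Suc N) * h) x) \<le> real (Suc N) * h * (e + C * C * h) * (1 + C * h) ^ Suc N"
      by (rule euler_error[of h "Suc N" T e]) (use h d elim in \<open>auto simp: h_def[symmetric]\<close>)
    also have "\<dots> \<le> T * (e + e) * exp (C * T)"
    proof (intro mult_mono)
      have "(1 + C * h) ^ Suc N \<le> exp (C * h) ^ Suc N"
        using C_nonneg h by (intro power_mono exp_ge_add_one_self) (auto intro: add_nonneg_nonneg)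
      also have "\<dots> = exp (C * T)" using h(2) by (simp add: exp_of_nat_mult[symmetric] mult_ac del: power_Suc)
      finally show "(1 + C * h) ^ Suc N \<le> exp (C * T)" .
    qed (use h T e CC C_nonneg in auto)
    also have "\<dots> < \<epsilon>" using T \<epsilon> by (simp add: e_def)
    finally show ?case unfolding h(2) unfolding h_def dist_norm .
  qed
  then show "\<exists>no. \<forall>n\<ge>no. dist (euler (T / real (Suc n)) (Suc n) x) (flow T x) < \<epsilon>"
    unfolding eventually_sequentially .
qed

text \<open>A pointwise limit of Euler maps, which are continuous in the starting point; regularity
  of the flow in x is not examined directly.\<close>

lemma borel_measurable_flow:
  assumes "0 \<le> T" shows "flow T \<in> borel_measurable borel"
proof (cases "T = 0")
  case True
  then have "flow T = (\<lambda>x. x)" by (simp add: fun_eq_iff flow_0)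
  then show ?thesis by simp
next
  case False
  then show ?thesis
    using assms by (intro borel_measurable_LIMSEQ_metric[OF _ euler_tendsto_flow]
        borel_measurable_continuous_onI continuous_on_euler) auto
qed

end

context continuity_equation begin

text \<open>Both sides are limits of the integrals of u along Euler maps: one by dominated
  convergence, where the bound B enters, the other by the telescoped transport error.\<close>

lemma integral_flow:
  assumes u: "C11 Q u Gu" and B: "\<And>x. \<bar>u x\<bar> \<le> B" and T: "0 \<le> T"
  shows "(\<integral>x. u x \<partial>\<rho> T) = (\<integral>x. u (flow T x) \<partial>\<rho> 0)"
proof (cases "T = 0")
  case True
  then show ?thesis by (simp add: flow_0)
next
  case False
  then have T: "0 < T" using T by simp
  have Q: "0 \<le> Q" by (rule C11_nonneg[OF u])
  interpret R: prob_space "\<rho> 0" by (rule prob_on_prob_space[OF prob_on_K K]) simp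
  let ?E = "\<lambda>N. euler (T / real (Suc N)) (Suc N)"
  have sets: "sets (\<rho> 0) = sets borel" by (rule sets_prob_on[OF prob_on_K K]) simp
  have u_borel: "u \<in> borel_measurable borel"
    by (intro borel_measurable_continuous_onI C11_continuous_on[OF u])
  have "(\<lambda>N. \<integral>x. u (?E N x) \<partial>\<rho> 0) \<longlonglongrightarrow> (\<integral>x. u (flow T x) \<partial>\<rho> 0)"
  proof (rule integral_dominated_convergence[where w = "\<lambda>_. B"])
    show "(\<lambda>x. u (flow T x)) \<in> borel_measurable (\<rho> 0)"
      using measurable_compose[OF borel_measurable_flow[of T] u_borel] T by (simp add: measurable_cong_sets[OF sets refl])
    show "(\<lambda>x. u (?E N x)) \<in> borel_measurable (\<rho> 0)" for N
      using measurable_compose[OF borel_measurable_continuous_onI[OF continuous_on_euler[of "T / real (Suc N)" UNIV "Suc N"]] u_borel] T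
      by (simp add: measurable_cong_sets[OF sets refl] del: euler.simps)
    show "AE x in \<rho> 0. (\<lambda>N. u (?E N x)) \<longlonglongrightarrow> u (flow T x)"
    proof (intro AE_I2)
      fix x
      have "isCont u (flow T x)" using C11_continuous_on[OF u, of UNIV] by (simp add: continuous_on_eq_continuous_at)
      then show "(\<lambda>N. u (?E N x)) \<longlonglongrightarrow> u (flow T x)"
        using euler_tendsto_flow[OF T] by (rule isCont_tendsto_compose)
    qed
  qed (use B in auto)
  moreover have "(\<lambda>N. \<integral>x. u (?E N x) \<partial>\<rho> 0) \<longlonglongrightarrow> (\<integral>x. u x \<partial>\<rho> T)"
  proof (rule metric_LIMSEQ_I)
    fix \<epsilon> :: real assume \<epsilon>: "0 < \<epsilon>"
    \<comment> \<open>Chosen so that the accumulated error T e (Q + 1) exp(3 C T) equals \<epsilon>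
      / 2; the 1 covers the case Q = 0.\<close>
    define e where "e = \<epsilon> / (2 * T * (Q + 1) * exp (3 * (C * T)))"
    have e: "e > 0" using \<epsilon> T Q by (simp add: e_def)
    obtain d where d: "d > 0" "\<forall>Q u Gu t h. C11 Q u Gu \<longrightarrow> 0 \<le> t \<longrightarrow> 0 \<le> h \<longrightarrow> h < d \<longrightarrow> t + h \<le> T \<longrightarrow>
      \<bar>(\<integral>x. u x \<partial>\<rho> (t + h)) - (\<integral>x. u (x + h *\<^sub>R b t x) \<partial>\<rho> t)\<bar> \<le> h * e * Q"
      using Euler_step_error[OF e, of T] by (elim exE conjE) (rule that)
    have "(\<lambda>N. T / real (Suc N)) \<longlonglongrightarrow> 0"
      by (rule LIMSEQ_Suc) (rule lim_const_over_n)
    then have "\<forall>\<^sub>F N in sequentially. T / real (Suc N) < d"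
      using d(1) by (rule order_tendstoD)
    then have "\<forall>\<^sub>F N in sequentially. dist (\<integral>x. u (?E N x) \<partial>\<rho> 0) (\<integral>x. u x \<partial>\<rho> T) < \<epsilon>"
    proof eventually_elim
      case (elim N)
      define h where "h = T / real (Suc N)"
      have h: "0 < h" "real (Suc N) * h = T" using T by (auto simp: h_def)
      have "\<bar>(\<integral>x. u x \<partial>\<rho> (real (Suc N) * h)) - (\<integral>x. u (euler h (Suc N) x) \<partial>\<rho> 0)\<bar>
          \<le> real (Suc N) * h * e * Q * (1 + C * h) ^ (3 * Suc N)"
      proof (rule Euler_transport_error[OF _ _ _ u, where T = T])
        show "\<bar>(\<integral>x. v x \<partial>\<rho> (t + h)) - (\<integral>x. v (x + h *\<^sub>R b t x) \<partial>\<rho> t)\<bar> \<le> h * e * P"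
          if "C11 P v Gv" "0 \<le> t" "t + h \<le> T" for P v Gv t
          by (intro d(2)[rule_format, OF that(1,2)]) (use h(1) elim that(3) in \<open>auto simp: h_def\<close>)
      qed (use h e in auto)
      also have "\<dots> \<le> T * e * (Q + 1) * exp (3 * (C * T))"
      proof (intro mult_mono)
        have "(1 + C * h) ^ (3 * Suc N) \<le> exp (C * h) ^ (3 * Suc N)"
          using C_nonneg h by (intro power_mono exp_ge_add_one_self) (auto intro: add_nonneg_nonneg)
        also have "\<dots> = exp (real (3 * Suc N) * (C * h))" by (rule exp_of_nat_mult[symmetric])
        also have "real (3 * Suc N) * (C * h) = 3 * (C * (real (Suc N) * h))" by simp
        finally show "(1 + C * h) ^ (3 * Suc N) \<le> exp (3 * (C * T))" by (simp only: h(2))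
      qed (use h T e Q C_nonneg in auto)
      also have "\<dots> < \<epsilon>" using T \<epsilon> Q by (simp add: e_def)
      finally show ?case unfolding h(2) unfolding h_def dist_real_def abs_minus_commute[of "\<integral>x. u x \<partial>\<rho> T"] .
    qed
    then show "\<exists>no. \<forall>n\<ge>no. dist (\<integral>x. u (?E n x) \<partial>\<rho> 0) (\<integral>x. u x \<partial>\<rho> T) < \<epsilon>"
      unfolding eventually_sequentially .
  qed
  ultimately show ?thesis by (rule LIMSEQ_unique[rotated])
qed

end

section \<open>Bounded test functions with Lipschitz gradient determine a measure\<close>

lemma smooth_step_derivative:
  assumes "a < b"
  obtains \<sigma> Q where "\<And>x. (smooth_step a b has_field_derivative \<sigma> x) (at x)" "\<And>x. \<bar>\<sigma> x\<bar> \<le> Q"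
    "\<And>x y. \<bar>\<sigma> x - \<sigma> y\<bar> \<le> Q * \<bar>x - y\<bar>"
proof -
  define c where "c = integral {a..b} (bump a b)"
  define \<sigma> where "\<sigma> x = 1 / c * bump a b x" for x
  \<comment> \<open>Projection onto {a..b} is 1-Lipschitz and leaves the bump unchanged, since it
    vanishes at and beyond the endpoints; bounds on the compact interval thereby become
    global.\<close>
  define clamp where "clamp x = max a (min b x)" for x
  have clamp: "clamp x \<in> {a..b}" "\<bar>clamp x - clamp y\<bar> \<le> \<bar>x - y\<bar>" "\<sigma> (clamp x) = \<sigma> x" for x y
    using assms by (auto simp: clamp_def \<sigma>_def bump_eq_0 max_def min_def)
  have "\<sigma> \<in> bumps" unfolding \<sigma>_def by (rule bump_in_bumps)
  then obtain \<sigma>' where \<sigma>': "\<sigma>' \<in> bumps" "\<And>x. (\<sigma> has_field_derivative \<sigma>' x) (at x)"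
    using DERIV_bumps by blast
  have cont: "continuous_on {a..b} \<sigma>'" "continuous_on {a..b} \<sigma>"
    using differentiable_bumps \<open>\<sigma> \<in> bumps\<close> \<sigma>'(1)
    by (auto intro!: differentiable_imp_continuous_on differentiable_at_imp_differentiable_on)
  obtain Q1 where Q1: "\<And>x. x \<in> {a..b} \<Longrightarrow> \<bar>\<sigma> x\<bar> \<le> Q1"
    using compact_imp_bounded[OF compact_continuous_image[OF cont(2) compact_Icc]] unfolding bounded_iff
    by (auto simp del: atLeastAtMost_iff)
  obtain Q2 where Q2: "\<And>x. x \<in> {a..b} \<Longrightarrow> \<bar>\<sigma>' x\<bar> \<le> Q2"
    using compact_imp_bounded[OF compact_continuous_image[OF cont(1) compact_Icc]] unfolding bounded_iff
    by (auto simp del: atLeastAtMost_iff)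
  have Q2': "0 \<le> Q2" using Q2[of a] assms by auto
  show thesis
  proof (rule that[of \<sigma> "max Q1 Q2"])
    show "(smooth_step a b has_field_derivative \<sigma> x) (at x)" for x
      using DERIV_smooth_step[OF assms, of x] by (simp add: \<sigma>_def c_def)
    show "\<bar>\<sigma> x\<bar> \<le> max Q1 Q2" for x
      using Q1[OF clamp(1), of x] clamp(3)[of x] by simp
    show "\<bar>\<sigma> x - \<sigma> y\<bar> \<le> max Q1 Q2 * \<bar>x - y\<bar>" for x y
    proof -
      have "norm (\<sigma> (clamp x) - \<sigma> (clamp y)) \<le> Q2 * norm (clamp x - clamp y)"
        using Q2 \<sigma>'(2) clamp(1)
        by (intro field_differentiable_bound[of "{a..b}" \<sigma> \<sigma>']) (auto intro: has_field_derivative_at_within)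
      also have "\<dots> \<le> max Q1 Q2 * \<bar>x - y\<bar>"
        using clamp(2)[of x y] Q2' by (intro mult_mono) auto
      finally show ?thesis by (simp add: clamp(3))
    qed
  qed
qed

lemma GDERIV_DERIV_compose:
  assumes "(f has_field_derivative f') (at (g x))" "GDERIV g x :> G"
  shows "GDERIV (\<lambda>x. f (g x)) x :> f' *\<^sub>R G"
proof -
  have "((\<lambda>x. f (g x)) has_derivative (\<lambda>v. f' * (v \<bullet> G))) (at x)"
    using assms(2) unfolding gderiv_def
    by (rule has_derivative_compose) (rule assms(1)[unfolded has_field_derivative_def])
  then show ?thesis by (simp add: gderiv_def)
qed

lemma C11_mult:
  assumes u: "C11 Q u G" "\<And>x. \<bar>u x\<bar> \<le> B" and v: "C11 Q' v G'" "\<And>x. \<bar>v x\<bar> \<le> B'"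
  shows "C11 (2 * Q * Q' + B * Q' + B' * Q) (\<lambda>x. u x * v x) (\<lambda>x. u x *\<^sub>R G' x + v x *\<^sub>R G x)"
proof -
  have Q: "0 \<le> Q" "0 \<le> Q'" by (rule C11_nonneg[OF u(1)] C11_nonneg[OF v(1)])+
  have B: "0 \<le> B" "0 \<le> B'" using u(2) v(2) abs_ge_zero order_trans by blast+
  have Lip: "norm (u x *\<^sub>R G' x - u y *\<^sub>R G' y) \<le> (Q * Q' + B * Q') * norm (x - y)"
    if u: "C11 Q u G" "\<And>x. \<bar>u x\<bar> \<le> B" and v: "C11 Q' v G'" and Q: "0 \<le> Q" "0 \<le> Q'" and B: "0 \<le> B"
    for Q Q' B u v G G' and x y :: 'a
  proof -
    have "u x *\<^sub>R G' x - u y *\<^sub>R G' y = (u x - u y) *\<^sub>R G' x + u y *\<^sub>R (G' x - G' y)"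
      by (simp add: algebra_simps)
    also have "norm \<dots> \<le> \<bar>u x - u y\<bar> * norm (G' x) + \<bar>u y\<bar> * norm (G' x - G' y)"
      by (rule order_trans[OF norm_triangle_ineq]) simp
    also have "\<dots> \<le> (Q * norm (x - y)) * Q' + B * (Q' * norm (x - y))"
      using C11_value_Lipschitz[OF u(1)] C11_bound[OF v] u(2) C11_Lipschitz[OF v] Q B
      by (intro add_mono mult_mono) auto
    finally show ?thesis by (simp add: algebra_simps)
  qed
  show ?thesis
    unfolding C11_def
  proof (intro conjI allI)
    show "GDERIV (\<lambda>x. u x * v x) x :> u x *\<^sub>R G' x + v x *\<^sub>R G x" for x
      using GDERIV_mult[OF C11_GDERIV[OF u(1)] C11_GDERIV[OF v(1)]] by simp
    show "norm (u x *\<^sub>R G' x + v x *\<^sub>R G x) \<le> 2 * Q * Q' + B * Q' + B' * Q" for x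
    proof -
      have "norm (u x *\<^sub>R G' x + v x *\<^sub>R G x) \<le> \<bar>u x\<bar> * norm (G' x) + \<bar>v x\<bar> * norm (G x)"
        by (rule order_trans[OF norm_triangle_ineq]) simp
      also have "\<dots> \<le> B * Q' + B' * Q"
        using u(2) v(2) C11_bound[OF u(1)] C11_bound[OF v(1)] B by (intro add_mono mult_mono) auto
      also have "\<dots> \<le> 2 * Q * Q' + B * Q' + B' * Q" using Q by simp
      finally show ?thesis .
    qed
    show "norm (u x *\<^sub>R G' x + v x *\<^sub>R G x - (u y *\<^sub>R G' y + v y *\<^sub>R G y)) \<le>
        (2 * Q * Q' + B * Q' + B' * Q) * norm (x - y)" for x y
    proof -
      have "norm (u x *\<^sub>R G' x + v x *\<^sub>R G x - (u y *\<^sub>R G' y + v y *\<^sub>R G y)) \<le>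
          norm (u x *\<^sub>R G' x - u y *\<^sub>R G' y) + norm (v x *\<^sub>R G x - v y *\<^sub>R G y)"
        by (rule norm_diff_triangle_ineq)
      also have "\<dots> \<le> (Q * Q' + B * Q') * norm (x - y) + (Q' * Q + B' * Q) * norm (x - y)"
        by (intro add_mono Lip[OF u v(1) Q B(1)] Lip[OF v u(1) Q(2,1) B(2)])
      finally show ?thesis by (simp add: algebra_simps)
    qed
  qed
qed

definition bounded_C11 :: "('a::euclidean_space \<Rightarrow> real) \<Rightarrow> bool" where
  "bounded_C11 u \<longleftrightarrow> (\<exists>B Q G. (\<forall>x. \<bar>u x\<bar> \<le> B) \<and> C11 Q u G)"

lemma bounded_C11_const: "bounded_C11 (\<lambda>_. c)"
  unfolding bounded_C11_def C11_def
  by (intro exI[of _ "\<bar>c\<bar>"] exI[of _ 0] exI[of _ "\<lambda>_. 0"]) (simp add: GDERIV_const)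

lemma bounded_C11_mult:
  assumes "bounded_C11 u" "bounded_C11 v" shows "bounded_C11 (\<lambda>x. u x * v x)"
proof -
  obtain B Q G B' Q' G' where *: "\<And>x. \<bar>u x\<bar> \<le> B" "C11 Q u G" "\<And>x. \<bar>v x\<bar> \<le> B'" "C11 Q' v G'"
    using assms unfolding bounded_C11_def by blast
  have "\<bar>u x * v x\<bar> \<le> B * B'" for x
    unfolding abs_mult using *(1,3)[of x] by (intro mult_mono) (auto intro: order_trans[OF abs_ge_zero])
  with C11_mult[OF *(2,1,4,3)] show ?thesis
    unfolding bounded_C11_def by blast
qed

lemma bounded_C11_prod: "(\<And>i. i \<in> I \<Longrightarrow> bounded_C11 (u i)) \<Longrightarrow> bounded_C11 (\<lambda>x. \<Prod>i\<in>I. u i x)"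
  by (induction I rule: infinite_finite_induct) (auto intro: bounded_C11_const bounded_C11_mult)

lemma bounded_C11_smooth_step: "bounded_C11 (\<lambda>x. smooth_step 0 1 (\<alpha> + x \<bullet> v))"
proof -
  obtain \<sigma> Q where \<sigma>: "\<And>x. (smooth_step 0 1 has_field_derivative \<sigma> x) (at x)" "\<And>x. \<bar>\<sigma> x\<bar> \<le> Q"
    "\<And>x y. \<bar>\<sigma> x - \<sigma> y\<bar> \<le> Q * \<bar>x - y\<bar>"
    using smooth_step_derivative[of 0 1] by (metis zero_less_one)
  have Q: "0 \<le> Q" using \<sigma>(2)[of 0] by linarith
  have "C11 (Q * norm v * (1 + norm v)) (\<lambda>x. smooth_step 0 1 (\<alpha> + x \<bullet> v)) (\<lambda>x. \<sigma> (\<alpha> + x \<bullet> v) *\<^sub>R v)"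
    unfolding C11_def
  proof (intro conjI allI)
    fix x y
    have "GDERIV (\<lambda>x. \<alpha> + x \<bullet> v) x :> v"
      unfolding gderiv_def by (auto intro!: derivative_eq_intros)
    then show "GDERIV (\<lambda>x. smooth_step 0 1 (\<alpha> + x \<bullet> v)) x :> \<sigma> (\<alpha> + x \<bullet> v) *\<^sub>R v"
      by (rule GDERIV_DERIV_compose[OF \<sigma>(1)])
    show "norm (\<sigma> (\<alpha> + x \<bullet> v) *\<^sub>R v) \<le> Q * norm v * (1 + norm v)"
    proof -
      have "norm (\<sigma> (\<alpha> + x \<bullet> v) *\<^sub>R v) \<le> Q * norm v * 1" using \<sigma>(2) by (simp add: mult_right_mono)
      also have "\<dots> \<le> Q * norm v * (1 + norm v)" using Q by (intro mult_left_mono) auto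
      finally show ?thesis .
    qed
    show "norm (\<sigma> (\<alpha> + x \<bullet> v) *\<^sub>R v - \<sigma> (\<alpha> + y \<bullet> v) *\<^sub>R v) \<le> Q * norm v * (1 + norm v) * norm (x - y)"
    proof -
      have "norm (\<sigma> (\<alpha> + x \<bullet> v) *\<^sub>R v - \<sigma> (\<alpha> + y \<bullet> v) *\<^sub>R v) \<le> (Q * \<bar>(x - y) \<bullet> v\<bar>) * norm v"
        using \<sigma>(3)[of "\<alpha> + x \<bullet> v" "\<alpha> + y \<bullet> v"]
        by (simp add: scaleR_diff_left[symmetric] inner_diff_left mult_right_mono)
      also have "\<dots> \<le> (Q * (norm (x - y) * norm v)) * norm v"
        using Q by (intro mult_right_mono mult_left_mono Cauchy_Schwarz_ineq2) auto
      also have "\<dots> = Q * norm v * norm v * norm (x - y)" by (simp add: mult_ac)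
      also have "\<dots> \<le> Q * norm v * (1 + norm v) * norm (x - y)"
        using Q by (intro mult_right_mono mult_left_mono) auto
      finally show ?thesis .
    qed
  qed
  moreover have "\<bar>smooth_step 0 1 (\<alpha> + x \<bullet> v)\<bar> \<le> 1" for x
    using smooth_step_bounds[of 0 1] by (simp add: abs_of_nonneg)
  ultimately show ?thesis unfolding bounded_C11_def by blast
qed

text \<open>The step is 0 at y = 0 for every n, so the limit is the indicator of the open half-line,
  as open boxes require.\<close>

lemma smooth_step_tendsto_indicator:
  "(\<lambda>n. smooth_step 0 1 (real n * y)) \<longlonglongrightarrow> indicator {0<..} y"
proof (cases "0 < y")
  case True
  obtain N where N: "real N > 1 / y" using reals_Archimedean2 by blast
  have "smooth_step 0 1 (real n * y) = 1" if "n \<ge> N" for n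
  proof (rule smooth_step_ge)
    have "1 / y < real n" using N that by (meson le_less_trans not_le of_nat_mono order_less_le_trans)
    then show "1 \<le> real n * y" using True by (simp add: field_simps)
  qed simp
  then have "\<forall>\<^sub>F n in sequentially. 1 = smooth_step 0 1 (real n * y)"
    unfolding eventually_sequentially by (intro exI[of _ N]) auto
  then show ?thesis using True by (intro Lim_transform_eventually[OF tendsto_const]) auto
next
  case False
  then have "smooth_step 0 1 (real n * y) = 0" for n
    by (intro smooth_step_le) (auto simp: mult_le_0_iff)
  then show ?thesis using False by simp
qed

text \<open>Products of steep steps in the coordinates converge boundedly to indicators of open
  boxes, and open boxes are an intersection-stable generator of the Borel sets.\<close>

lemma measure_eqI_bounded_C11:
  fixes \<mu> \<nu> :: "'a::euclidean_space measure"
  assumes \<mu>: "prob_space \<mu>" "sets \<mu> = sets borel" and \<nu>: "prob_space \<nu>" "sets \<nu> = sets borel"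
    and eq: "\<And>u. bounded_C11 u \<Longrightarrow> (\<integral>x. u x \<partial>\<mu>) = (\<integral>x. u x \<partial>\<nu>)"
  shows "\<mu> = \<nu>"
proof -
  define u where "u a b n x = (\<Prod>i\<in>Basis. smooth_step 0 1 (real n * (x \<bullet> i - a \<bullet> i)) *
      smooth_step 0 1 (real n * (b \<bullet> i - x \<bullet> i)))" for a b :: 'a and n and x :: 'a
  have u: "bounded_C11 (u a b n)" for a b n
  proof -
    have "bounded_C11 (\<lambda>x. \<Prod>i\<in>Basis. smooth_step 0 1 (- real n * (a \<bullet> i) + x \<bullet> (real n *\<^sub>R i)) *
      smooth_step 0 1 (real n * (b \<bullet> i) + x \<bullet> (- real n *\<^sub>R i)))"
      by (intro bounded_C11_prod bounded_C11_mult bounded_C11_smooth_step)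
    then show ?thesis by (simp add: u_def[abs_def] algebra_simps)
  qed
  have u_lim: "(\<lambda>n. u a b n x) \<longlonglongrightarrow> indicator (box a b) x" for a b x
  proof -
    have "(\<lambda>n. u a b n x) \<longlonglongrightarrow> (\<Prod>i\<in>Basis. indicator {0<..} (x \<bullet> i - a \<bullet> i) * indicator {0<..} (b \<bullet> i - x \<bullet> i))"
      unfolding u_def by (intro tendsto_prod tendsto_mult smooth_step_tendsto_indicator)
    also have "(\<Prod>i\<in>Basis. indicator {0<..} (x \<bullet> i - a \<bullet> i) * indicator {0<..} (b \<bullet> i - x \<bullet> i)) = (indicator (box a b) x :: real)"
      by (auto simp: indicator_def mem_box intro!: prod.neutral)
    finally show ?thesis .
  qed
  have u_bound: "\<bar>u a b n x\<bar> \<le> 1" for a b n x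
    unfolding u_def abs_prod
    by (intro prod_le_1) (auto simp: smooth_step_bounds abs_mult intro!: mult_le_one)
  have lim: "(\<lambda>n. \<integral>x. u a b n x \<partial>M) \<longlonglongrightarrow> measure M (box a b)" if "prob_space M" "sets M = sets borel" for M a b
  proof -
    interpret prob_space M by fact
    have "(\<lambda>n. \<integral>x. u a b n x \<partial>M) \<longlonglongrightarrow> (\<integral>x. indicator (box a b) x \<partial>M)"
    proof (rule integral_dominated_convergence[where w = "\<lambda>_. 1"])
      show "u a b n \<in> borel_measurable M" for n
      proof -
        obtain Q G where "C11 Q (u a b n) G" using u[of a b n] unfolding bounded_C11_def by blast
        then show ?thesis
          by (simp add: measurable_cong_sets[OF that(2) refl] borel_measurable_continuous_onI C11_continuous_on)
      qed
    qed (use u_lim u_bound that in auto)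
    then show ?thesis using that by simp
  qed
  have box: "emeasure \<mu> (box a b) = emeasure \<nu> (box a b)" for a b
  proof -
    interpret \<mu>: prob_space \<mu> by fact
    interpret \<nu>: prob_space \<nu> by fact
    have "measure \<mu> (box a b) = measure \<nu> (box a b)"
      using lim[OF \<mu>, of a b] lim[OF \<nu>, of a b] eq[OF u] LIMSEQ_unique by simp
    then show ?thesis by (simp add: \<mu>.emeasure_eq_measure \<nu>.emeasure_eq_measure)
  qed
  let ?E = "range (\<lambda>(a, b). box a b :: 'a set)"
  show ?thesis
  proof (rule measure_eqI_generator_eq[where E = ?E and \<Omega> = UNIV and A = "\<lambda>n::nat. box (- (real n *\<^sub>R One)) (real n *\<^sub>R One)"])
    show "Int_stable ?E" by (auto simp: Int_stable_def box_Int_box)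
    show "sets \<mu> = sigma_sets UNIV ?E" "sets \<nu> = sigma_sets UNIV ?E"
      by (simp_all add: \<mu> \<nu> borel_eq_box)
    show "(\<Union>n::nat. box (- (real n *\<^sub>R One)) (real n *\<^sub>R One)) = (UNIV :: 'a set)"
      by (rule UN_box_eq_UNIV)
    show "emeasure \<mu> (box (- (real n *\<^sub>R One)) (real n *\<^sub>R One)) \<noteq> \<infinity>" for n :: nat
      using \<mu>(1) by (simp add: prob_space.emeasure_space_1 prob_space_imp_sigma_finite finite_measure.emeasure_finite prob_space.finite_measure)
  qed (auto simp: box)
qed

context continuity_equation begin

theorem distr_flow:
  assumes T: "0 \<le> T" shows "distr (\<rho> 0) borel (flow T) = \<rho> T"
proof (rule measure_eqI_bounded_C11)
  have sets0: "sets (\<rho> 0) = sets borel" by (rule sets_prob_on[OF prob_on_K K]) simp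
  have meas: "flow T \<in> measurable (\<rho> 0) borel"
    using borel_measurable_flow[OF T] by (simp add: measurable_cong_sets[OF sets0 refl])
  interpret R: prob_space "\<rho> 0" by (rule prob_on_prob_space[OF prob_on_K K]) simp
  show "prob_space (distr (\<rho> 0) borel (flow T))" by (rule R.prob_space_distr) (rule meas)
  show "prob_space (\<rho> T)" "sets (\<rho> T) = sets borel"
    using prob_on_prob_space[OF prob_on_K K] sets_prob_on[OF prob_on_K K] T by auto
  show "(\<integral>x. u x \<partial>distr (\<rho> 0) borel (flow T)) = (\<integral>x. u x \<partial>\<rho> T)" if u': "bounded_C11 u" for u
  proof -
    obtain B Q G where u: "\<And>x. \<bar>u x\<bar> \<le> B" "C11 Q u G" using u' unfolding bounded_C11_def by blast
    have "(\<integral>x. u x \<partial>distr (\<rho> 0) borel (flow T)) = (\<integral>x. u (flow T x) \<partial>\<rho> 0)"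
      by (rule integral_distr[OF meas borel_measurable_continuous_onI[OF C11_continuous_on[OF u(2)]]])
    then show ?thesis using integral_flow[OF u(2,1) T] by simp
  qed
qed simp

end

section \<open>Cutoffs and smooth expressions\<close>

text \<open>The local form of \<open>C11\<close>, for functions smooth everywhere but controlled
  only on a ball. The bound on u itself is included because multiplication by a cutoff puts u into
  the gradient.\<close>

definition C11_in :: "real \<Rightarrow> real \<Rightarrow> ('a::euclidean_space \<Rightarrow> real) \<Rightarrow> ('a \<Rightarrow> 'a) \<Rightarrow> bool" where
  "C11_in r Q u G \<longleftrightarrow> (\<forall>x. GDERIV u x :> G x) \<and>
     (\<forall>x\<in>cball 0 r. \<bar>u x\<bar> \<le> Q \<and> norm (G x) \<le> Q) \<and>
     (\<forall>x\<in>cball 0 r. \<forall>y\<in>cball 0 r. norm (G x - G y) \<le> Q * norm (x - y))"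

lemma C11_in_sum:
  assumes "\<And>p. p \<in> I \<Longrightarrow> C11_in r (Q p) (u p) (G p)"
  shows "C11_in r (\<Sum>p\<in>I. Q p) (\<lambda>x. \<Sum>p\<in>I. u p x) (\<lambda>x. \<Sum>p\<in>I. G p x)"
  unfolding C11_in_def
proof (intro conjI allI ballI)
  show "GDERIV (\<lambda>x. \<Sum>p\<in>I. u p x) x :> (\<Sum>p\<in>I. G p x)" for x
    using assms unfolding C11_in_def gderiv_def inner_sum_right by (intro has_derivative_sum) auto
  show "\<bar>\<Sum>p\<in>I. u p x\<bar> \<le> (\<Sum>p\<in>I. Q p)" if "x \<in> cball 0 r" for x
    using assms that unfolding C11_in_def by (intro order_trans[OF sum_abs] sum_mono) auto
  show "norm (\<Sum>p\<in>I. G p x) \<le> (\<Sum>p\<in>I. Q p)" if "x \<in> cball 0 r" for x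
    using assms that unfolding C11_in_def by (intro order_trans[OF norm_sum] sum_mono) auto
  show "norm ((\<Sum>p\<in>I. G p x) - (\<Sum>p\<in>I. G p y)) \<le> (\<Sum>p\<in>I. Q p) * norm (x - y)"
    if "x \<in> cball 0 r" "y \<in> cball 0 r" for x y
    using assms that unfolding C11_in_def sum_subtractf[symmetric] sum_distrib_right
    by (intro order_trans[OF norm_sum] sum_mono) auto
qed

text \<open>The new constant depends on Q but not on u, so the cut-off velocities obey one bound for
  all times. Control on radius R + 2 leaves a collar of width 1 around the support of the
  cutoff.\<close>

lemma exists_cutoff:
  fixes R :: real
  assumes R: "0 \<le> R"
  obtains \<eta> :: "'a::euclidean_space \<Rightarrow> real" where "\<And>x. norm x \<le> R \<Longrightarrow> \<eta> x = 1"
    "\<And>x. 0 \<le> \<eta> x" "\<And>x. \<eta> x \<le> 1" "\<And>x. R + 1 \<le> norm x \<Longrightarrow> \<eta> x = 0"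
    "\<And>Q. 0 \<le> Q \<Longrightarrow> \<exists>Q'. \<forall>u G. C11_in (R + 2) Q u G \<longrightarrow> (\<exists>G'. C11 Q' (\<lambda>x. \<eta> x * u x) G') \<and> (\<forall>x. \<bar>\<eta> x * u x\<bar> \<le> Q')"
proof -
  obtain \<sigma> q where \<sigma>: "\<And>x. (smooth_step 0 1 has_field_derivative \<sigma> x) (at x)" "\<And>x. \<bar>\<sigma> x\<bar> \<le> q"
    "\<And>x y. \<bar>\<sigma> x - \<sigma> y\<bar> \<le> q * \<bar>x - y\<bar>"
    using smooth_step_derivative[of 0 1] by (metis zero_less_one)
  have q: "0 \<le> q" using \<sigma>(2)[of 0] by linarith
  \<comment> \<open>The squared norm avoids a singularity at the origin: p is at least 1 on the ball
    of radius R and at most 0 beyond R + 1, because (R + 1)^2 \<ge> R^2 + 1.\<close>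
  define p where "p x = R\<^sup>2 + 1 - x \<bullet> x" for x :: 'a
  define \<eta> where "\<eta> x = smooth_step 0 1 (p x)" for x :: 'a
  define H where "H x = (- 2 * \<sigma> (p x)) *\<^sub>R x" for x :: 'a
  have \<eta>01: "0 \<le> \<eta> x" "\<eta> x \<le> 1" for x using smooth_step_bounds[of 0 1] by (auto simp: \<eta>_def)
  have \<eta>1: "\<eta> x = 1" if "norm x \<le> R" for x
    using that R power_mono[OF that norm_ge_zero, of 2] unfolding \<eta>_def
    by (intro smooth_step_ge) (auto simp: p_def power2_norm_eq_inner)
  have \<eta>0: "\<eta> x = 0" if "R + 1 \<le> norm x" for x
  proof -
    have "(R + 1)\<^sup>2 \<le> (norm x)\<^sup>2" using that R by (intro power_mono) auto
    then have "R\<^sup>2 + 1 \<le> x \<bullet> x" using R by (simp add: power2_norm_eq_inner[symmetric] power2_sum)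
    then show ?thesis unfolding \<eta>_def by (intro smooth_step_le) (simp add: p_def)
  qed
  have H: "GDERIV \<eta> x :> H x" for x
  proof -
    have p: "GDERIV p x :> - 2 *\<^sub>R x"
      unfolding gderiv_def p_def by (auto intro!: derivative_eq_intros simp: inner_commute)
    show ?thesis
      using GDERIV_DERIV_compose[OF \<sigma>(1) p] by (simp add: \<eta>_def[abs_def] H_def mult.commute)
  qed
  define r where "r = R + 2"
  have r: "0 \<le> r" using R by (simp add: r_def)
  define q' where "q' = 2 * q * (1 + r + 2 * r * r)"
  have q': "0 \<le> q'" using q r by (simp add: q'_def)
  have Hb: "norm (H x) \<le> q'" if "norm x \<le> r" for x
  proof -
    have "norm (H x) \<le> 2 * q * r"
      unfolding H_def using that \<sigma>(2)[of "p x"] by (auto simp: abs_mult intro!: mult_mono)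
    also have "\<dots> \<le> q'" unfolding q'_def using q r by (intro mult_left_mono) auto
    finally show ?thesis .
  qed
  have HL: "norm (H x - H y) \<le> q' * norm (x - y)" if "norm x \<le> r" "norm y \<le> r" for x y
  proof -
    have pL: "\<bar>p x - p y\<bar> \<le> 2 * r * norm (x - y)"
    proof -
      have "p x - p y = (y - x) \<bullet> (x + y)"
        by (simp add: p_def inner_diff_left inner_diff_right inner_add_left inner_add_right inner_commute)
      then have "\<bar>p x - p y\<bar> \<le> norm (y - x) * norm (x + y)" using Cauchy_Schwarz_ineq2[of "y - x" "x + y"] by simp
      also have "\<dots> \<le> norm (y - x) * (2 * r)"
        using that norm_triangle_ineq[of x y] by (intro mult_left_mono) auto
      finally show ?thesis by (simp add: norm_minus_commute mult_ac)
    qed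
    have "H x - H y = (- 2) *\<^sub>R ((\<sigma> (p x) - \<sigma> (p y)) *\<^sub>R x + \<sigma> (p y) *\<^sub>R (x - y))"
      by (simp add: H_def algebra_simps)
    also have "norm \<dots> \<le> 2 * (\<bar>\<sigma> (p x) - \<sigma> (p y)\<bar> * norm x + \<bar>\<sigma> (p y)\<bar> * norm (x - y))"
      using norm_triangle_ineq[of "(\<sigma> (p x) - \<sigma> (p y)) *\<^sub>R x" "\<sigma> (p y) *\<^sub>R (x - y)"] by simp
    also have "\<dots> \<le> 2 * ((q * (2 * r * norm (x - y))) * r + q * norm (x - y))"
    proof (intro mult_left_mono add_mono mult_mono mult_right_mono)
      show "\<bar>\<sigma> (p x) - \<sigma> (p y)\<bar> \<le> q * (2 * r * norm (x - y))"
        using \<sigma>(3)[of "p x" "p y"] mult_left_mono[OF pL q] by linarith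
    qed (use that \<sigma>(2) q r in auto)
    also have "\<dots> = 2 * q * (1 + 2 * r * r) * norm (x - y)" by (simp add: algebra_simps)
    also have "\<dots> \<le> q' * norm (x - y)"
      unfolding q'_def using q r by (intro mult_right_mono mult_left_mono) auto
    finally show ?thesis .
  qed
  show thesis
  proof (rule that[of \<eta>, OF \<eta>1 \<eta>01 \<eta>0])
    fix Q :: real assume Q: "0 \<le> Q"
    define Q' where "Q' = 3 * Q * q' + 2 * Q + q' * Q"
    show "\<exists>Q'. \<forall>u G. C11_in (R + 2) Q u G \<longrightarrow> (\<exists>G'. C11 Q' (\<lambda>x. \<eta> x * u x) G') \<and> (\<forall>x. \<bar>\<eta> x * u x\<bar> \<le> Q')"
    proof (intro exI[of _ Q'] allI impI)
      fix u :: "'a \<Rightarrow> real" and G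
      assume "C11_in (R + 2) Q u G"
      then have uD: "\<And>x. GDERIV u x :> G x" and u: "\<And>x. norm x \<le> r \<Longrightarrow> \<bar>u x\<bar> \<le> Q" "\<And>x. norm x \<le> r \<Longrightarrow> norm (G x) \<le> Q"
        "\<And>x y. norm x \<le> r \<Longrightarrow> norm y \<le> r \<Longrightarrow> norm (G x - G y) \<le> Q * norm (x - y)"
        by (auto simp: C11_in_def r_def)
      define G' where "G' x = \<eta> x *\<^sub>R G x + u x *\<^sub>R H x" for x
      have D: "GDERIV (\<lambda>x. \<eta> x * u x) x :> G' x" for x
        using GDERIV_mult[OF H uD, of x] by (simp add: G'_def)
      have prod: "norm (a *\<^sub>R v - a' *\<^sub>R v') \<le> (k * m' + m * k') * norm (x - y)"
        if "\<bar>a - a'\<bar> \<le> k * norm (x - y)" "norm v \<le> m'" "\<bar>a'\<bar> \<le> m" "norm (v - v') \<le> k' * norm (x - y)" "0 \<le> k" "0 \<le> m"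
        for a a' k k' m m' :: real and v v' x y :: 'a
      proof -
        have "norm (a *\<^sub>R v - a' *\<^sub>R v') = norm ((a - a') *\<^sub>R v + a' *\<^sub>R (v - v'))"
          by (simp add: algebra_simps)
        also have "\<dots> \<le> \<bar>a - a'\<bar> * norm v + \<bar>a'\<bar> * norm (v - v')"
          by (rule order_trans[OF norm_triangle_ineq]) simp
        also have "\<dots> \<le> (k * norm (x - y)) * m' + m * (k' * norm (x - y))"
          using that by (intro add_mono mult_mono) auto
        finally show ?thesis by (simp add: algebra_simps)
      qed
      have val: "\<bar>v x - v y\<bar> \<le> k * norm (x - y)"
        if "\<And>x. GDERIV v x :> F x" "\<And>x. norm x \<le> r \<Longrightarrow> norm (F x) \<le> k" "norm x \<le> r" "norm y \<le> r" for v F k and x y :: 'a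
        using that by (intro GDERIV_bound[of "cball 0 r" v F]) auto
      have G'_bound_in: "norm (G' x) \<le> Q'" if "norm x \<le> r" for x
      proof -
        have "norm (G' x) \<le> \<bar>\<eta> x\<bar> * norm (G x) + \<bar>u x\<bar> * norm (H x)"
          unfolding G'_def by (rule order_trans[OF norm_triangle_ineq]) simp
        also have "\<dots> \<le> 1 * Q + Q * q'"
          using \<eta>01[of x] u(1,2)[OF that] Hb[OF that] Q by (intro add_mono mult_mono) auto
        also have "\<dots> \<le> Q'" using Q q' by (simp add: Q'_def mult_ac)
        finally show ?thesis .
      qed
      have G'_Lip_in: "norm (G' x - G' y) \<le> Q' * norm (x - y)" if "norm x \<le> r" "norm y \<le> r" for x y
      proof -
        have "norm (G' x - G' y) \<le> norm (\<eta> x *\<^sub>R G x - \<eta> y *\<^sub>R G y) + norm (u x *\<^sub>R H x - u y *\<^sub>R H y)"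
          unfolding G'_def by (rule norm_diff_triangle_ineq)
        also have "\<dots> \<le> (q' * Q + 1 * Q) * norm (x - y) + (Q * q' + Q * q') * norm (x - y)"
          using that \<eta>01[of y] u Q q' Hb HL val[OF H Hb that] val[OF uD u(2) that]
          by (intro add_mono prod) auto
        also have "\<dots> \<le> Q' * norm (x - y)"
        proof -
          have "(q' * Q + 1 * Q) + (Q * q' + Q * q') \<le> Q'"
            using mult_nonneg_nonneg[OF Q q'] Q by (simp add: Q'_def algebra_simps)
          then show ?thesis
            unfolding distrib_right[symmetric] by (rule mult_right_mono) simp
        qed
        finally show ?thesis .
      qed
      have G'0: "G' x = 0" if "R + 1 < norm x" for x
      proof -
        have "open {x::'a. R + 1 < norm x}" by (intro open_Collect_less continuous_intros)
        moreover have "GDERIV (\<lambda>_. 0) x :> 0" by (rule GDERIV_const)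
        ultimately have "GDERIV (\<lambda>x. \<eta> x * u x) x :> 0"
          unfolding gderiv_def using that
          by (elim has_derivative_transform_within_open) (auto simp: \<eta>0 less_imp_le)
        then have "(\<lambda>h. h \<bullet> G' x) = (\<lambda>h. h \<bullet> 0)"
          using D[of x] unfolding gderiv_def by (rule has_derivative_unique[rotated])
        from fun_cong[OF this, of "G' x"] show ?thesis by simp
      qed
      have Q'0: "0 \<le> Q'" using Q q' by (simp add: Q'_def)
      \<comment> \<open>With y outside the collar its gradient vanishes. Either x is also outside
        the support, or the points are at least 1 apart and the sup bound serves as a Lipschitz
        bound.\<close>
      have far: "norm (G' x - G' y) \<le> Q' * norm (x - y)" if "\<not> norm y \<le> r" for x y
      proof (cases "norm x \<le> R + 1")
        case True
        then have "1 \<le> norm (x - y)" using that norm_triangle_ineq2[of y x] by (simp add: r_def norm_minus_commute)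
        then have "Q' * 1 \<le> Q' * norm (x - y)" by (intro mult_left_mono Q'0)
        moreover have "G' y = 0" using that by (intro G'0) (simp add: r_def)
        moreover have "norm (G' x) \<le> Q'" using True by (intro G'_bound_in) (simp add: r_def)
        ultimately show ?thesis by simp
      next
        case False
        then have "G' x = 0" "G' y = 0" using that by (auto intro!: G'0 simp: r_def)
        then show ?thesis using Q'0 by simp
      qed
      have "C11 Q' (\<lambda>x. \<eta> x * u x) G'"
        unfolding C11_def
      proof (intro conjI allI D)
        show "norm (G' x) \<le> Q'" for x
          using G'_bound_in[of x] G'0[of x] Q'0 by (cases "norm x \<le> r") (auto simp: r_def)
        show "norm (G' x - G' y) \<le> Q' * norm (x - y)" for x y
          using G'_Lip_in[of x y] far[of y x] far[of x y]
          by (cases "norm x \<le> r"; cases "norm y \<le> r") (auto simp: norm_minus_commute)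
      qed
      moreover have "\<bar>\<eta> x * u x\<bar> \<le> Q'" for x
      proof (cases "norm x \<le> r")
        case True
        have "\<bar>\<eta> x * u x\<bar> \<le> 1 * Q"
          unfolding abs_mult using u(1)[OF True] \<eta>01[of x] by (intro mult_mono) auto
        also have "\<dots> \<le> Q'" using Q q' by (simp add: Q'_def)
        finally show ?thesis .
      next
        case False
        then show ?thesis using \<eta>0[of x] Q'0 by (simp add: r_def)
      qed
      ultimately show "(\<exists>G'. C11 Q' (\<lambda>x. \<eta> x * u x) G') \<and> (\<forall>x. \<bar>\<eta> x * u x\<bar> \<le> Q')" by blast
    qed
  qed
qed

text \<open>Closed under partial derivatives, so one induction yields derivatives of all orders.\<close>

inductive smooth_expr :: "('e::euclidean_space \<Rightarrow> real) \<Rightarrow> bool" where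
  smooth_const: "smooth_expr (\<lambda>_. c)"
| smooth_inner: "smooth_expr (\<lambda>z. z \<bullet> a)"
| smooth_add: "smooth_expr f \<Longrightarrow> smooth_expr g \<Longrightarrow> smooth_expr (\<lambda>z. f z + g z)"
| smooth_mult: "smooth_expr f \<Longrightarrow> smooth_expr g \<Longrightarrow> smooth_expr (\<lambda>z. f z * g z)"
| smooth_exp: "smooth_expr f \<Longrightarrow> smooth_expr (\<lambda>z. exp (f z))"
| smooth_inverse: "smooth_expr f \<Longrightarrow> (\<And>z. f z \<noteq> 0) \<Longrightarrow> smooth_expr (\<lambda>z. inverse (f z))"

lemma smooth_sum: "(\<And>i. i \<in> I \<Longrightarrow> smooth_expr (f i)) \<Longrightarrow> smooth_expr (\<lambda>z. \<Sum>i\<in>I. f i z)"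
  by (induction I rule: infinite_finite_induct) (auto intro: smooth_expr.intros)

lemma smooth_expr_gradient:
  "smooth_expr f \<Longrightarrow> \<exists>G. (\<forall>z. GDERIV f z :> G z) \<and> (\<forall>v. smooth_expr (\<lambda>z. G z \<bullet> v))"
proof (induction rule: smooth_expr.induct)
  case (smooth_const c)
  show ?case by (intro exI[of _ "\<lambda>_. 0"]) (auto simp: GDERIV_const intro: smooth_expr.intros)
next
  case (smooth_inner a)
  have "GDERIV (\<lambda>z. z \<bullet> a) z :> a" for z
    unfolding gderiv_def by (auto intro!: derivative_eq_intros)
  then show ?case by (intro exI[of _ "\<lambda>_. a"]) (auto intro: smooth_expr.intros)
next
  case (smooth_add f g)
  then obtain F G where *: "\<And>z. GDERIV f z :> F z" "\<And>v. smooth_expr (\<lambda>z. F z \<bullet> v)"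
    "\<And>z. GDERIV g z :> G z" "\<And>v. smooth_expr (\<lambda>z. G z \<bullet> v)" by metis
  show ?case
    by (intro exI[of _ "\<lambda>z. F z + G z"]) (auto simp: inner_add_left intro: GDERIV_add * smooth_expr.intros)
next
  case (smooth_mult f g)
  then obtain F G where *: "\<And>z. GDERIV f z :> F z" "\<And>v. smooth_expr (\<lambda>z. F z \<bullet> v)"
    "\<And>z. GDERIV g z :> G z" "\<And>v. smooth_expr (\<lambda>z. G z \<bullet> v)" by metis
  have "smooth_expr (\<lambda>z. (f z *\<^sub>R G z + g z *\<^sub>R F z) \<bullet> v)" for v
    unfolding inner_add_left inner_scaleR_left by (intro smooth_expr.intros * smooth_mult)
  then show ?case
    by (intro exI[of _ "\<lambda>z. f z *\<^sub>R G z + g z *\<^sub>R F z"] conjI allI GDERIV_mult *(1,3))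
next
  case (smooth_exp f)
  then obtain F where *: "\<And>z. GDERIV f z :> F z" "\<And>v. smooth_expr (\<lambda>z. F z \<bullet> v)" by metis
  have "smooth_expr (\<lambda>z. (exp (f z) *\<^sub>R F z) \<bullet> v)" for v
    unfolding inner_scaleR_left by (intro smooth_expr.intros * smooth_exp)
  then show ?case
    by (intro exI[of _ "\<lambda>z. exp (f z) *\<^sub>R F z"] conjI allI GDERIV_DERIV_compose[OF DERIV_exp *(1)])
next
  case (smooth_inverse f)
  then obtain F where *: "\<And>z. GDERIV f z :> F z" "\<And>v. smooth_expr (\<lambda>z. F z \<bullet> v)" by metis
  have "GDERIV (\<lambda>z. inverse (f z)) z :> (- 1 * (inverse (f z) * inverse (f z))) *\<^sub>R F z" for z
    using GDERIV_DERIV_compose[OF DERIV_inverse[OF smooth_inverse(2)] *(1), of z]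
    by (simp add: power2_eq_square numeral_2_eq_2)
  moreover have "smooth_expr (\<lambda>z. ((- 1 * (inverse (f z) * inverse (f z))) *\<^sub>R F z) \<bullet> v)" for v
    unfolding inner_scaleR_left by (intro smooth_expr.intros * smooth_inverse)
  ultimately show ?case
    by (intro exI[of _ "\<lambda>z. (- 1 * (inverse (f z) * inverse (f z))) *\<^sub>R F z"] conjI allI)
qed

lemma smooth_expr_continuous: "smooth_expr f \<Longrightarrow> continuous_on S f"
  using smooth_expr_gradient GDERIV_continuous_on by blast

lemma smooth_gradient_continuous:
  fixes G :: "'e::euclidean_space \<Rightarrow> 'e"
  assumes "\<And>v. smooth_expr (\<lambda>z. G z \<bullet> v)" shows "continuous_on S G"
  by (subst continuous_on_componentwise) (auto intro: smooth_expr_continuous assms)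

lemma smooth_expr_Lipschitz:
  assumes f: "smooth_expr f" and S: "compact S" "convex S"
  shows "\<exists>Q\<ge>0. \<forall>x\<in>S. \<forall>y\<in>S. \<bar>f x - f y\<bar> \<le> Q * norm (x - y)"
proof -
  obtain G where G: "\<And>z. GDERIV f z :> G z" "\<And>v. smooth_expr (\<lambda>z. G z \<bullet> v)"
    using smooth_expr_gradient[OF f] by blast
  obtain Q where "Q > 0" "\<And>x. x \<in> S \<Longrightarrow> norm (G x) \<le> Q"
    using compact_imp_bounded[OF compact_continuous_image[OF smooth_gradient_continuous[OF G(2)] S(1)]]
    unfolding bounded_pos by auto
  then show ?thesis
    using GDERIV_bound[OF S(2) G(1)] by (intro exI[of _ Q]) auto
qed

text \<open>The Lipschitz bound of the gradient is the first-order bound applied to each of its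
  components, which are smooth expressions again; no second derivative has to be written
  down.\<close>

lemma smooth_expr_bounds:
  assumes G: "\<And>z. GDERIV f z :> G z" "\<And>v. smooth_expr (\<lambda>z. G z \<bullet> v)"
    and f: "smooth_expr f" and S: "compact S" "convex S"
  obtains Q where "0 \<le> Q" "\<And>x. x \<in> S \<Longrightarrow> \<bar>f x\<bar> \<le> Q" "\<And>x. x \<in> S \<Longrightarrow> norm (G x) \<le> Q"
    "\<And>x y. x \<in> S \<Longrightarrow> y \<in> S \<Longrightarrow> norm (G x - G y) \<le> Q * norm (x - y)"
proof -
  obtain Q1 where Q1: "\<And>x. x \<in> S \<Longrightarrow> \<bar>f x\<bar> \<le> Q1"
    using compact_imp_bounded[OF compact_continuous_image[OF smooth_expr_continuous[OF f] S(1)]]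
    unfolding bounded_iff by auto
  obtain Q2 where Q2: "\<And>x. x \<in> S \<Longrightarrow> norm (G x) \<le> Q2"
    using compact_imp_bounded[OF compact_continuous_image[OF smooth_gradient_continuous[OF G(2)] S(1)]]
    unfolding bounded_iff by auto
  have "\<exists>Q. \<forall>v. 0 \<le> Q v \<and> (\<forall>x\<in>S. \<forall>y\<in>S. \<bar>G x \<bullet> v - G y \<bullet> v\<bar> \<le> Q v * norm (x - y))"
    by (intro choice allI) (use smooth_expr_Lipschitz[OF G(2) S] in blast)
  then obtain Q3 where Q3: "\<And>v. 0 \<le> Q3 v" "\<And>v x y. x \<in> S \<Longrightarrow> y \<in> S \<Longrightarrow> \<bar>G x \<bullet> v - G y \<bullet> v\<bar> \<le> Q3 v * norm (x - y)"
    by blast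
  have Lip: "norm (G x - G y) \<le> (\<Sum>v\<in>Basis. Q3 v) * norm (x - y)" if "x \<in> S" "y \<in> S" for x y
  proof -
    have "norm (G x - G y) \<le> (\<Sum>v\<in>Basis. \<bar>(G x - G y) \<bullet> v\<bar>)" by (rule norm_le_l1)
    also have "\<dots> \<le> (\<Sum>v\<in>Basis. Q3 v * norm (x - y))"
      using Q3(2)[OF that] by (intro sum_mono) (simp add: inner_diff_left)
    finally show ?thesis by (simp add: sum_distrib_right)
  qed
  have nn: "0 \<le> (\<Sum>v\<in>Basis. Q3 v)" by (intro sum_nonneg Q3)
  show thesis
  proof (rule that[of "\<bar>Q1\<bar> + \<bar>Q2\<bar> + (\<Sum>v\<in>Basis. Q3 v)"])
    show "norm (G x - G y) \<le> (\<bar>Q1\<bar> + \<bar>Q2\<bar> + (\<Sum>v\<in>Basis. Q3 v)) * norm (x - y)" if "x \<in> S" "y \<in> S" for x y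
      using Lip[OF that] by (rule order_trans) (intro mult_right_mono, auto)
  qed (use Q1 Q2 nn in force)+
qed

section \<open>Integrals depending on a parameter\<close>

text \<open>Quadratic remainders survive integration with their constant, so this criterion replaces
  a separate argument for differentiating under the integral over inputs.\<close>

lemma GDERIV_quadratic_remainder:
  fixes F :: "'a::euclidean_space \<Rightarrow> real"
  assumes "\<And>v. norm v \<le> 1 \<Longrightarrow> \<bar>F (x + v) - F x - v \<bullet> D\<bar> \<le> Q * (norm v)\<^sup>2"
  shows "GDERIV F x :> D"
  unfolding gderiv_def has_derivative_at
proof (intro conjI bounded_linear_inner_left)
  show "(\<lambda>h. norm (F (x + h) - F x - h \<bullet> D) / norm h) \<midarrow>0\<rightarrow> 0"
  proof (rule Lim_null_comparison)
    show "((\<lambda>h. Q * norm h) \<longlongrightarrow> 0) (at 0)"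
      by (auto intro!: tendsto_eq_intros)
    have "\<forall>\<^sub>F h in at (0::'a). norm h < 1"
      unfolding eventually_at by (intro exI[of _ 1]) (simp add: dist_norm)
    then show "\<forall>\<^sub>F h in at 0. norm (norm (F (x + h) - F x - h \<bullet> D) / norm h) \<le> Q * norm h"
    proof eventually_elim
      case (elim h)
      then show ?case using assms[of h]
        by (cases "h = 0") (auto simp: divide_le_eq power2_eq_square mult.assoc)
    qed
  qed
qed

lemma
  assumes "C11_in r Q u G"
  shows C11_in_GDERIV: "GDERIV u x :> G x"
    and C11_in_value_bound: "norm x \<le> r \<Longrightarrow> \<bar>u x\<bar> \<le> Q"
    and C11_in_bound: "norm x \<le> r \<Longrightarrow> norm (G x) \<le> Q"
    and C11_in_Lipschitz: "norm x \<le> r \<Longrightarrow> norm y \<le> r \<Longrightarrow> norm (G x - G y) \<le> Q * norm (x - y)"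
  using assms by (simp_all add: C11_in_def)

lemma C11_in_remainder:
  assumes "C11_in r Q u G" "norm x + norm v \<le> r"
  shows "\<bar>u (x + v) - u x - v \<bullet> G x\<bar> \<le> Q * (norm v)\<^sup>2"
proof -
  have *: "y \<in> cball 0 r" if "y \<in> cball x (norm v)" for y
    using that assms(2) norm_triangle_ineq2[of y x] by (simp add: dist_norm norm_minus_commute)
  have Q: "0 \<le> Q"
    using assms(1) *[of x] unfolding C11_in_def by (auto intro: order_trans[OF norm_ge_zero])
  have "\<bar>(u (x + v) - (x + v) \<bullet> G x) - (u x - x \<bullet> G x)\<bar> \<le> Q * norm v * norm (x + v - x)"
  proof (rule GDERIV_bound[where S = "cball x (norm v)" and G = "\<lambda>y. G y - G x"])
    show "GDERIV (\<lambda>y. u y - y \<bullet> G x) y :> G y - G x" for y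
      using assms(1) unfolding gderiv_def C11_in_def
      by (auto intro!: derivative_eq_intros simp: inner_diff_right)
    show "norm (G y - G x) \<le> Q * norm v" if y: "y \<in> cball x (norm v)" for y
    proof -
      have "norm (G y - G x) \<le> Q * norm (y - x)"
        using assms(1) *[OF y] *[of x] unfolding C11_in_def by auto
      also have "\<dots> \<le> Q * norm v"
        using y Q by (intro mult_left_mono) (simp_all add: dist_norm norm_minus_commute)
      finally show ?thesis .
    qed
  qed (auto simp: dist_norm)
  then show ?thesis
    by (simp add: inner_add_left power2_eq_square algebra_simps)
qed

lemma C11_in_scale:
  assumes "C11_in r Q u G" "\<bar>k\<bar> \<le> Z"
  shows "C11_in r (Z * Q) (\<lambda>x. k * u x) (\<lambda>x. k *\<^sub>R G x)"
  unfolding C11_in_def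
proof (intro conjI allI ballI)
  have Z: "0 \<le> Z" using assms(2) by linarith
  show "GDERIV (\<lambda>x. k * u x) x :> k *\<^sub>R G x" for x
    using assms(1) unfolding C11_in_def gderiv_def
    by (auto intro!: derivative_eq_intros)
  show "\<bar>k * u x\<bar> \<le> Z * Q" "norm (k *\<^sub>R G x) \<le> Z * Q" if "x \<in> cball 0 r" for x
    using assms that Z unfolding C11_in_def by (auto simp: abs_mult intro!: mult_mono)
  show "norm (k *\<^sub>R G x - k *\<^sub>R G y) \<le> Z * Q * norm (x - y)" if "x \<in> cball 0 r" "y \<in> cball 0 r" for x y
    using assms that Z unfolding C11_in_def scaleR_diff_right[symmetric] norm_scaleR mult.assoc
    by (intro mult_mono) auto
qed

text \<open>Bounds for the joint function on the compact product of two balls yield constants that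
  are uniform in X; the gradient of a section is the second block of the joint gradient.\<close>

lemma C11_in_section:
  fixes f :: "'p::euclidean_space \<times> 'a::euclidean_space \<Rightarrow> real"
  assumes f: "smooth_expr f" and G: "\<And>z. GDERIV f z :> G z" "\<And>v. smooth_expr (\<lambda>z. G z \<bullet> v)"
  shows "\<exists>Q\<ge>0. \<forall>X\<in>cball 0 p. C11_in r Q (\<lambda>\<omega>. f (X, \<omega>)) (\<lambda>\<omega>. snd (G (X, \<omega>)))"
proof -
  let ?S = "cball (0::'p) p \<times> cball (0::'a) r"
  obtain Q where Q: "0 \<le> Q" "\<And>x. x \<in> ?S \<Longrightarrow> \<bar>f x\<bar> \<le> Q" "\<And>x. x \<in> ?S \<Longrightarrow> norm (G x) \<le> Q"
    "\<And>x y. x \<in> ?S \<Longrightarrow> y \<in> ?S \<Longrightarrow> norm (G x - G y) \<le> Q * norm (x - y)"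
    by (rule smooth_expr_bounds[OF G f, of ?S]) (auto intro: compact_Times convex_Times)
  have D: "GDERIV (\<lambda>\<omega>. f (X, \<omega>)) \<omega> :> snd (G (X, \<omega>))" for X \<omega>
  proof -
    have "((\<lambda>\<omega>. (X, \<omega>)) has_derivative (\<lambda>v. (0, v))) (at \<omega>)"
      by (auto intro!: derivative_eq_intros)
    then have "((\<lambda>\<omega>. f (X, \<omega>)) has_derivative (\<lambda>v. (0, v) \<bullet> G (X, \<omega>))) (at \<omega>)"
      using G(1)[unfolded gderiv_def] by (rule has_derivative_compose)
    then show ?thesis by (simp add: gderiv_def inner_prod_def)
  qed
  have snd_le: "norm (snd z) \<le> norm z" for z :: "'p \<times> 'a" by (cases z) (simp add: norm_snd_le)
  show ?thesis
  proof (intro exI[of _ Q] conjI Q(1) ballI)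
    fix X :: 'p assume X: "X \<in> cball 0 p"
    show "C11_in r Q (\<lambda>\<omega>. f (X, \<omega>)) (\<lambda>\<omega>. snd (G (X, \<omega>)))"
      unfolding C11_in_def
    proof (intro conjI allI ballI D)
      show "\<bar>f (X, \<omega>)\<bar> \<le> Q" "norm (snd (G (X, \<omega>))) \<le> Q" if "\<omega> \<in> cball 0 r" for \<omega>
        using Q(2)[of "(X, \<omega>)"] order_trans[OF snd_le Q(3)[of "(X, \<omega>)"]] X that by simp_all
      show "norm (snd (G (X, \<omega>)) - snd (G (X, \<omega>'))) \<le> Q * norm (\<omega> - \<omega>')"
        if "\<omega> \<in> cball 0 r" "\<omega>' \<in> cball 0 r" for \<omega> \<omega>'
      proof -
        have "norm (snd (G (X, \<omega>) - G (X, \<omega>'))) \<le> Q * norm ((X, \<omega>) - (X, \<omega>'))"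
          using order_trans[OF snd_le Q(4)[of "(X, \<omega>)" "(X, \<omega>')"]] X that by simp
        then show ?thesis by (simp add: norm_Pair)
      qed
    qed
  qed
qed

lemma
  fixes h :: "'p \<Rightarrow> 'b::{banach, second_countable_topology}"
  assumes D: "prob_space D" "AE X in D. X \<in> P"
    and c: "c \<in> borel_measurable D" "AE X in D. \<bar>c X\<bar> \<le> m"
    and h: "h \<in> borel_measurable D" "\<And>X. X \<in> P \<Longrightarrow> norm (h X) \<le> B"
  shows integrable_weighted: "integrable D (\<lambda>X. c X *\<^sub>R h X)"
    and integral_weighted_bound: "norm (\<integral>X. c X *\<^sub>R h X \<partial>D) \<le> m * B"
proof -
  interpret prob_space D by (rule D)
  have AE: "AE X in D. norm (c X *\<^sub>R h X) \<le> m * B"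
    using D(2) c(2)
  proof eventually_elim
    case (elim X)
    then show ?case using h(2)[OF elim(1)] by (auto intro!: mult_mono)
  qed
  show int: "integrable D (\<lambda>X. c X *\<^sub>R h X)"
    using c(1) h(1) AE by (intro integrable_const_bound) auto
  have "norm (\<integral>X. c X *\<^sub>R h X \<partial>D) \<le> (\<integral>X. norm (c X *\<^sub>R h X) \<partial>D)"
    by (rule integral_norm_bound)
  also have "\<dots> \<le> (\<integral>X. m * B \<partial>D)"
    by (intro integral_mono_AE integrable_norm[OF int] integrable_const AE)
  finally show "norm (\<integral>X. c X *\<^sub>R h X \<partial>D) \<le> m * B" by (simp add: prob_space)
qed

locale bounded_data =
  fixes D :: "'p::euclidean_space measure" and p :: real
  assumes prob: "prob_space D" and sets_D: "sets D = sets borel" and AE_ball: "AE X in D. X \<in> cball 0 p"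
begin

lemma borel_measurable_D: "continuous_on UNIV h \<Longrightarrow> h \<in> borel_measurable D"
  using borel_measurable_continuous_onI by (simp add: measurable_cong_sets[OF sets_D refl])

text \<open>All regularity in \<omega> is carried by f, so the weight need only be measurable and
  bounded. The constant does not depend on the weight, which later contains the labels and the
  evolving measure.\<close>

lemma C11_in_weighted_integral:
  fixes f :: "'p \<times> 'a::euclidean_space \<Rightarrow> real"
  assumes f: "smooth_expr f" and G: "\<And>z. GDERIV f z :> G z" "\<And>v. smooth_expr (\<lambda>z. G z \<bullet> v)"
  shows "\<exists>Q\<ge>0. \<forall>c. c \<in> borel_measurable D \<longrightarrow> (AE X in D. \<bar>c X\<bar> \<le> 1) \<longrightarrow>
    C11_in r Q (\<lambda>\<omega>. \<integral>X. c X * f (X, \<omega>) \<partial>D) (\<lambda>\<omega>. \<integral>X. c X *\<^sub>R snd (G (X, \<omega>)) \<partial>D)"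
proof -
  obtain Q where Q: "0 \<le> Q" "\<And>X. X \<in> cball 0 p \<Longrightarrow> C11_in r Q (\<lambda>\<omega>. f (X, \<omega>)) (\<lambda>\<omega>. snd (G (X, \<omega>)))"
    using C11_in_section[OF f G] by blast
  have meas: "(\<lambda>X. f (X, \<omega>)) \<in> borel_measurable D" "(\<lambda>X. snd (G (X, \<omega>))) \<in> borel_measurable D" for \<omega>
    by (intro borel_measurable_D continuous_on_snd
        continuous_on_compose2[OF smooth_expr_continuous[OF f, of UNIV]]
        continuous_on_compose2[OF smooth_gradient_continuous[OF G(2), of UNIV]] continuous_intros; simp)+
  show ?thesis
  proof (intro exI[of _ Q] conjI Q(1) allI impI)
    fix c :: "'p \<Rightarrow> real" assume c: "c \<in> borel_measurable D" "AE X in D. \<bar>c X\<bar> \<le> 1"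
    note int = integrable_weighted[OF prob AE_ball c] and bnd = integral_weighted_bound[OF prob AE_ball c]
    have int_f: "integrable D (\<lambda>X. c X * f (X, \<omega>))" and int_G: "integrable D (\<lambda>X. c X *\<^sub>R snd (G (X, \<omega>)))" for \<omega>
    proof -
      obtain q where q: "\<And>X. X \<in> cball 0 p \<Longrightarrow> C11_in (norm \<omega>) q (\<lambda>\<omega>. f (X, \<omega>)) (\<lambda>\<omega>. snd (G (X, \<omega>)))"
        using C11_in_section[OF f G] by blast
      show "integrable D (\<lambda>X. c X * f (X, \<omega>))"
        using int[OF meas(1), of \<omega> q] C11_in_value_bound[OF q] by simp
      show "integrable D (\<lambda>X. c X *\<^sub>R snd (G (X, \<omega>)))"
        using int[OF meas(2), of \<omega> q] C11_in_bound[OF q] by simp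
    qed
    show "C11_in r Q (\<lambda>\<omega>. \<integral>X. c X * f (X, \<omega>) \<partial>D) (\<lambda>\<omega>. \<integral>X. c X *\<^sub>R snd (G (X, \<omega>)) \<partial>D)"
      unfolding C11_in_def
    proof (intro conjI allI ballI)
      fix \<omega> :: 'a
      \<comment> \<open>Differentiability is claimed at every \<omega>, also outside the ball of
        radius r, so a separate constant is taken on a ball containing all increments of length at
        most 1.\<close>
      obtain q where q: "\<And>X. X \<in> cball 0 p \<Longrightarrow> C11_in (norm \<omega> + 1) q (\<lambda>\<omega>. f (X, \<omega>)) (\<lambda>\<omega>. snd (G (X, \<omega>)))"
        using C11_in_section[OF f G] by blast
      show "GDERIV (\<lambda>\<omega>. \<integral>X. c X * f (X, \<omega>) \<partial>D) \<omega> :> (\<integral>X. c X *\<^sub>R snd (G (X, \<omega>)) \<partial>D)"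
      proof (rule GDERIV_quadratic_remainder)
        fix v :: 'a assume v: "norm v \<le> 1"
        have "(\<integral>X. c X * f (X, \<omega> + v) \<partial>D) - (\<integral>X. c X * f (X, \<omega>) \<partial>D) - v \<bullet> (\<integral>X. c X *\<^sub>R snd (G (X, \<omega>)) \<partial>D)
          = (\<integral>X. c X * f (X, \<omega> + v) - c X * f (X, \<omega>) - v \<bullet> (c X *\<^sub>R snd (G (X, \<omega>))) \<partial>D)"
          using int_f int_G by (simp del: inner_scaleR_right)
        also have "\<dots> = (\<integral>X. c X *\<^sub>R (f (X, \<omega> + v) - f (X, \<omega>) - v \<bullet> snd (G (X, \<omega>))) \<partial>D)"
          by (simp add: algebra_simps)
        also have "norm \<dots> \<le> 1 * (q * (norm v)\<^sup>2)"
        proof (rule bnd)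
          show "(\<lambda>X. f (X, \<omega> + v) - f (X, \<omega>) - v \<bullet> snd (G (X, \<omega>))) \<in> borel_measurable D"
            by (intro borel_measurable_diff borel_measurable_inner borel_measurable_const meas)
          show "norm (f (X, \<omega> + v) - f (X, \<omega>) - v \<bullet> snd (G (X, \<omega>))) \<le> q * (norm v)\<^sup>2" if "X \<in> cball 0 p" for X
            using C11_in_remainder[OF q[OF that], of \<omega> v] v by simp
        qed
        finally show "\<bar>(\<integral>X. c X * f (X, \<omega> + v) \<partial>D) - (\<integral>X. c X * f (X, \<omega>) \<partial>D) - v \<bullet> (\<integral>X. c X *\<^sub>R snd (G (X, \<omega>)) \<partial>D)\<bar> \<le> q * (norm v)\<^sup>2"
          by simp
      qed
    next
      fix \<omega> :: 'a assume \<omega>: "\<omega> \<in> cball 0 r"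
      show "\<bar>\<integral>X. c X * f (X, \<omega>) \<partial>D\<bar> \<le> Q"
        using bnd[OF meas(1), of \<omega> Q] C11_in_value_bound[OF Q(2)] \<omega> by simp
      show "norm (\<integral>X. c X *\<^sub>R snd (G (X, \<omega>)) \<partial>D) \<le> Q"
        using bnd[OF meas(2), of \<omega> Q] C11_in_bound[OF Q(2)] \<omega> by simp
      fix \<omega>' :: 'a assume \<omega>': "\<omega>' \<in> cball 0 r"
      have "norm (\<integral>X. c X *\<^sub>R (snd (G (X, \<omega>)) - snd (G (X, \<omega>'))) \<partial>D) \<le> 1 * (Q * norm (\<omega> - \<omega>'))"
        using C11_in_Lipschitz[OF Q(2)] \<omega> \<omega>' by (intro bnd borel_measurable_diff meas) simp
      then show "norm ((\<integral>X. c X *\<^sub>R snd (G (X, \<omega>)) \<partial>D) - (\<integral>X. c X *\<^sub>R snd (G (X, \<omega>')) \<partial>D)) \<le> Q * norm (\<omega> - \<omega>')"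
        using int_G by (simp add: scaleR_diff_right)
    qed
  qed
qed

end

text \<open>Multiplied by a cutoff equal to 1 on K, the sections for X in a ball form one
  equi-Lipschitz class, while their integrals against measures on K are unchanged.\<close>

lemma narrowly_continuous_sections:
  fixes f :: "'p::euclidean_space \<times> 'a::euclidean_space \<Rightarrow> real"
  assumes f: "smooth_expr f"
    and K: "compact K" and \<rho>: "\<And>t. 0 \<le> t \<Longrightarrow> \<rho> t \<in> prob_on K" and cont: "narrowly_continuous \<rho>"
    and e: "0 < e"
  shows "\<exists>d>0. \<forall>s\<in>{0..T}. \<forall>t\<in>{0..T}. \<bar>s - t\<bar> < d \<longrightarrow>
    (\<forall>X\<in>cball 0 p. \<bar>(\<integral>\<omega>. f (X, \<omega>) \<partial>\<rho> s) - (\<integral>\<omega>. f (X, \<omega>) \<partial>\<rho> t)\<bar> \<le> e)"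
proof -
  obtain R where R: "0 < R" "\<And>x. x \<in> K \<Longrightarrow> norm x \<le> R"
    using compact_imp_bounded[OF K] unfolding bounded_pos by blast
  obtain \<eta> :: "'a \<Rightarrow> real" where \<eta>: "\<And>x. norm x \<le> R \<Longrightarrow> \<eta> x = 1"
    "\<And>Q. 0 \<le> Q \<Longrightarrow> \<exists>Q'. \<forall>u G. C11_in (R + 2) Q u G \<longrightarrow> (\<exists>G'. C11 Q' (\<lambda>x. \<eta> x * u x) G') \<and> (\<forall>x. \<bar>\<eta> x * u x\<bar> \<le> Q')"
    by (rule exists_cutoff[OF less_imp_le[OF R(1)], where 'a = 'a]) (rule that, assumption+)
  obtain G where G: "\<And>z. GDERIV f z :> G z" "\<And>v. smooth_expr (\<lambda>z. G z \<bullet> v)"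
    using smooth_expr_gradient[OF f] by blast
  obtain Q where Q: "0 \<le> Q" "\<And>X. X \<in> cball 0 p \<Longrightarrow> C11_in (R + 2) Q (\<lambda>\<omega>. f (X, \<omega>)) (\<lambda>\<omega>. snd (G (X, \<omega>)))"
    using C11_in_section[OF f G] by blast
  obtain Q' where Q': "\<And>u G. C11_in (R + 2) Q u G \<Longrightarrow> (\<exists>G'. C11 Q' (\<lambda>x. \<eta> x * u x) G') \<and> (\<forall>x. \<bar>\<eta> x * u x\<bar> \<le> Q')"
    using \<eta>(2)[OF Q(1)] by blast
  obtain d where d: "d > 0" "\<And>s t g. s \<in> {0..T} \<Longrightarrow> t \<in> {0..T} \<Longrightarrow> \<bar>s - t\<bar> < d \<Longrightarrow>
      (\<forall>x. \<bar>g x\<bar> \<le> \<bar>Q'\<bar>) \<and> (\<forall>x y. \<bar>g x - g y\<bar> \<le> \<bar>Q'\<bar> * norm (x - y)) \<Longrightarrow>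
      \<bar>(\<integral>x. g x \<partial>\<rho> s) - (\<integral>x. g x \<partial>\<rho> t)\<bar> \<le> e"
    using narrowly_continuous_equi_Lipschitz[OF K \<rho> cont abs_ge_zero e, of T Q'] by blast
  show ?thesis
  proof (intro exI[of _ d] conjI d(1) ballI impI)
    fix s t X assume st: "s \<in> {0..T}" "t \<in> {0..T}" "\<bar>s - t\<bar> < d" and X: "X \<in> cball (0::'p) p"
    obtain G' where u: "C11 Q' (\<lambda>\<omega>. \<eta> \<omega> * f (X, \<omega>)) G'" "\<And>\<omega>. \<bar>\<eta> \<omega> * f (X, \<omega>)\<bar> \<le> Q'"
      using Q'[OF Q(2)[OF X]] by blast
    have eq: "(\<integral>\<omega>. f (X, \<omega>) \<partial>\<rho> r) = (\<integral>\<omega>. \<eta> \<omega> * f (X, \<omega>) \<partial>\<rho> r)" if r: "0 \<le> r" for r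
    proof (rule integral_cong_AE)
      have "continuous_on UNIV (\<lambda>\<omega>. f (X, \<omega>))"
        by (rule continuous_on_compose2[OF smooth_expr_continuous[OF f, of UNIV]]) (auto intro!: continuous_intros)
      then show "(\<lambda>\<omega>. f (X, \<omega>)) \<in> borel_measurable (\<rho> r)"
        by (rule borel_measurable_prob_on[OF \<rho>[OF r]])
      show "(\<lambda>\<omega>. \<eta> \<omega> * f (X, \<omega>)) \<in> borel_measurable (\<rho> r)"
        by (rule borel_measurable_prob_on[OF \<rho>[OF r] C11_continuous_on[OF u(1)]])
      show "AE \<omega> in \<rho> r. f (X, \<omega>) = \<eta> \<omega> * f (X, \<omega>)"
        using AE_prob_on[OF \<rho>[OF r] K] by eventually_elim (simp add: \<eta>(1) R(2))
    qed
    have Q'0: "0 \<le> Q'" by (rule C11_nonneg[OF u(1)])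
    have "\<bar>(\<integral>\<omega>. \<eta> \<omega> * f (X, \<omega>) \<partial>\<rho> s) - (\<integral>\<omega>. \<eta> \<omega> * f (X, \<omega>) \<partial>\<rho> t)\<bar> \<le> e"
      by (intro d(2)[OF st]) (use u(2) C11_value_Lipschitz[OF u(1)] Q'0 in auto)
    then show "\<bar>(\<integral>\<omega>. f (X, \<omega>) \<partial>\<rho> s) - (\<integral>\<omega>. f (X, \<omega>) \<partial>\<rho> t)\<bar> \<le> e"
      using st by (simp add: eq)
  qed
qed

section \<open>Smoothness of the attention head in input and parameters\<close>

definition smooth_matrix :: "('e::euclidean_space \<Rightarrow> real^'m^'n) \<Rightarrow> bool" where
  "smooth_matrix A \<longleftrightarrow> (\<forall>i j. smooth_expr (\<lambda>z. A z $ i $ j))"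

lemma smooth_matrix_mult: "smooth_matrix A \<Longrightarrow> smooth_matrix B \<Longrightarrow> smooth_matrix (\<lambda>z. A z ** B z)"
  unfolding smooth_matrix_def matrix_matrix_mult_def
  by (auto intro!: smooth_sum smooth_expr.smooth_mult)

lemma smooth_matrix_transpose: "smooth_matrix A \<Longrightarrow> smooth_matrix (\<lambda>z. transpose (A z))"
  unfolding smooth_matrix_def transpose_def by auto

lemma smooth_matrix_const: "smooth_matrix (\<lambda>_. A)"
  unfolding smooth_matrix_def by (auto intro: smooth_expr.intros)

text \<open>Applied to the projections of the product space onto its matrix blocks: an entry of a
  linear image is an inner product with the adjoint image of a matrix unit.\<close>

lemma smooth_matrix_adjoint:
  assumes "\<And>z M. L z \<bullet> M = z \<bullet> adj M" shows "smooth_matrix L"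
  unfolding smooth_matrix_def
proof (intro allI)
  fix i j
  have "(\<lambda>z. L z $ i $ j) = (\<lambda>z. z \<bullet> adj (axis i (axis j 1)))"
    by (auto simp: assms[symmetric] inner_axis)
  then show "smooth_expr (\<lambda>z. L z $ i $ j)" by (simp add: smooth_expr.intros)
qed

lemma smooth_matrix_attn:
  assumes "smooth_matrix WQ" "smooth_matrix WK" "smooth_matrix X"
  shows "smooth_matrix (\<lambda>z. attn (WQ z) (WK z) (X z))"
proof -
  have logit: "smooth_expr (\<lambda>z. attn_logit (WQ z) (WK z) (X z) r s)" for r s
  proof -
    have "smooth_matrix (\<lambda>z. X z ** WQ z ** transpose (WK z) ** transpose (X z))"
      by (intro smooth_matrix_mult smooth_matrix_transpose assms)
    then show ?thesis
      unfolding attn_logit_def divide_inverse smooth_matrix_def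
      by (auto intro: smooth_expr.smooth_mult smooth_expr.smooth_const)
  qed
  have *: "smooth_expr (\<lambda>z. exp (attn_logit (WQ z) (WK z) (X z) r s) *
      inverse (\<Sum>s'\<in>{..r}. exp (attn_logit (WQ z) (WK z) (X z) r s')))" for r s
  proof (intro smooth_expr.smooth_mult smooth_expr.smooth_inverse smooth_sum smooth_expr.smooth_exp logit)
    fix z
    have "0 < (\<Sum>s'\<in>{..r}. exp (attn_logit (WQ z) (WK z) (X z) r s'))"
      by (intro sum_pos) auto
    then show "(\<Sum>s'\<in>{..r}. exp (attn_logit (WQ z) (WK z) (X z) r s')) \<noteq> 0" by simp
  qed
  have "smooth_expr (\<lambda>z. attn (WQ z) (WK z) (X z) $ r $ s)" for r s
    using *[of r s] by (cases "s \<le> r") (simp_all add: attn_def divide_inverse smooth_expr.smooth_const)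
  then show ?thesis by (simp add: smooth_matrix_def)
qed

text \<open>Joint smoothness in input and head is what makes later constants uniform over the
  compact range of inputs.\<close>

lemma smooth_expr_psi:
  fixes Wout :: "real^'v^'x" and l :: "'l::{finite,linorder}"
  shows "smooth_expr (\<lambda>z :: ('x, 'l) input \<times> ('x, 'k::finite) head. psi Wout l (fst z) (snd z) $ j)"
proof -
  have "smooth_matrix (\<lambda>z :: ('x, 'l) input \<times> ('x, 'k) head.
      attn (fst (snd z)) (fst (snd (snd z))) (fst z) ** fst z **
      fst (snd (snd (snd z))) ** snd (snd (snd (snd z))) ** Wout)"
    by (intro smooth_matrix_mult smooth_matrix_attn smooth_matrix_const
        smooth_matrix_adjoint[of fst "\<lambda>M. (M, 0)"]
        smooth_matrix_adjoint[of "\<lambda>z. fst (snd z)" "\<lambda>M. (0, M, 0)"]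
        smooth_matrix_adjoint[of "\<lambda>z. fst (snd (snd z))" "\<lambda>M. (0, 0, M, 0)"]
        smooth_matrix_adjoint[of "\<lambda>z. fst (snd (snd (snd z)))" "\<lambda>M. (0, 0, 0, M, 0)"]
        smooth_matrix_adjoint[of "\<lambda>z. snd (snd (snd (snd z)))" "\<lambda>M. (0, 0, 0, 0, M)"])
      (auto simp: inner_prod_def)
  then show ?thesis
    unfolding smooth_matrix_def psi_def row_def by (simp add: case_prod_beta)
qed

section \<open>The gradient of the first variation\<close>

lemma grad_eqI: "GDERIV f x :> D \<Longrightarrow> grad f x = D"
  unfolding grad_def
proof (rule the_equality)
  fix D' assume "GDERIV f x :> D" "GDERIV f x :> D'"
  then have "(\<lambda>h. h \<bullet> D') = (\<lambda>h. h \<bullet> D)"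
    unfolding gderiv_def using has_derivative_unique by blast
  from fun_cong[OF this, of "D' - D"] have "(D' - D) \<bullet> (D' - D) = 0"
    by (simp add: inner_diff_right)
  then show "D' = D" by simp
qed

lemma C11_in_mono: "C11_in r Q u G \<Longrightarrow> Q \<le> Q' \<Longrightarrow> C11_in r Q' u G"
  unfolding C11_in_def by (meson mult_right_mono norm_ge_zero order_trans)

context bounded_data begin

lemma integrable_weighted_continuous:
  fixes h :: "'p \<Rightarrow> 'b::{banach, second_countable_topology}"
  assumes "c \<in> borel_measurable D" "AE X in D. \<bar>c X\<bar> \<le> m" "continuous_on UNIV h"
  shows "integrable D (\<lambda>X. c X *\<^sub>R h X)"
proof -
  obtain B where "\<And>X. X \<in> cball 0 p \<Longrightarrow> norm (h X) \<le> B"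
    using compact_imp_bounded[OF compact_continuous_image[OF continuous_on_subset[OF assms(3) subset_UNIV] compact_cball[of 0 p]]]
    unfolding bounded_iff by (auto simp del: mem_cball_0 mem_cball)
  then show ?thesis
    by (rule integrable_weighted[OF prob AE_ball assms(1,2) borel_measurable_D[OF assms(3)]])
qed

end

lemma continuous_on_softmax: "continuous_on S softmax"
proof -
  have "(\<Sum>m\<in>UNIV. exp (z $ m)) \<noteq> (0::real)" for z :: "real^'v"
    using sum_pos[of "UNIV :: 'v set" "\<lambda>m. exp (z $ m)"] by simp
  then show ?thesis
    unfolding softmax_def[abs_def] by (intro continuous_intros) auto
qed

lemma softmax_bounds: "0 \<le> softmax z $ j" "softmax z $ j \<le> 1"
proof -
  have "exp (z $ j) \<le> (\<Sum>m\<in>UNIV. exp (z $ m))"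
    by (rule member_le_sum) auto
  moreover from this have "0 < (\<Sum>m\<in>UNIV. exp (z $ m))"
    using exp_gt_zero by (rule less_le_trans[rotated])
  ultimately show "0 \<le> softmax z $ j" "softmax z $ j \<le> 1"
    unfolding softmax_def by simp_all
qed

text \<open>The equation is not assumed: regularity of the velocity in time follows from narrow
  continuity. The locale is instantiated both for the solution and for the constant stationary
  curve.\<close>

locale attention_curve =
  fixes Wout :: "real^'v^'x"
    and D :: "('x, 'l::{finite,linorder}) input measure"
    and Y :: "'l \<Rightarrow> ('x, 'l) input \<Rightarrow> real^'v"
    and K :: "('x, 'k::finite) head set"
    and Kx :: "(real^'x) set"
    and \<zeta> :: "real \<Rightarrow> real"
    and \<rho> :: "real \<Rightarrow> ('x, 'k) head measure"
  assumes data: "data_law D Y"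
    and lr: "learning_rate \<zeta>"
    and smooth: "smoothness Wout D K Kx"
    and prob_on_K: "\<And>t. 0 \<le> t \<Longrightarrow> \<rho> t \<in> prob_on K"
    and narrow: "narrowly_continuous \<rho>"
begin

lemma K: "compact K" using smooth by (simp add: smoothness_def)

definition input_radius :: real where
  "input_radius = (SOME p. AE X in D. X \<in> cball 0 p)"

sublocale bounded_data D input_radius
proof (rule bounded_data.intro)
  show "prob_space D" "sets D = sets borel" using data by (auto simp: data_law_def)
  obtain B where B: "\<And>x. x \<in> Kx \<Longrightarrow> norm x \<le> B"
  proof -
    have "compact Kx" using smooth by (simp add: smoothness_def)
    from compact_imp_bounded[OF this] show ?thesis using that unfolding bounded_iff by blast
  qed
  have "AE X in D. \<forall>l. X $ l \<in> Kx" using smooth by (simp add: smoothness_def)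
  then have "AE X in D. X \<in> cball 0 (real CARD('l) * B)"
  proof eventually_elim
    case (elim X)
    have "norm X \<le> (\<Sum>l\<in>UNIV. norm (X $ l))" by (simp add: norm_vec_def L2_set_le_sum)
    also have "\<dots> \<le> (\<Sum>l\<in>(UNIV::'l set). B)" using elim B by (intro sum_mono) auto
    finally show ?case by simp
  qed
  then show "AE X in D. X \<in> cball 0 input_radius"
    unfolding input_radius_def by (rule someI)
qed

text \<open>The first variation is a finite sum over pairs (position, output coordinate). Time and
  labels enter only through \<open>coef\<close>, the parameter \<omega> only through
  \<open>psi_comp\<close>, which also absorbs the factor 1 / L.\<close>

definition coef :: "real \<Rightarrow> 'l \<times> 'v \<Rightarrow> ('x, 'l) input \<Rightarrow> real" where
  "coef t = (\<lambda>(l, j) X. softmax (mean_logit Wout l X (\<rho> t)) $ j - Y l X $ j)"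

definition psi_comp :: "'l \<times> 'v \<Rightarrow> ('x, 'l) input \<times> ('x, 'k) head \<Rightarrow> real" where
  "psi_comp = (\<lambda>(l, j) z. 1 / real CARD('l) * psi Wout l (fst z) (snd z) $ j)"

lemma smooth_psi_comp: "smooth_expr (psi_comp q)"
  unfolding psi_comp_def case_prod_beta by (intro smooth_expr.smooth_mult smooth_expr.smooth_const smooth_expr_psi)

lemma psi_continuous: "continuous_on S (\<lambda>z. psi Wout (l :: 'l) (fst z) (snd z :: ('x, 'k) head))"
proof -
  have "continuous_on S (\<lambda>z. \<chi> j. psi Wout l (fst z) (snd z :: ('x, 'k) head) $ j)"
    by (intro continuous_on_vec_lambda smooth_expr_continuous smooth_expr_psi)
  then show ?thesis by simp
qed

lemma psi_section_continuous: "continuous_on S (psi Wout (l :: 'l) X :: ('x, 'k) head \<Rightarrow> _)"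
  using continuous_on_compose2[OF psi_continuous[of UNIV l]
      continuous_on_Pair[OF continuous_on_const continuous_on_id]] by simp

lemma mean_logit_nth:
  assumes "0 \<le> t"
  shows "mean_logit Wout (l :: 'l) X (\<rho> t) $ j = (\<integral>\<omega>. psi Wout l X \<omega> $ j \<partial>\<rho> t)"
proof -
  have "integrable (\<rho> t) (psi Wout l X)"
    by (rule integrable_prob_on[OF prob_on_K[OF assms] K psi_section_continuous])
  from integral_inner_left[OF this, of "axis j 1"] show ?thesis
    unfolding mean_logit_def by (simp add: inner_axis)
qed

text \<open>A parameter integral of a jointly continuous function, hence measurable in X as an
  integral over one factor of a product measure.\<close>

lemma borel_measurable_mean_logit:
  assumes t: "0 \<le> t"
  shows "(\<lambda>X. mean_logit Wout (l :: 'l) X (\<rho> t) $ j) \<in> borel_measurable D"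
proof -
  interpret R: prob_space "\<rho> t" by (rule prob_on_prob_space[OF prob_on_K[OF t] K])
  have sets: "sets (\<rho> t) = sets borel" by (rule sets_prob_on[OF prob_on_K[OF t] K])
  have "sets (D \<Otimes>\<^sub>M \<rho> t) = sets (borel \<Otimes>\<^sub>M borel)"
    by (rule sets_pair_measure_cong[OF sets_D sets])
  then have eq: "sets (D \<Otimes>\<^sub>M \<rho> t) = sets borel"
    unfolding borel_prod[where 'a = "('x, 'l) input" and 'b = "('x, 'k) head"] .
  have "(\<lambda>z. psi Wout l (fst z) (snd z) $ j) \<in> borel_measurable (D \<Otimes>\<^sub>M \<rho> t)"
    using borel_measurable_continuous_onI[OF smooth_expr_continuous[OF smooth_expr_psi]]
    by (simp add: measurable_cong_sets[OF eq refl])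
  then show ?thesis
    unfolding mean_logit_nth[OF t]
    by (intro R.borel_measurable_lebesgue_integral) (simp add: case_prod_beta)
qed

lemma borel_measurable_coef:
  assumes t: "0 \<le> t"
  shows "coef t q \<in> borel_measurable D"
proof -
  obtain l j where q: "q = (l, j)" by (cases q)
  have [measurable]: "(\<lambda>X. mean_logit Wout l X (\<rho> t) $ m) \<in> borel_measurable D" for m
    by (rule borel_measurable_mean_logit[OF t])
  have "Y l \<in> borel_measurable D" using data by (simp add: data_law_def)
  then have [measurable]: "(\<lambda>X. Y l X $ j) \<in> borel_measurable D"
    by (rule measurable_compose) (intro borel_measurable_continuous_onI continuous_intros)
  have "(\<lambda>X. exp (mean_logit Wout l X (\<rho> t) $ j) / (\<Sum>m\<in>UNIV. exp (mean_logit Wout l X (\<rho> t) $ m)) - Y l X $ j)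
      \<in> borel_measurable D"
    by measurable
  then show ?thesis by (simp add: q coef_def softmax_def)
qed

text \<open>A softmax entry lies between 0 and 1, and a one-hot entry is 0 or 1.\<close>

lemma AE_coef_bound: "AE X in D. \<bar>coef t q X\<bar> \<le> 1"
proof -
  obtain l j where q: "q = (l, j)" by (cases q)
  have "AE X in D. \<forall>l. one_hot (Y l X)" using data by (simp add: data_law_def)
  then show ?thesis
  proof eventually_elim
    case (elim X)
    then obtain m where "Y l X = axis m 1" unfolding one_hot_def by blast
    then have "Y l X $ j = 0 \<or> Y l X $ j = 1" by (auto simp: axis_def)
    then show ?case
      using softmax_bounds[of "mean_logit Wout l X (\<rho> t)" j] by (auto simp: q coef_def)
  qed
qed

lemma mean_logit_bounded:
  obtains B where "0 \<le> B" "\<And>t l X. 0 \<le> t \<Longrightarrow> X \<in> cball 0 input_radius \<Longrightarrow> norm (mean_logit Wout (l :: 'l) X (\<rho> t)) \<le> B"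
proof -
  have "\<exists>B. \<forall>X\<in>cball 0 input_radius. \<forall>\<omega>\<in>K. norm (psi Wout l X \<omega>) \<le> B" for l :: 'l
  proof -
    obtain B where "\<And>z. z \<in> cball 0 input_radius \<times> K \<Longrightarrow> norm (psi Wout l (fst z) (snd z)) \<le> B"
      using compact_imp_bounded[OF compact_continuous_image[OF psi_continuous[of _ l] compact_Times[OF compact_cball[of 0 input_radius] K]]]
      unfolding bounded_iff by blast
    from this[of "(X, \<omega>)" for X \<omega>] show ?thesis by (intro exI[of _ B]) simp
  qed
  then obtain B where B: "\<And>l X \<omega>. X \<in> cball 0 input_radius \<Longrightarrow> \<omega> \<in> K \<Longrightarrow> norm (psi Wout (l :: 'l) X \<omega>) \<le> B l"
    by metis
  show thesis
  proof (rule that[of "\<Sum>l\<in>UNIV. \<bar>B l\<bar>"])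
    fix t :: real and l :: 'l and X :: "('x, 'l) input"
    assume t: "0 \<le> t" and X: "X \<in> cball 0 input_radius"
    have "norm (mean_logit Wout l X (\<rho> t)) \<le> B l"
      unfolding mean_logit_def by (rule integral_prob_on_bound[OF prob_on_K[OF t] K psi_section_continuous B[OF X]])
    also have "\<dots> \<le> \<bar>B l\<bar>" by simp
    also have "\<dots> \<le> (\<Sum>l\<in>UNIV. \<bar>B l\<bar>)" by (rule member_le_sum) auto
    finally show "norm (mean_logit Wout l X (\<rho> t)) \<le> (\<Sum>l\<in>UNIV. \<bar>B l\<bar>)" .
  qed (simp add: sum_nonneg)
qed

text \<open>Mean logits are close in time uniformly over inputs, and all of them lie in one ball, on
  which softmax is uniformly continuous. The labels cancel in the difference.\<close>

lemma coef_time_uniform: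
  assumes e: "0 < e"
  shows "\<exists>d>0. \<forall>s\<in>{0..T}. \<forall>t\<in>{0..T}. \<bar>s - t\<bar> < d \<longrightarrow>
    (\<forall>q. \<forall>X\<in>cball 0 input_radius. \<bar>coef s q X - coef t q X\<bar> \<le> e)"
proof -
  obtain B where "0 \<le> B" and B: "\<And>t l X. 0 \<le> t \<Longrightarrow> X \<in> cball 0 input_radius \<Longrightarrow> norm (mean_logit Wout (l :: 'l) X (\<rho> t)) \<le> B"
    by (rule mean_logit_bounded) (rule that, assumption+)
  have "uniformly_continuous_on (cball (0::real^'v) B) softmax"
    by (intro compact_uniformly_continuous continuous_on_softmax compact_cball)
  then have "\<exists>d0>0. \<forall>z\<in>cball (0::real^'v) B. \<forall>w\<in>cball 0 B. dist w z < d0 \<longrightarrow> dist (softmax w) (softmax z) < e"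
    using e unfolding uniformly_continuous_on_def by blast
  then obtain d0 where d0: "d0 > 0" "\<And>z w :: real^'v. z \<in> cball 0 B \<Longrightarrow> w \<in> cball 0 B \<Longrightarrow> dist w z < d0 \<Longrightarrow> dist (softmax w) (softmax z) < e"
    by blast
  \<comment> \<open>Closeness is known per component; summing over the output coordinates gives at
    most d0 / 2.\<close>
  define e1 where "e1 = d0 / (2 * real CARD('v))"
  have e1: "e1 > 0" using d0(1) by (simp add: e1_def)
  have "\<forall>q :: 'l \<times> 'v. \<exists>d>0. \<forall>s\<in>{0..T}. \<forall>t\<in>{0..T}. \<bar>s - t\<bar> < d \<longrightarrow> (\<forall>X\<in>cball 0 input_radius.
      \<bar>(\<integral>\<omega>. psi Wout (fst q) X \<omega> $ snd q \<partial>\<rho> s) - (\<integral>\<omega>. psi Wout (fst q) X \<omega> $ snd q \<partial>\<rho> t)\<bar> \<le> e1)"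
  proof
    fix q :: "'l \<times> 'v"
    show "\<exists>d>0. \<forall>s\<in>{0..T}. \<forall>t\<in>{0..T}. \<bar>s - t\<bar> < d \<longrightarrow> (\<forall>X\<in>cball 0 input_radius.
      \<bar>(\<integral>\<omega>. psi Wout (fst q) X \<omega> $ snd q \<partial>\<rho> s) - (\<integral>\<omega>. psi Wout (fst q) X \<omega> $ snd q \<partial>\<rho> t)\<bar> \<le> e1)"
      using narrowly_continuous_sections[OF smooth_expr_psi[of Wout "fst q" "snd q"] K prob_on_K narrow e1, of T input_radius] by simp
  qed
  from choice[OF this] obtain d where d: "\<forall>q :: 'l \<times> 'v. 0 < d q \<and> (\<forall>s\<in>{0..T}. \<forall>t\<in>{0..T}. \<bar>s - t\<bar> < d q \<longrightarrow> (\<forall>X\<in>cball 0 input_radius.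
      \<bar>(\<integral>\<omega>. psi Wout (fst q) X \<omega> $ snd q \<partial>\<rho> s) - (\<integral>\<omega>. psi Wout (fst q) X \<omega> $ snd q \<partial>\<rho> t)\<bar> \<le> e1))"
    by (elim exE) (rule that)
  define d' where "d' = Min (range d)"
  have d': "d' > 0" "\<And>q. d' \<le> d q" using d by (simp_all add: d'_def)
  show ?thesis
  proof (intro exI[of _ d'] conjI d'(1) ballI impI allI)
    fix s t :: real and q :: "'l \<times> 'v" and X :: "('x, 'l) input"
    assume st: "s \<in> {0..T}" "t \<in> {0..T}" "\<bar>s - t\<bar> < d'" and X: "X \<in> cball 0 input_radius"
    obtain l j where q: "q = (l, j)" by (cases q)
    let ?z = "\<lambda>t. mean_logit Wout l X (\<rho> t)"
    have "\<bar>?z s $ m - ?z t $ m\<bar> \<le> e1" for m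
      using d[THEN spec, of "(l, m)", THEN conjunct2, THEN bspec, OF st(1), THEN bspec, OF st(2), THEN mp, THEN bspec, OF _ X]
        st d'(2)[of "(l, m)"] by (simp add: mean_logit_nth)
    then have "norm (?z s - ?z t) \<le> (\<Sum>m\<in>(UNIV::'v set). e1)"
      by (intro order_trans[OF norm_le_l1_cart] sum_mono) simp
    also have "\<dots> < d0" using d0(1) by (simp add: e1_def)
    finally have "dist (softmax (?z s)) (softmax (?z t)) < e"
      using B[OF _ X] st by (intro d0(2)) (auto simp: dist_norm)
    moreover have "\<bar>(softmax (?z s) - softmax (?z t)) $ j\<bar> \<le> norm (softmax (?z s) - softmax (?z t))"
      by (rule component_le_norm_cart)
    ultimately show "\<bar>coef s q X - coef t q X\<bar> \<le> e"
      by (simp add: q coef_def dist_norm)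
  qed
qed

definition psi_grad :: "'l \<times> 'v \<Rightarrow> ('x, 'l) input \<times> ('x, 'k) head \<Rightarrow> ('x, 'l) input \<times> ('x, 'k) head" where
  "psi_grad q = (SOME G. (\<forall>z. GDERIV (psi_comp q) z :> G z) \<and> (\<forall>v. smooth_expr (\<lambda>z. G z \<bullet> v)))"

lemma GDERIV_psi_comp: "GDERIV (psi_comp q) z :> psi_grad q z"
  and smooth_psi_grad: "smooth_expr (\<lambda>z. psi_grad q z \<bullet> v)"
proof -
  have *: "(\<forall>z. GDERIV (psi_comp q) z :> psi_grad q z) \<and> (\<forall>v. smooth_expr (\<lambda>z. psi_grad q z \<bullet> v))"
    unfolding psi_grad_def by (rule someI_ex[OF smooth_expr_gradient[OF smooth_psi_comp]])
  show "GDERIV (psi_comp q) z :> psi_grad q z" by (rule *[THEN conjunct1, THEN spec])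
  show "smooth_expr (\<lambda>z. psi_grad q z \<bullet> v)" by (rule *[THEN conjunct2, THEN spec])
qed

lemma psi_grad_continuous: "continuous_on S (\<lambda>X. snd (psi_grad q (X, \<omega>)))"
  by (intro continuous_on_snd
        continuous_on_compose2[OF smooth_gradient_continuous[OF smooth_psi_grad, of UNIV]] continuous_intros) auto

definition Phi_grad :: "real \<Rightarrow> ('x, 'k) head \<Rightarrow> ('x, 'k) head" where
  "Phi_grad t \<omega> = (\<Sum>q\<in>UNIV. \<integral>X. coef t q X *\<^sub>R snd (psi_grad q (X, \<omega>)) \<partial>D)"

lemma Phi_eq:
  assumes t: "0 \<le> t"
  shows "Phi Wout D Y \<omega> (\<rho> t) = (\<Sum>q\<in>UNIV. \<integral>X. coef t q X * psi_comp q (X, \<omega>) \<partial>D)"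
proof -
  have "continuous_on UNIV (\<lambda>X. psi_comp q (X, \<omega>))" for q
    by (intro continuous_on_compose2[OF smooth_expr_continuous[OF smooth_psi_comp, of UNIV]] continuous_intros) auto
  then have int: "integrable D (\<lambda>X. coef t q X * psi_comp q (X, \<omega>))" for q
    using integrable_weighted_continuous[OF borel_measurable_coef[OF t] AE_coef_bound, of "\<lambda>X. psi_comp q (X, \<omega>)"] by simp
  have pairs: "(\<Sum>q\<in>UNIV. g q) = (\<Sum>l\<in>UNIV. \<Sum>j\<in>UNIV. g (l, j))" for g :: "'l \<times> 'v \<Rightarrow> real"
    by (simp add: sum.cartesian_product)
  have "1 / real CARD('l) * (\<Sum>l\<in>UNIV. (softmax (mean_logit Wout l X (\<rho> t)) - Y l X) \<bullet> psi Wout l X \<omega>) =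
      (\<Sum>q\<in>UNIV. coef t q X * psi_comp q (X, \<omega>))" for X
    by (simp add: pairs inner_vec_def coef_def psi_comp_def sum_distrib_left mult_ac)
  then show ?thesis
    unfolding Phi_def using int by simp
qed

lemma GDERIV_Phi:
  assumes t: "0 \<le> t"
  shows "GDERIV (\<lambda>\<omega>. Phi Wout D Y \<omega> (\<rho> t)) \<omega> :> Phi_grad t \<omega>"
proof -
  have "GDERIV (\<lambda>\<omega>. \<integral>X. coef t q X * psi_comp q (X, \<omega>) \<partial>D) \<omega> :> (\<integral>X. coef t q X *\<^sub>R snd (psi_grad q (X, \<omega>)) \<partial>D)" for q
    using C11_in_weighted_integral[OF smooth_psi_comp GDERIV_psi_comp smooth_psi_grad, of 0 q]
      borel_measurable_coef[OF t] AE_coef_bound C11_in_GDERIV by blast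
  then show ?thesis
    unfolding Phi_eq[OF t] Phi_grad_def gderiv_def inner_sum_right by (intro has_derivative_sum)
qed

lemma grad_Phi_eq: "0 \<le> t \<Longrightarrow> grad_Phi Wout D Y \<omega> (\<rho> t) = Phi_grad t \<omega>"
  by (rule grad_eqI[OF GDERIV_Phi])

lemma Phi_grad_bounds:
  obtains B where "0 \<le> B" "\<And>t \<omega>. 0 \<le> t \<Longrightarrow> norm \<omega> \<le> r \<Longrightarrow> norm (Phi_grad t \<omega>) \<le> B"
    "\<And>s t \<omega> e. 0 \<le> s \<Longrightarrow> 0 \<le> t \<Longrightarrow> norm \<omega> \<le> r \<Longrightarrow> 0 \<le> e \<Longrightarrow>
       (\<forall>q. \<forall>X\<in>cball 0 input_radius. \<bar>coef s q X - coef t q X\<bar> \<le> e) \<Longrightarrow> norm (Phi_grad s \<omega> - Phi_grad t \<omega>) \<le> e * B"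
proof -
  have "\<exists>Q. \<forall>q. 0 \<le> Q q \<and> (\<forall>X\<in>cball 0 input_radius. C11_in r (Q q) (\<lambda>\<omega>. psi_comp q (X, \<omega>)) (\<lambda>\<omega>. snd (psi_grad q (X, \<omega>))))"
    by (intro choice allI) (use C11_in_section[OF smooth_psi_comp GDERIV_psi_comp smooth_psi_grad] in blast)
  then obtain Q where Q: "\<And>q. 0 \<le> Q q" "\<And>q X. X \<in> cball 0 input_radius \<Longrightarrow>
      C11_in r (Q q) (\<lambda>\<omega>. psi_comp q (X, \<omega>)) (\<lambda>\<omega>. snd (psi_grad q (X, \<omega>)))"
    by blast
  note meas = borel_measurable_D[OF psi_grad_continuous]
  show thesis
  proof (rule that[of "\<Sum>q\<in>UNIV. Q q"])
    show "norm (Phi_grad t \<omega>) \<le> (\<Sum>q\<in>UNIV. Q q)" if t: "0 \<le> t" and \<omega>: "norm \<omega> \<le> r" for t \<omega>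
      unfolding Phi_grad_def
    proof (intro order_trans[OF norm_sum] sum_mono)
      show "norm (\<integral>X. coef t q X *\<^sub>R snd (psi_grad q (X, \<omega>)) \<partial>D) \<le> Q q" for q
        using integral_weighted_bound[OF prob AE_ball borel_measurable_coef[OF t] AE_coef_bound meas C11_in_bound[OF Q(2) \<omega>]]
        by simp
    qed
    show "norm (Phi_grad s \<omega> - Phi_grad t \<omega>) \<le> e * (\<Sum>q\<in>UNIV. Q q)"
      if s: "0 \<le> s" and t: "0 \<le> t" and \<omega>: "norm \<omega> \<le> r" and e: "0 \<le> e"
        and close: "\<forall>q. \<forall>X\<in>cball 0 input_radius. \<bar>coef s q X - coef t q X\<bar> \<le> e" for s t \<omega> e
      unfolding Phi_grad_def sum_subtractf[symmetric] sum_distrib_left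
    proof (intro order_trans[OF norm_sum] sum_mono)
      fix q
      have AE: "AE X in D. \<bar>coef s q X - coef t q X\<bar> \<le> e"
        using AE_ball by eventually_elim (simp add: close)
      have "norm (\<integral>X. (coef s q X - coef t q X) *\<^sub>R snd (psi_grad q (X, \<omega>)) \<partial>D) \<le> e * Q q"
        by (rule integral_weighted_bound[OF prob AE_ball borel_measurable_diff[OF borel_measurable_coef[OF s] borel_measurable_coef[OF t]]
              AE meas C11_in_bound[OF Q(2) \<omega>]])
      moreover have "integrable D (\<lambda>X. coef u q X *\<^sub>R snd (psi_grad q (X, \<omega>)))" if "0 \<le> u" for u
        by (rule integrable_weighted_continuous[OF borel_measurable_coef[OF that] AE_coef_bound psi_grad_continuous])
      ultimately show "norm ((\<integral>X. coef s q X *\<^sub>R snd (psi_grad q (X, \<omega>)) \<partial>D) - (\<integral>X. coef t q X *\<^sub>R snd (psi_grad q (X, \<omega>)) \<partial>D)) \<le> e * Q q"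
        using s t by (simp add: scaleR_diff_left)
    qed
  qed (simp add: sum_nonneg Q)
qed

text \<open>Each component of the gradient is again a weighted integral of smooth expressions, so
  the result for weighted integrals applies one order higher. The vector (0, i) selects a direction
  in the parameter block.\<close>

lemma Phi_grad_component_C11_in:
  obtains Q where "0 \<le> Q" "\<And>t i. 0 \<le> t \<Longrightarrow> i \<in> Basis \<Longrightarrow> \<exists>G. C11_in r Q (\<lambda>\<omega>. Phi_grad t \<omega> \<bullet> i) G"
proof -
  define F where "F q i t \<omega> = (\<integral>X. coef t q X * (psi_grad q (X, \<omega>) \<bullet> (0, i)) \<partial>D)" for q i t \<omega>
  have "\<exists>Q\<ge>0. \<forall>t\<ge>0. \<exists>G. C11_in r Q (F q i t) G" for q i
  proof -
    obtain G where G: "\<And>z. GDERIV (\<lambda>z. psi_grad q z \<bullet> (0, i)) z :> G z" "\<And>v. smooth_expr (\<lambda>z. G z \<bullet> v)"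
      using smooth_expr_gradient[OF smooth_psi_grad] by blast
    show ?thesis
      unfolding F_def
      using C11_in_weighted_integral[OF smooth_psi_grad G, of r] borel_measurable_coef AE_coef_bound by blast
  qed
  then obtain Q where Q: "\<And>q i. 0 \<le> Q q i" "\<And>q i t. 0 \<le> t \<Longrightarrow> \<exists>G. C11_in r (Q q i) (F q i t) G"
    by metis
  show thesis
  proof (rule that[of "\<Sum>i\<in>Basis. \<Sum>q\<in>UNIV. Q q i"])
    fix t :: real and i :: "('x, 'k) head" assume t: "0 \<le> t" and i: "i \<in> Basis"
    have "\<forall>q. \<exists>G. C11_in r (Q q i) (F q i t) G"
      using Q(2)[OF t] by blast
    from choice[OF this] obtain G where "\<And>q. C11_in r (Q q i) (F q i t) (G q)"
      by blast
    then have "C11_in r (\<Sum>q\<in>UNIV. Q q i) (\<lambda>\<omega>. \<Sum>q\<in>UNIV. F q i t \<omega>) (\<lambda>\<omega>. \<Sum>q\<in>UNIV. G q \<omega>)"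
      by (rule C11_in_sum)
    moreover have "(\<Sum>q\<in>UNIV. F q i t \<omega>) = Phi_grad t \<omega> \<bullet> i" for \<omega>
    proof -
      have int: "integrable D (\<lambda>X. coef t q X *\<^sub>R snd (psi_grad q (X, \<omega>)))" for q
        by (rule integrable_weighted_continuous[OF borel_measurable_coef[OF t] AE_coef_bound psi_grad_continuous])
      have snd: "psi_grad q z \<bullet> (0, i) = snd (psi_grad q z) \<bullet> i" for q z
        by (simp only: inner_prod_def[of "psi_grad q z"] fst_conv snd_conv inner_zero_right add_0)
      show ?thesis
        unfolding Phi_grad_def inner_sum_left F_def snd integral_inner_left[OF int, symmetric] inner_scaleR_left ..
    qed
    ultimately have "C11_in r (\<Sum>q\<in>UNIV. Q q i) (\<lambda>\<omega>. Phi_grad t \<omega> \<bullet> i) (\<lambda>\<omega>. \<Sum>q\<in>UNIV. G q \<omega>)" by simp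
    moreover have "(\<Sum>q\<in>UNIV. Q q i) \<le> (\<Sum>i\<in>Basis. \<Sum>q\<in>UNIV. Q q i)"
      using i Q(1) by (intro member_le_sum sum_nonneg) auto
    ultimately have "C11_in r (\<Sum>i\<in>Basis. \<Sum>q\<in>UNIV. Q q i) (\<lambda>\<omega>. Phi_grad t \<omega> \<bullet> i) (\<lambda>\<omega>. \<Sum>q\<in>UNIV. G q \<omega>)"
      by (rule C11_in_mono)
    then show "\<exists>G. C11_in r (\<Sum>i\<in>Basis. \<Sum>q\<in>UNIV. Q q i) (\<lambda>\<omega>. Phi_grad t \<omega> \<bullet> i) G"
      by blast
  qed (intro sum_nonneg Q)
qed

lemma Phi_grad_continuous:
  assumes "0 \<le> t" shows "continuous_on S (Phi_grad t)"
proof (subst continuous_on_componentwise, intro ballI)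
  fix i :: "('x, 'k) head" assume i: "i \<in> Basis"
  \<comment> \<open>Only differentiability is wanted, and \<open>C11_in\<close> provides it on the
    whole space whatever the radius.\<close>
  obtain Q where "\<exists>G. C11_in 0 Q (\<lambda>\<omega>. Phi_grad t \<omega> \<bullet> i) G"
    using Phi_grad_component_C11_in[of 0] assms i by metis
  then obtain G where "C11_in 0 Q (\<lambda>\<omega>. Phi_grad t \<omega> \<bullet> i) G" ..
  from C11_in_GDERIV[OF this] show "continuous_on S (\<lambda>\<omega>. Phi_grad t \<omega> \<bullet> i)"
    by (rule GDERIV_continuous_on)
qed

text \<open>The formula for the velocity makes sense everywhere but is controlled only on bounded
  sets. A cutoff equal to 1 on K makes the control global without changing the field where the
  measures live.\<close>

theorem ex_C11_field_curve:
  "\<exists>b G M. C11_field_curve b G M K \<rho> \<and>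
     (\<forall>t\<ge>0. \<forall>\<omega>\<in>K. b t \<omega> = (- 2 * \<zeta> t) *\<^sub>R grad_Phi Wout D Y \<omega> (\<rho> t))"
proof -
  obtain R where R: "0 < R" "\<And>x. x \<in> K \<Longrightarrow> norm x \<le> R"
    using compact_imp_bounded[OF K] unfolding bounded_pos by blast
  obtain \<eta> :: "('x, 'k) head \<Rightarrow> real" where \<eta>: "\<And>x. norm x \<le> R \<Longrightarrow> \<eta> x = 1" "\<And>x. 0 \<le> \<eta> x" "\<And>x. \<eta> x \<le> 1"
    "\<And>x. R + 1 \<le> norm x \<Longrightarrow> \<eta> x = 0"
    "\<And>Q. 0 \<le> Q \<Longrightarrow> \<exists>Q'. \<forall>u G. C11_in (R + 2) Q u G \<longrightarrow> (\<exists>G'. C11 Q' (\<lambda>x. \<eta> x * u x) G') \<and> (\<forall>x. \<bar>\<eta> x * u x\<bar> \<le> Q')"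
    by (rule exists_cutoff[OF less_imp_le[OF R(1)], where 'a = "('x, 'k) head"]) (rule that, assumption+)
  obtain Z where Z: "0 < Z" "\<And>t. 0 \<le> t \<Longrightarrow> \<bar>\<zeta> t\<bar> \<le> Z"
    using lr unfolding learning_rate_def bounded_pos by auto
  obtain L where L: "0 \<le> L" "\<And>s t. 0 \<le> s \<Longrightarrow> 0 \<le> t \<Longrightarrow> \<bar>\<zeta> s - \<zeta> t\<bar> \<le> L * \<bar>s - t\<bar>"
    using lr unfolding learning_rate_def lipschitz_on_def dist_real_def by auto
  obtain B where B: "0 \<le> B" "\<And>t \<omega>. 0 \<le> t \<Longrightarrow> norm \<omega> \<le> R + 1 \<Longrightarrow> norm (Phi_grad t \<omega>) \<le> B"
    "\<And>s t \<omega> e. 0 \<le> s \<Longrightarrow> 0 \<le> t \<Longrightarrow> norm \<omega> \<le> R + 1 \<Longrightarrow> 0 \<le> e \<Longrightarrow>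
       (\<forall>q. \<forall>X\<in>cball 0 input_radius. \<bar>coef s q X - coef t q X\<bar> \<le> e) \<Longrightarrow> norm (Phi_grad s \<omega> - Phi_grad t \<omega>) \<le> e * B"
    by (rule Phi_grad_bounds[of "R + 1"]) (rule that, assumption+)
  obtain Q where Q: "0 \<le> Q" "\<And>t i. 0 \<le> t \<Longrightarrow> i \<in> Basis \<Longrightarrow> \<exists>G. C11_in (R + 2) Q (\<lambda>\<omega>. Phi_grad t \<omega> \<bullet> i) G"
    by (rule Phi_grad_component_C11_in[of "R + 2"]) (rule that, assumption+)
  have ZQ: "0 \<le> 2 * Z * Q" using Z Q by simp
  obtain M where M: "\<And>u G. C11_in (R + 2) (2 * Z * Q) u G \<Longrightarrow> (\<exists>G'. C11 M (\<lambda>x. \<eta> x * u x) G') \<and> (\<forall>x. \<bar>\<eta> x * u x\<bar> \<le> M)"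
    using \<eta>(5)[OF ZQ] by blast
  define b where "b t \<omega> = (- 2 * \<zeta> t * \<eta> \<omega>) *\<^sub>R Phi_grad t \<omega>" for t \<omega>
  have comp: "(\<exists>G. C11 M (\<lambda>\<omega>. b t \<omega> \<bullet> i) G) \<and> (\<forall>\<omega>. \<bar>b t \<omega> \<bullet> i\<bar> \<le> M)" if t: "0 \<le> t" and i: "i \<in> Basis" for t i
  proof -
    obtain G where "C11_in (R + 2) Q (\<lambda>\<omega>. Phi_grad t \<omega> \<bullet> i) G" using Q(2)[OF t i] by blast
    moreover have "\<bar>- 2 * \<zeta> t\<bar> \<le> 2 * Z" using Z(2)[OF t] by (simp add: abs_mult)
    ultimately have "C11_in (R + 2) (2 * Z * Q) (\<lambda>\<omega>. - 2 * \<zeta> t * (Phi_grad t \<omega> \<bullet> i)) (\<lambda>\<omega>. (- 2 * \<zeta> t) *\<^sub>R G \<omega>)"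
      by (rule C11_in_scale)
    from M[OF this] show ?thesis by (simp add: b_def mult_ac)
  qed
  then have "\<forall>t i. \<exists>G. 0 \<le> t \<longrightarrow> i \<in> Basis \<longrightarrow> C11 M (\<lambda>\<omega>. b t \<omega> \<bullet> i) G" by blast
  then obtain G where G: "\<And>t i. 0 \<le> t \<Longrightarrow> i \<in> Basis \<Longrightarrow> C11 M (\<lambda>\<omega>. b t \<omega> \<bullet> i) (G t i)"
    unfolding choice_iff by blast
  have "C11_field_curve b G M K \<rho>"
  proof
    fix e T :: real assume e: "0 < e"
    \<comment> \<open>The changes of the learning rate and of the gradient each contribute e/4, and
      the factor 2 of the velocity restores e. The added 1 in the denominators excludes division by
      zero.\<close>
    define e1 where "e1 = e / (4 * (Z * (B + 1)))"
    define d1 where "d1 = e / (4 * (L + 1) * (B + 1))"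
    have e1: "0 < e1" using e Z B by (simp add: e1_def)
    have d1: "0 < d1" using e L B by (simp add: d1_def)
    obtain d2 where d2: "d2 > 0" "\<And>s t q X. s \<in> {0..T} \<Longrightarrow> t \<in> {0..T} \<Longrightarrow> \<bar>s - t\<bar> < d2 \<Longrightarrow>
        X \<in> cball 0 input_radius \<Longrightarrow> \<bar>coef s q X - coef t q X\<bar> \<le> e1"
      using coef_time_uniform[OF e1, of T] by blast
    show "\<exists>d>0. \<forall>s\<in>{0..T}. \<forall>t\<in>{0..T}. \<bar>s - t\<bar> < d \<longrightarrow> (\<forall>x. norm (b s x - b t x) \<le> e)"
    proof (intro exI[of _ "min d1 d2"] conjI ballI impI allI)
      fix s t x assume st: "s \<in> {0..T}" "t \<in> {0..T}" "\<bar>s - t\<bar> < min d1 d2"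
      then have s0: "0 \<le> s" and t0: "0 \<le> t" by auto
      show "norm (b s x - b t x) \<le> e"
      proof (cases "norm x \<le> R + 1")
        case False
        then show ?thesis using \<eta>(4)[of x] e by (simp add: b_def)
      next
        case True
        have "b s x - b t x = (- 2 * \<eta> x) *\<^sub>R ((\<zeta> s - \<zeta> t) *\<^sub>R Phi_grad s x + \<zeta> t *\<^sub>R (Phi_grad s x - Phi_grad t x))"
          by (simp add: b_def algebra_simps)
        also have "norm \<dots> = 2 * \<eta> x * norm ((\<zeta> s - \<zeta> t) *\<^sub>R Phi_grad s x + \<zeta> t *\<^sub>R (Phi_grad s x - Phi_grad t x))"
          using \<eta>(2)[of x] by (simp add: abs_mult)
        also have "\<dots> \<le> 2 * 1 * (\<bar>\<zeta> s - \<zeta> t\<bar> * norm (Phi_grad s x) + \<bar>\<zeta> t\<bar> * norm (Phi_grad s x - Phi_grad t x))"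
          using \<eta>(2,3)[of x] norm_triangle_ineq[of "(\<zeta> s - \<zeta> t) *\<^sub>R Phi_grad s x" "\<zeta> t *\<^sub>R (Phi_grad s x - Phi_grad t x)"]
          by (intro mult_mono) auto
        also have "\<dots> \<le> 2 * 1 * (((L + 1) * d1) * (B + 1) + Z * (e1 * (B + 1)))"
        proof (intro mult_left_mono add_mono mult_mono)
          have "L * \<bar>s - t\<bar> \<le> (L + 1) * d1" using st L(1) by (intro mult_mono) auto
          then show "\<bar>\<zeta> s - \<zeta> t\<bar> \<le> (L + 1) * d1" using L(2)[OF s0 t0] by linarith
          show "norm (Phi_grad s x) \<le> B + 1" using B(2)[OF s0 True] by linarith
          have "norm (Phi_grad s x - Phi_grad t x) \<le> e1 * B"
            using st e1 by (intro B(3)[OF s0 t0 True] allI ballI d2(2)) auto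
          also have "\<dots> \<le> e1 * (B + 1)" using e1 by simp
          finally show "norm (Phi_grad s x - Phi_grad t x) \<le> e1 * (B + 1)" .
          show "\<bar>\<zeta> t\<bar> \<le> Z" by (rule Z(2)[OF t0])
        qed (use L(1) d1 Z(1) in auto)
        also have "\<dots> = e"
        proof -
          have "L + 1 \<noteq> 0" "B + 1 \<noteq> 0" "Z \<noteq> 0" using L(1) B(1) Z(1) by linarith+
          then have "(L + 1) * d1 * (B + 1) = e / 4" "Z * (e1 * (B + 1)) = e / 4"
            unfolding d1_def e1_def by (simp_all add: divide_simps)
          then show ?thesis by simp
        qed
        finally show ?thesis .
      qed
    qed (use d1 d2(1) in auto)
  qed (use G comp K prob_on_K narrow in auto)
  moreover have "b t \<omega> = (- 2 * \<zeta> t) *\<^sub>R grad_Phi Wout D Y \<omega> (\<rho> t)" if "0 \<le> t" "\<omega> \<in> K" for t \<omega>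
    using \<eta>(1)[OF R(2)[OF that(2)]] by (simp add: b_def grad_Phi_eq[OF that(1)])
  ultimately show ?thesis by blast
qed

end

section \<open>Contraction of couplings\<close>

text \<open>Narrow continuity speaks of bounded functions; clipping u at its bounds on K leaves it
  unchanged on K and makes it bounded.\<close>

lemma narrowly_continuous_integral:
  fixes u :: "'a::euclidean_space \<Rightarrow> real"
  assumes K: "compact K" and \<rho>: "\<And>t. 0 \<le> t \<Longrightarrow> \<rho> t \<in> prob_on K" and cont: "narrowly_continuous \<rho>"
    and u: "continuous_on UNIV u"
  shows "continuous_on {0..} (\<lambda>t. \<integral>x. u x \<partial>\<rho> t)"
proof -
  obtain B where B: "\<And>x. x \<in> K \<Longrightarrow> \<bar>u x\<bar> \<le> B"
    using compact_imp_bounded[OF compact_continuous_image[OF continuous_on_subset[OF u subset_UNIV] K]]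
    unfolding bounded_iff by auto
  define v where "v x = max (- B) (min B (u x))" for x
  have v: "continuous_on UNIV v" unfolding v_def by (intro continuous_intros u)
  have "\<bar>v x\<bar> \<le> \<bar>B\<bar>" for x by (auto simp: v_def)
  then have "bounded (range v)" by (auto simp: bounded_iff)
  then have v_cont: "continuous_on {0..} (\<lambda>t. \<integral>x. v x \<partial>\<rho> t)"
    using cont v unfolding narrowly_continuous_def by blast
  have "(\<integral>x. v x \<partial>\<rho> t) = (\<integral>x. u x \<partial>\<rho> t)" if t: "0 \<le> t" for t
  proof (rule integral_cong_AE)
    show "AE x in \<rho> t. v x = u x"
      using AE_prob_on[OF \<rho>[OF t] K] by eventually_elim (use B in \<open>force simp: v_def\<close>)
  qed (use borel_measurable_prob_on[OF \<rho>[OF t]] u v in auto)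
  then show ?thesis by (intro continuous_on_eq[OF v_cont]) simp
qed

text \<open>The field agrees with the true velocity on K, which carries the measures, so the rates
  coincide. Continuity of the rate in time then upgrades the distributional identity to an
  integrated one.\<close>

lemma (in attention_curve) continuity_equation_of_weak_solution:
  assumes sol: "weak_solution K \<zeta> (grad_Phi Wout D Y) \<rho>"
    and curve: "C11_field_curve b G M K \<rho>"
    and b: "\<And>t \<omega>. 0 \<le> t \<Longrightarrow> \<omega> \<in> K \<Longrightarrow> b t \<omega> = (- 2 * \<zeta> t) *\<^sub>R grad_Phi Wout D Y \<omega> (\<rho> t)"
  shows "continuity_equation b G M K \<rho>"
proof -
  interpret C: C11_field_curve b G M K \<rho> by (rule curve)
  show ?thesis
  proof (intro continuity_equation.intro continuity_equation_axioms.intro curve)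
    fix Q and u :: "('x, 'k) head \<Rightarrow> real" and Gu and s t :: real
    assume u: "C11 Q u Gu" and st: "0 \<le> s" "s \<le> t"
    define a where "a t = (\<integral>x. Gu x \<bullet> b t x \<partial>\<rho> t)" for t
    define F where "F t = (\<integral>x. u x \<partial>\<rho> t)" for t
    have grad_u: "grad u = Gu" using grad_eqI[OF C11_GDERIV[OF u]] by auto
    have C1: "C1 u"
      unfolding C1_def grad_u
      using C11_GDERIV[OF u] C11_grad_continuous_on[OF u] unfolding gderiv_def differentiable_def by blast
    have a_eq: "a t = - 2 * \<zeta> t * (\<integral>x. Gu x \<bullet> grad_Phi Wout D Y x (\<rho> t) \<partial>\<rho> t)" if t: "0 \<le> t" for t
    proof -
      have "a t = (\<integral>x. - 2 * \<zeta> t * (Gu x \<bullet> Phi_grad t x) \<partial>\<rho> t)"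
        unfolding a_def
      proof (rule integral_cong_AE)
        show "(\<lambda>x. Gu x \<bullet> b t x) \<in> borel_measurable (\<rho> t)"
          by (intro borel_measurable_prob_on[OF prob_on_K[OF t]] continuous_intros C11_grad_continuous_on[OF u] C.continuous_on_field t)
        show "(\<lambda>x. - 2 * \<zeta> t * (Gu x \<bullet> Phi_grad t x)) \<in> borel_measurable (\<rho> t)"
          by (intro borel_measurable_prob_on[OF prob_on_K[OF t]] continuous_intros C11_grad_continuous_on[OF u] Phi_grad_continuous t)
        show "AE x in \<rho> t. Gu x \<bullet> b t x = - 2 * \<zeta> t * (Gu x \<bullet> Phi_grad t x)"
          using AE_prob_on[OF prob_on_K[OF t] K] by eventually_elim (simp add: b t grad_Phi_eq)
      qed
      then show ?thesis using t by (simp add: grad_Phi_eq)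
    qed
    have "F t - F s = integral {s..t} a"
    proof (rule weak_derivative_imp_integral[OF _ _ _ st])
      show "continuous_on {0..} F"
        unfolding F_def by (rule narrowly_continuous_integral[OF K prob_on_K narrow C11_continuous_on[OF u]])
      show "continuous_on {0..} a"
        unfolding a_def by (rule C.rate_continuous[OF u])
      fix \<phi> assume "time_test \<phi>"
      then have "- (LINT t:{0<..}|lborel. deriv \<phi> t * F t) =
          (LINT t:{0<..}|lborel. \<phi> t * (- 2 * \<zeta> t * (\<integral>x. Gu x \<bullet> grad_Phi Wout D Y x (\<rho> t) \<partial>\<rho> t)))"
        using sol C1 unfolding weak_solution_def F_def grad_u[symmetric] by blast
      also have "\<dots> = (LINT t:{0<..}|lborel. \<phi> t * a t)"
        unfolding set_lebesgue_integral_def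
        by (intro Bochner_Integration.integral_cong) (auto simp: a_eq indicator_def)
      finally show "- (LINT t:{0<..}|lborel. deriv \<phi> t * F t) = (LINT t:{0<..}|lborel. \<phi> t * a t)" .
    qed
    then show "(\<integral>x. u x \<partial>\<rho> t) - (\<integral>x. u x \<partial>\<rho> s) = integral {s..t} (\<lambda>\<tau>. \<integral>x. Gu x \<bullet> b \<tau> x \<partial>\<rho> \<tau>)"
      unfolding F_def a_def .
  qed
qed

text \<open>Dominated convergence along sequences of times: on a bounded interval containing the
  sequence, the mean value inequality dominates the difference quotients by the bound on g'. The
  derivative at 0 is one-sided.\<close>

lemma has_real_derivative_integral:
  fixes g :: "real \<Rightarrow> 'a \<Rightarrow> real"
  assumes "finite_measure \<pi>" and int: "\<And>t. 0 \<le> t \<Longrightarrow> integrable \<pi> (g t)"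
    and der: "\<And>t x. 0 \<le> t \<Longrightarrow> ((\<lambda>t. g t x) has_real_derivative g' t x) (at t within {0..})"
    and bd: "\<And>T. \<exists>B. AE x in \<pi>. \<forall>t\<in>{0..T}. \<bar>g' t x\<bar> \<le> B"
    and meas: "\<And>t. 0 \<le> t \<Longrightarrow> g' t \<in> borel_measurable \<pi>"
    and t: "0 \<le> t"
  shows "((\<lambda>t. \<integral>x. g t x \<partial>\<pi>) has_real_derivative (\<integral>x. g' t x \<partial>\<pi>)) (at t within {0..})"
proof -
  interpret finite_measure \<pi> by fact
  show ?thesis
    unfolding has_field_derivative_iff tendsto_at_iff_sequentially
  proof (intro allI impI)
    fix s :: "nat \<Rightarrow> real"
    assume s: "\<forall>n. s n \<in> {0..} - {t}" and lim: "s \<longlonglongrightarrow> t"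
    obtain T where T: "\<And>n. \<bar>s n\<bar> \<le> T"
      using convergent_imp_Bseq[OF convergentI[OF lim]] unfolding Bseq_def by auto
    define T' where "T' = max T t"
    have sT: "s n \<in> {0..T'}" "s n \<noteq> t" for n using s T[of n] by (auto simp: T'_def)
    have tT: "t \<in> {0..T'}" using t by (simp add: T'_def)
    obtain B where B: "AE x in \<pi>. \<forall>t\<in>{0..T'}. \<bar>g' t x\<bar> \<le> B" using bd by blast
    have lim_int: "(\<lambda>n. \<integral>x. (g (s n) x - g t x) / (s n - t) \<partial>\<pi>) \<longlonglongrightarrow> (\<integral>x. g' t x \<partial>\<pi>)"
    proof (rule integral_dominated_convergence[where w = "\<lambda>_. B"])
      show "g' t \<in> borel_measurable \<pi>" by (rule meas[OF t])
      show "(\<lambda>x. (g (s n) x - g t x) / (s n - t)) \<in> borel_measurable \<pi>" for n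
        using int[of "s n"] int[OF t] sT[of n] by auto
      have "(\<lambda>n. (g (s n) x - g t x) / (s n - t)) \<longlonglongrightarrow> g' t x" for x
        using der[OF t, of x] s lim unfolding has_field_derivative_iff tendsto_at_iff_sequentially comp_def by blast
      then show "AE x in \<pi>. (\<lambda>n. (g (s n) x - g t x) / (s n - t)) \<longlonglongrightarrow> g' t x" by simp
      show "AE x in \<pi>. norm ((g (s n) x - g t x) / (s n - t)) \<le> B" for n
        using B
      proof eventually_elim
        case (elim x)
        have "norm (g (s n) x - g t x) \<le> B * norm (s n - t)"
        proof (rule field_differentiable_bound[where S = "{0..T'}" and f' = "\<lambda>t. g' t x"])
          show "((\<lambda>t. g t x) has_field_derivative g' u x) (at u within {0..T'})" if "u \<in> {0..T'}" for u
            using that by (intro has_field_derivative_subset[OF der]) auto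
        qed (use elim sT tT in auto)
        then show ?case using sT(2)[of n] by (simp add: abs_divide divide_le_eq)
      qed
    qed simp
    have "(\<integral>x. (g (s n) x - g t x) / (s n - t) \<partial>\<pi>) = ((\<integral>x. g (s n) x \<partial>\<pi>) - (\<integral>x. g t x \<partial>\<pi>)) / (s n - t)" for n
      using int[of "s n"] int[OF t] sT[of n] by simp
    with lim_int show "((\<lambda>y. ((\<integral>x. g y x \<partial>\<pi>) - (\<integral>x. g t x \<partial>\<pi>)) / (y - t)) \<circ> s) \<longlonglongrightarrow> (\<integral>x. g' t x \<partial>\<pi>)"
      by (simp only: comp_def)
  qed
qed

section \<open>Couplings and their transport cost\<close>

lemma
  assumes "\<pi> \<in> couplings \<mu> \<nu>"
  shows couplings_prob_space: "prob_space \<pi>" and sets_couplings: "sets \<pi> = sets borel"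
    and couplings_fst: "distr \<pi> borel fst = \<mu>" and couplings_snd: "distr \<pi> borel snd = \<nu>"
  using assms by (auto simp: couplings_def)

lemma borel_measurable_couplings:
  assumes "\<pi> \<in> couplings \<mu> \<nu>" "f \<in> borel_measurable borel" shows "f \<in> borel_measurable \<pi>"
  using assms(2) by (simp add: measurable_cong_sets[OF sets_couplings[OF assms(1)] refl])

lemma AE_couplings:
  assumes \<pi>: "\<pi> \<in> couplings \<mu> \<nu>" and K: "compact K" "\<mu> \<in> prob_on K" "\<nu> \<in> prob_on K"
  shows "AE p in \<pi>. fst p \<in> K \<and> snd p \<in> K"
proof -
  have "fst \<in> borel_measurable \<pi>" "snd \<in> borel_measurable \<pi>"
    by (intro borel_measurable_couplings[OF \<pi>] borel_measurable_continuous_onI continuous_intros)+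
  note AE_distrD[OF this(1), unfolded couplings_fst[OF \<pi>], OF AE_prob_on[OF K(2,1)]]
    AE_distrD[OF this(2), unfolded couplings_snd[OF \<pi>], OF AE_prob_on[OF K(3,1)]]
  then show ?thesis by eventually_elim simp
qed

text \<open>Links the extended integral in \<open>W2\<close> with the real integral in the
  monotonicity assumption; the cost is bounded because K is.\<close>

lemma nn_integral_cost:
  assumes \<pi>: "\<pi> \<in> couplings \<mu> \<nu>" and K: "compact K" "\<mu> \<in> prob_on K" "\<nu> \<in> prob_on K"
  shows "(\<integral>\<^sup>+p. ennreal ((norm (fst p - snd p))\<^sup>2) \<partial>\<pi>) = ennreal (\<integral>p. (norm (fst p - snd p))\<^sup>2 \<partial>\<pi>)"
proof -
  interpret prob_space \<pi> by (rule couplings_prob_space[OF \<pi>])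
  obtain R where R: "\<And>x. x \<in> K \<Longrightarrow> norm x \<le> R"
    using compact_imp_bounded[OF K(1)] unfolding bounded_iff by blast
  have "AE p in \<pi>. norm ((norm (fst p - snd p))\<^sup>2) \<le> (2 * R)\<^sup>2"
    using AE_couplings[OF \<pi> K]
  proof eventually_elim
    case (elim p)
    then have "norm (fst p - snd p) \<le> 2 * R"
      using norm_triangle_ineq4[of "fst p" "snd p"] R[of "fst p"] R[of "snd p"] by linarith
    from power_mono[OF this norm_ge_zero, of 2] show ?case by simp
  qed
  then have int: "integrable \<pi> (\<lambda>p. (norm (fst p - snd p))\<^sup>2)"
    by (intro integrable_const_bound borel_measurable_couplings[OF \<pi>] borel_measurable_continuous_onI continuous_intros)
  show "(\<integral>\<^sup>+p. ennreal ((norm (fst p - snd p))\<^sup>2) \<partial>\<pi>) = ennreal (\<integral>p. (norm (fst p - snd p))\<^sup>2 \<partial>\<pi>)"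
    by (rule nn_integral_eq_integral[OF int]) simp
qed

text \<open>The product measure is a coupling; its existence makes the infimum in \<open>W2\<close>
  finite.\<close>

lemma couplings_nonempty:
  assumes "\<mu> \<in> prob_on K" "\<nu> \<in> prob_on K" shows "couplings \<mu> \<nu> \<noteq> {}"
proof -
  have \<mu>: "prob_space \<mu>" "sets \<mu> = sets borel" and \<nu>: "prob_space \<nu>" "sets \<nu> = sets borel"
    using assms by (auto simp: prob_on_def)
  interpret \<mu>: prob_space \<mu> by fact
  interpret \<nu>: prob_space \<nu> by fact
  interpret P: pair_prob_space \<mu> \<nu> ..
  have sets: "sets (\<mu> \<Otimes>\<^sub>M \<nu>) = sets borel"
    using sets_pair_measure_cong[OF \<mu>(2) \<nu>(2)] unfolding borel_prod .
  have "distr (\<mu> \<Otimes>\<^sub>M \<nu>) borel fst = distr (\<mu> \<Otimes>\<^sub>M \<nu>) \<mu> fst"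
    using \<mu>(2) by (intro distr_cong) auto
  also have "\<dots> = \<mu>" by (rule \<nu>.distr_pair_fst)
  finally have 1: "distr (\<mu> \<Otimes>\<^sub>M \<nu>) borel fst = \<mu>" .
  have "distr (\<mu> \<Otimes>\<^sub>M \<nu>) borel snd = distr (\<mu> \<Otimes>\<^sub>M \<nu>) \<nu> snd"
    using \<nu>(2) by (intro distr_cong) auto
  also have "\<dots> = \<nu>"
  proof (rule measure_eqI)
    fix A assume "A \<in> sets (distr (\<mu> \<Otimes>\<^sub>M \<nu>) \<nu> snd)"
    then have A: "A \<in> sets \<nu>" by simp
    have "snd -` A \<inter> space (\<mu> \<Otimes>\<^sub>M \<nu>) = space \<mu> \<times> A"
      using sets.sets_into_space[OF A] by (auto simp: space_pair_measure)
    then show "emeasure (distr (\<mu> \<Otimes>\<^sub>M \<nu>) \<nu> snd) A = emeasure \<nu> A"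
      using A by (simp add: emeasure_distr \<nu>.emeasure_pair_measure_Times \<mu>.emeasure_space_1)
  qed simp
  finally have 2: "distr (\<mu> \<Otimes>\<^sub>M \<nu>) borel snd = \<nu>" .
  have "\<mu> \<Otimes>\<^sub>M \<nu> \<in> couplings \<mu> \<nu>"
    unfolding couplings_def using 1 2 sets P.prob_space_axioms by auto
  then show ?thesis by blast
qed

text \<open>The plan is pushed forward by the pair of flows, and the cost is differentiated under
  the fixed initial plan. The transported plan need not be optimal, so monotonicity is applied to an
  arbitrary coupling at each time.\<close>

lemma coupled_flow_contraction:
  fixes b b' :: "real \<Rightarrow> 'a::euclidean_space \<Rightarrow> 'a"
  assumes 1: "continuity_equation b G M K \<rho>" and 2: "continuity_equation b' G' M' K \<rho>'"
    and \<pi>: "\<pi> \<in> couplings (\<rho> 0) (\<rho>' 0)"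
    and mono: "\<And>t \<pi>. 0 \<le> t \<Longrightarrow> \<pi> \<in> couplings (\<rho> t) (\<rho>' t) \<Longrightarrow>
      (\<integral>p. (fst p - snd p) \<bullet> (b t (fst p) - b' t (snd p)) \<partial>\<pi>) \<le> - (k * \<zeta> t) * (\<integral>p. (norm (fst p - snd p))\<^sup>2 \<partial>\<pi>)"
    and \<zeta>: "continuous_on {0..} \<zeta>" and T: "0 \<le> T"
  shows "\<exists>\<pi>'\<in>couplings (\<rho> T) (\<rho>' T). (\<integral>p. (norm (fst p - snd p))\<^sup>2 \<partial>\<pi>')
     \<le> exp (- (2 * k) * integral {0..T} \<zeta>) * (\<integral>p. (norm (fst p - snd p))\<^sup>2 \<partial>\<pi>)"
proof -
  interpret A: continuity_equation b G M K \<rho> by (rule 1)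
  interpret B: continuity_equation b' G' M' K \<rho>' by (rule 2)
  interpret \<pi>: prob_space \<pi> by (rule couplings_prob_space[OF \<pi>])
  define \<Psi> where "\<Psi> t p = (A.flow t (fst p), B.flow t (snd p))" for t p
  define \<Gamma> where "\<Gamma> t = distr \<pi> borel (\<Psi> t)" for t
  have fst_snd: "fst \<in> borel_measurable \<pi>" "snd \<in> borel_measurable \<pi>"
    by (intro borel_measurable_couplings[OF \<pi>] borel_measurable_continuous_onI continuous_intros)+
  have flow_meas: "(\<lambda>p. A.flow t (fst p)) \<in> borel_measurable \<pi>" "(\<lambda>p. B.flow t (snd p)) \<in> borel_measurable \<pi>" if "0 \<le> t" for t
    using measurable_compose[OF fst_snd(1) A.borel_measurable_flow[OF that]]
      measurable_compose[OF fst_snd(2) B.borel_measurable_flow[OF that]] by auto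
  then have \<Psi>_meas: "\<Psi> t \<in> borel_measurable \<pi>" if "0 \<le> t" for t
    unfolding \<Psi>_def using that by (intro borel_measurable_Pair) auto
  have \<Gamma>: "\<Gamma> t \<in> couplings (\<rho> t) (\<rho>' t)" if t: "0 \<le> t" for t
  proof -
    have "distr (\<Gamma> t) borel fst = distr \<pi> borel (A.flow t \<circ> fst)"
      unfolding \<Gamma>_def using \<Psi>_meas[OF t]
      by (subst distr_distr) (auto simp: comp_def \<Psi>_def intro!: borel_measurable_continuous_onI continuous_intros)
    also have "\<dots> = distr (distr \<pi> borel fst) borel (A.flow t)"
      by (rule distr_distr[symmetric, OF A.borel_measurable_flow[OF t] fst_snd(1)])
    finally have 1: "distr (\<Gamma> t) borel fst = \<rho> t"
      by (simp add: couplings_fst[OF \<pi>] A.distr_flow[OF t])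
    have "distr (\<Gamma> t) borel snd = distr \<pi> borel (B.flow t \<circ> snd)"
      unfolding \<Gamma>_def using \<Psi>_meas[OF t]
      by (subst distr_distr) (auto simp: comp_def \<Psi>_def intro!: borel_measurable_continuous_onI continuous_intros)
    also have "\<dots> = distr (distr \<pi> borel snd) borel (B.flow t)"
      by (rule distr_distr[symmetric, OF B.borel_measurable_flow[OF t] fst_snd(2)])
    finally have 2: "distr (\<Gamma> t) borel snd = \<rho>' t"
      by (simp add: couplings_snd[OF \<pi>] B.distr_flow[OF t])
    have "prob_space (\<Gamma> t)" unfolding \<Gamma>_def by (rule \<pi>.prob_space_distr) (rule \<Psi>_meas[OF t])
    then show ?thesis unfolding couplings_def using 1 2 by (auto simp: \<Gamma>_def)
  qed
  define d where "d t p = A.flow t (fst p) - B.flow t (snd p)" for t p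
  define d' where "d' t p = b t (A.flow t (fst p)) - b' t (B.flow t (snd p))" for t p
  define cost where "cost t = (\<integral>p. (norm (fst p - snd p))\<^sup>2 \<partial>\<Gamma> t)" for t
  have cost: "cost t = (\<integral>p. d t p \<bullet> d t p \<partial>\<pi>)" if t: "0 \<le> t" for t
    unfolding cost_def \<Gamma>_def
    by (subst integral_distr[OF \<Psi>_meas[OF t]])
      (auto simp: \<Psi>_def d_def power2_norm_eq_inner intro!: borel_measurable_continuous_onI continuous_intros)
  have rate: "(\<integral>p. 2 * (d t p \<bullet> d' t p) \<partial>\<pi>) \<le> - (2 * k * \<zeta> t) * cost t" if t: "0 \<le> t" for t
  proof -
    have "(\<integral>p. (fst p - snd p) \<bullet> (b t (fst p) - b' t (snd p)) \<partial>\<Gamma> t) = (\<integral>p. d t p \<bullet> d' t p \<partial>\<pi>)"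
      unfolding \<Gamma>_def
    proof (subst integral_distr[OF \<Psi>_meas[OF t]])
      show "(\<lambda>p. (fst p - snd p) \<bullet> (b t (fst p) - b' t (snd p))) \<in> borel_measurable borel"
        by (intro borel_measurable_continuous_onI continuous_intros
            continuous_on_compose2[OF A.continuous_on_field[OF t, of UNIV]]
            continuous_on_compose2[OF B.continuous_on_field[OF t, of UNIV]]) auto
    qed (simp add: \<Psi>_def d_def d'_def)
    then show ?thesis using mono[OF t \<Gamma>[OF t]] by (simp add: cost_def)
  qed
  obtain R where R: "\<And>x. x \<in> K \<Longrightarrow> norm x \<le> R"
    using compact_imp_bounded[OF A.K] unfolding bounded_iff by blast
  \<comment> \<open>Individual trajectories are not confined to K in this argument; growth linear in
    time suffices for integrability and for domination on bounded time intervals.\<close>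
  have d_bound: "norm (d t p) \<le> 2 * R + (A.C + B.C) * t" if "fst p \<in> K" "snd p \<in> K" "0 \<le> t" for t p
  proof -
    have "norm (A.flow t (fst p)) \<le> R + A.C * t"
      using A.flow_time_Lipschitz[of 0 t "fst p"] R[OF that(1)] that(3)
        norm_triangle_ineq2[of "A.flow t (fst p)" "fst p"] by (simp add: A.flow_0)
    moreover have "norm (B.flow t (snd p)) \<le> R + B.C * t"
      using B.flow_time_Lipschitz[of 0 t "snd p"] R[OF that(2)] that(3)
        norm_triangle_ineq2[of "B.flow t (snd p)" "snd p"] by (simp add: B.flow_0)
    ultimately show ?thesis
      unfolding d_def using norm_triangle_ineq4[of "A.flow t (fst p)" "B.flow t (snd p)"]
      by (simp add: algebra_simps)
  qed
  have d'_bound: "norm (d' t p) \<le> A.C + B.C" if "0 \<le> t" for t p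
    unfolding d'_def using A.bound[OF that, of "A.flow t (fst p)"] B.bound[OF that, of "B.flow t (snd p)"]
      norm_triangle_ineq4[of "b t (A.flow t (fst p))" "b' t (B.flow t (snd p))"] by linarith
  have AE_K: "AE p in \<pi>. fst p \<in> K \<and> snd p \<in> K"
    by (rule AE_couplings[OF \<pi> A.K A.prob_on_K B.prob_on_K]) auto
  have d_meas: "d t \<in> borel_measurable \<pi>" if "0 \<le> t" for t
    unfolding d_def using flow_meas[OF that] by (intro borel_measurable_diff)
  have d'_meas: "d' t \<in> borel_measurable \<pi>" if "0 \<le> t" for t
    unfolding d'_def using flow_meas[OF that]
    by (intro borel_measurable_diff measurable_compose[OF _ borel_measurable_continuous_onI[OF A.continuous_on_field[OF that]]]
        measurable_compose[OF _ borel_measurable_continuous_onI[OF B.continuous_on_field[OF that]]])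
  have cost_deriv: "(cost has_real_derivative (\<integral>p. 2 * (d t p \<bullet> d' t p) \<partial>\<pi>)) (at t within {0..})" if t: "0 \<le> t" for t
  proof -
    have "((\<lambda>t. \<integral>p. d t p \<bullet> d t p \<partial>\<pi>) has_real_derivative (\<integral>p. 2 * (d t p \<bullet> d' t p) \<partial>\<pi>)) (at t within {0..})"
    proof (rule has_real_derivative_integral[OF _ _ _ _ _ t])
      show "finite_measure \<pi>" by (rule \<pi>.finite_measure_axioms)
      show "integrable \<pi> (\<lambda>p. d s p \<bullet> d s p)" if s: "0 \<le> s" for s
      proof (rule \<pi>.integrable_const_bound)
        show "AE p in \<pi>. norm (d s p \<bullet> d s p) \<le> (2 * R + (A.C + B.C) * s)\<^sup>2"
          using AE_K
          by eventually_elim (auto simp: power2_norm_eq_inner[symmetric] intro!: power_mono d_bound s)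
        show "(\<lambda>p. d s p \<bullet> d s p) \<in> borel_measurable \<pi>"
          by (intro borel_measurable_inner d_meas s)
      qed
      show "((\<lambda>t. d t p \<bullet> d t p) has_real_derivative 2 * (d s p \<bullet> d' s p)) (at s within {0..})" if s: "0 \<le> s" for s p
      proof -
        have "((\<lambda>t. d t p) has_vector_derivative d' s p) (at s within {0..})"
          unfolding d_def d'_def
          by (intro has_vector_derivative_diff A.flow_has_vector_derivative B.flow_has_vector_derivative s)
        then have "((\<lambda>t. d t p \<bullet> d t p) has_derivative (\<lambda>h. d s p \<bullet> (h *\<^sub>R d' s p) + (h *\<^sub>R d' s p) \<bullet> d s p)) (at s within {0..})"
          unfolding has_vector_derivative_def by (intro has_derivative_inner)
        then show ?thesis
          unfolding has_field_derivative_def by (rule has_derivative_eq_rhs) (auto simp: inner_commute fun_eq_iff)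
      qed
      show "\<exists>B. AE p in \<pi>. \<forall>s\<in>{0..S}. \<bar>2 * (d s p \<bullet> d' s p)\<bar> \<le> B" for S
      proof (intro exI[of _ "2 * ((2 * R + (A.C + B.C) * \<bar>S\<bar>) * (A.C + B.C))"])
        show "AE p in \<pi>. \<forall>s\<in>{0..S}. \<bar>2 * (d s p \<bullet> d' s p)\<bar> \<le> 2 * ((2 * R + (A.C + B.C) * \<bar>S\<bar>) * (A.C + B.C))"
          using AE_K
        proof eventually_elim
          case (elim p)
          show ?case
          proof
            fix s assume s: "s \<in> {0..S}"
            have "(A.C + B.C) * s \<le> (A.C + B.C) * \<bar>S\<bar>"
              using s A.C_nonneg B.C_nonneg by (intro mult_left_mono) auto
            then have "norm (d s p) \<le> 2 * R + (A.C + B.C) * \<bar>S\<bar>"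
              using d_bound[of p s] elim s by simp
            then have "norm (d s p) * norm (d' s p) \<le> (2 * R + (A.C + B.C) * \<bar>S\<bar>) * (A.C + B.C)"
              using d'_bound[of s p] s by (intro mult_mono) (auto intro: order_trans[OF norm_ge_zero])
            then show "\<bar>2 * (d s p \<bullet> d' s p)\<bar> \<le> 2 * ((2 * R + (A.C + B.C) * \<bar>S\<bar>) * (A.C + B.C))"
              using Cauchy_Schwarz_ineq2[of "d s p" "d' s p"] by (simp add: abs_mult)
          qed
        qed
      qed
      show "(\<lambda>p. 2 * (d s p \<bullet> d' s p)) \<in> borel_measurable \<pi>" if "0 \<le> s" for s
        by (intro borel_measurable_times borel_measurable_const borel_measurable_inner d_meas d'_meas that)
    qed
    then show ?thesis
      by (rule has_field_derivative_transform_within[of _ _ _ _ 1]) (use t in \<open>auto simp: cost\<close>)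
  qed
  define Z where "Z t = integral {0..t} \<zeta>" for t
  have Z_deriv: "(Z has_real_derivative \<zeta> t) (at t within {0..})" if t: "0 \<le> t" for t
  proof -
    have "((\<lambda>t. integral {0..t} \<zeta>) has_vector_derivative \<zeta> t) (at t within {0..t + 1})"
      using t by (intro integral_has_vector_derivative continuous_on_subset[OF \<zeta>]) auto
    moreover have "at t within {0..t + 1} = at t within {0..}"
      using t by (intro at_within_nhd[of _ "{..<t + 1}"]) auto
    ultimately show ?thesis
      by (simp add: Z_def[abs_def] has_real_derivative_iff_has_vector_derivative)
  qed
  \<comment> \<open>The integrating factor turns the differential inequality into monotonicity of E,
    which is Gronwall in its simplest form.\<close>
  define E where "E t = cost t * exp (2 * k * Z t)" for t
  have E_deriv: "(E has_real_derivative ((\<integral>p. 2 * (d t p \<bullet> d' t p) \<partial>\<pi>) + 2 * k * \<zeta> t * cost t) * exp (2 * k * Z t)) (at t within {0..})"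
    if t: "0 \<le> t" for t
    unfolding E_def
    by (rule DERIV_cong[OF DERIV_mult[OF cost_deriv[OF t] DERIV_chain2[OF DERIV_exp DERIV_cmult[OF Z_deriv[OF t]]]]])
      (simp add: algebra_simps)
  have "E T \<le> E 0"
    using T
  proof (rule DERIV_nonpos_imp_decreasing_open)
    fix t assume t: "0 < t" "t < T"
    have "at t within {0..} = at t" using t by (intro at_within_interior) auto
    moreover have "((\<integral>p. 2 * (d t p \<bullet> d' t p) \<partial>\<pi>) + 2 * k * \<zeta> t * cost t) * exp (2 * k * Z t) \<le> 0"
      using rate[of t] t by (simp add: mult_le_0_iff)
    ultimately show "\<exists>y. (E has_real_derivative y) (at t) \<and> y \<le> 0"
      using E_deriv[of t] t by auto
  next
    have "continuous_on {0..} E"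
      using E_deriv by (intro DERIV_continuous_on) auto
    then show "continuous_on {0..T} E" by (rule continuous_on_subset) auto
  qed
  moreover have "Z 0 = 0" by (simp add: Z_def)
  ultimately have "cost T * exp (2 * k * Z T) \<le> cost 0" by (simp add: E_def)
  then have "cost T \<le> exp (- (2 * k) * Z T) * cost 0"
    by (simp add: exp_minus field_simps)
  moreover have "cost 0 = (\<integral>p. (norm (fst p - snd p))\<^sup>2 \<partial>\<pi>)"
    by (simp add: cost d_def A.flow_0 B.flow_0 power2_norm_eq_inner)
  ultimately show ?thesis
    using \<Gamma>[OF T] unfolding cost_def Z_def by (intro bexI[of _ "\<Gamma> T"]) auto
qed

section \<open>From couplings to the Wasserstein distance\<close>

lemma W2_nonneg: "0 \<le> W2 \<mu> \<nu>"
  by (simp add: W2_def)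

lemma W2_square: "(W2 \<mu> \<nu>)\<^sup>2 = enn2real (INF \<pi>\<in>couplings \<mu> \<nu>. \<integral>\<^sup>+p. ennreal ((norm (fst p - snd p))\<^sup>2) \<partial>\<pi>)"
  by (simp add: W2_def)

lemma W2_contraction_from_couplings:
  assumes K: "compact K" "\<mu> \<in> prob_on K" "\<nu> \<in> prob_on K" "\<mu>' \<in> prob_on K" "\<nu>' \<in> prob_on K" and c: "0 < c"
    and contr: "\<And>\<pi>. \<pi> \<in> couplings \<mu> \<nu> \<Longrightarrow> \<exists>\<pi>'\<in>couplings \<mu>' \<nu>'.
      (\<integral>p. (norm (fst p - snd p))\<^sup>2 \<partial>\<pi>') \<le> c * (\<integral>p. (norm (fst p - snd p))\<^sup>2 \<partial>\<pi>)"
  shows "(W2 \<mu>' \<nu>')\<^sup>2 \<le> c * (W2 \<mu> \<nu>)\<^sup>2"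
proof -
  let ?I = "\<lambda>\<mu> \<nu>. INF \<pi>\<in>couplings \<mu> \<nu>. \<integral>\<^sup>+p. ennreal ((norm (fst p - snd p))\<^sup>2) \<partial>\<pi>"
  obtain \<pi> where \<pi>: "\<pi> \<in> couplings \<mu> \<nu>" using couplings_nonempty[OF K(2,3)] by blast
  have "?I \<mu> \<nu> \<le> ennreal (\<integral>p. (norm (fst p - snd p))\<^sup>2 \<partial>\<pi>)"
    unfolding nn_integral_cost[OF \<pi> K(1-3), symmetric] by (rule INF_lower[OF \<pi>])
  then have fin: "?I \<mu> \<nu> < \<infinity>" by (rule le_less_trans) simp
  \<comment> \<open>Dividing by c leaves a constant lower bound for the cost of each initial
    coupling, hence for the infimum. Its finiteness matters afterwards, since
    \<open>enn2real\<close> sends infinity to 0.\<close>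
  have "ennreal ((W2 \<mu>' \<nu>')\<^sup>2 / c) \<le> ?I \<mu> \<nu>"
  proof (rule INF_greatest)
    fix \<pi> assume \<pi>: "\<pi> \<in> couplings \<mu> \<nu>"
    let ?cost = "\<lambda>\<pi>. \<integral>p. (norm (fst p - snd p))\<^sup>2 \<partial>\<pi>"
    obtain \<pi>' where \<pi>': "\<pi>' \<in> couplings \<mu>' \<nu>'" "?cost \<pi>' \<le> c * ?cost \<pi>" using contr[OF \<pi>] by blast
    have "?I \<mu>' \<nu>' \<le> ennreal (?cost \<pi>')"
      unfolding nn_integral_cost[OF \<pi>'(1) K(1,4,5), symmetric] by (rule INF_lower[OF \<pi>'(1)])
    then have "enn2real (?I \<mu>' \<nu>') \<le> enn2real (ennreal (?cost \<pi>'))"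
      by (rule enn2real_mono) simp
    then have "(W2 \<mu>' \<nu>')\<^sup>2 \<le> ?cost \<pi>'" by (simp add: W2_square)
    then have "(W2 \<mu>' \<nu>')\<^sup>2 / c \<le> ?cost \<pi>"
      using \<pi>'(2) c by (simp add: divide_le_eq mult.commute)
    then show "ennreal ((W2 \<mu>' \<nu>')\<^sup>2 / c) \<le> (\<integral>\<^sup>+p. ennreal ((norm (fst p - snd p))\<^sup>2) \<partial>\<pi>)"
      by (simp add: nn_integral_cost[OF \<pi> K(1-3)] ennreal_leI)
  qed
  then have "enn2real (ennreal ((W2 \<mu>' \<nu>')\<^sup>2 / c)) \<le> enn2real (?I \<mu> \<nu>)"
    using fin by (intro enn2real_mono) auto
  then have "(W2 \<mu>' \<nu>')\<^sup>2 / c \<le> (W2 \<mu> \<nu>)\<^sup>2"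
    using c by (simp add: W2_square)
  then show ?thesis using c by (simp add: divide_le_eq mult.commute)
qed

lemma learning_rate_continuous: "learning_rate \<zeta> \<Longrightarrow> continuous_on {0..} \<zeta>"
  unfolding learning_rate_def using lipschitz_on_continuous_on by blast

theorem theorem7p1:
  fixes Wout :: "real^'v^'x"
    and D :: "('x, 'l::{finite,linorder}) input measure"
    and Y :: "'l \<Rightarrow> ('x, 'l) input \<Rightarrow> real^'v"
    and K :: "('x, 'k::finite) head set"
    and Kx :: "(real^'x) set"
    and \<zeta> :: "real \<Rightarrow> real"
    and \<rho>bar :: "('x, 'k) head measure"
    and \<rho> :: "real \<Rightarrow> ('x, 'k) head measure"
    and r \<kappa> :: real
  assumes data: "data_law D Y"
    and lr: "learning_rate \<zeta>"
    and smooth: "smoothness Wout D K Kx"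
    and stationary: "stationary_solution K \<zeta> (grad_Phi Wout D Y) \<rho>bar"
    and r_pos: "r > 0"
    and \<kappa>_pos: "\<kappa> > 0"
    and monotone: "\<forall>\<mu>\<in>prob_on K. W2 \<mu> \<rho>bar < r \<longrightarrow> (\<forall>\<pi>\<in>couplings \<mu> \<rho>bar.
        (\<integral>p. (fst p - snd p) \<bullet> (grad_Phi Wout D Y (fst p) \<mu> - grad_Phi Wout D Y (snd p) \<rho>bar) \<partial>\<pi>)
        \<ge> \<kappa> * (\<integral>p. (norm (fst p - snd p))\<^sup>2 \<partial>\<pi>))"
    and solution: "weak_solution K \<zeta> (grad_Phi Wout D Y) \<rho>"
    and initial: "W2 (\<rho> 0) \<rho>bar < r"
    and trapped: "\<forall>t\<ge>0. W2 (\<rho> t) \<rho>bar < r"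
  shows "(\<forall>t\<ge>0. (W2 (\<rho> t) \<rho>bar)\<^sup>2 \<le> (W2 (\<rho> 0) \<rho>bar)\<^sup>2 * exp (- 4 * \<kappa> * integral {0..t} \<zeta>))
    \<and> (\<forall>t\<ge>0. W2 (\<rho> t) \<rho>bar \<le> W2 (\<rho> 0) \<rho>bar * exp (- 2 * \<kappa> * integral {0..t} \<zeta>))
    \<and> (\<forall>\<zeta>min>0. (\<forall>t\<ge>0. \<zeta> t \<ge> \<zeta>min) \<longrightarrow>
        (\<forall>t\<ge>0. W2 (\<rho> t) \<rho>bar \<le> W2 (\<rho> 0) \<rho>bar * exp (- 2 * \<kappa> * \<zeta>min * t)))"
proof -
  have \<rho>: "\<And>t. 0 \<le> t \<Longrightarrow> \<rho> t \<in> prob_on K" "narrowly_continuous \<rho>"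
    using solution by (auto simp: weak_solution_def)
  have \<rho>bar: "\<rho>bar \<in> prob_on K" "narrowly_continuous (\<lambda>_. \<rho>bar)" "weak_solution K \<zeta> (grad_Phi Wout D Y) (\<lambda>_. \<rho>bar)"
    using stationary by (auto simp: stationary_solution_def weak_solution_def)
  interpret A: attention_curve Wout D Y K Kx \<zeta> \<rho>
    by (rule attention_curve.intro[OF data lr smooth \<rho>])
  \<comment> \<open>The stationary measure is treated as a constant solution with its own field and
    flow, so the second marginal of every transported plan stays \<rho>bar.\<close>
  interpret B: attention_curve Wout D Y K Kx \<zeta> "\<lambda>_. \<rho>bar"
    by (rule attention_curve.intro[OF data lr smooth \<rho>bar(1,2)])
  obtain b G M where b: "C11_field_curve b G M K \<rho>"
    "\<And>t \<omega>. 0 \<le> t \<Longrightarrow> \<omega> \<in> K \<Longrightarrow> b t \<omega> = (- 2 * \<zeta> t) *\<^sub>R grad_Phi Wout D Y \<omega> (\<rho> t)"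
    using A.ex_C11_field_curve by blast
  obtain b' G' M' where b': "C11_field_curve b' G' M' K (\<lambda>_. \<rho>bar)"
    "\<And>t \<omega>. 0 \<le> t \<Longrightarrow> \<omega> \<in> K \<Longrightarrow> b' t \<omega> = (- 2 * \<zeta> t) *\<^sub>R grad_Phi Wout D Y \<omega> \<rho>bar"
    using B.ex_C11_field_curve by blast
  have eq: "continuity_equation b G M K \<rho>"
    by (rule A.continuity_equation_of_weak_solution[OF solution b])
  have eq': "continuity_equation b' G' M' K (\<lambda>_. \<rho>bar)"
    by (rule B.continuity_equation_of_weak_solution[OF \<rho>bar(3) b'])
  interpret E: continuity_equation b G M K \<rho> by (rule eq)
  interpret E': continuity_equation b' G' M' K "\<lambda>_. \<rho>bar" by (rule eq')
  \<comment> \<open>The nonpositive factor - 2 \<zeta> t reverses the monotonicity inequality, which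
    is available at every time because the trajectory stays in the ball. This gives k = 2 \<kappa>,
    and the exponent 2 k of the contraction becomes 4 \<kappa>.\<close>
  have mono: "(\<integral>p. (fst p - snd p) \<bullet> (b t (fst p) - b' t (snd p)) \<partial>\<pi>) \<le> - (2 * \<kappa> * \<zeta> t) * (\<integral>p. (norm (fst p - snd p))\<^sup>2 \<partial>\<pi>)"
    if t: "0 \<le> t" and \<pi>: "\<pi> \<in> couplings (\<rho> t) \<rho>bar" for t \<pi>
  proof -
    let ?V = "\<lambda>p. (fst p - snd p) \<bullet> (grad_Phi Wout D Y (fst p) (\<rho> t) - grad_Phi Wout D Y (snd p) \<rho>bar)"
    have "(\<integral>p. (fst p - snd p) \<bullet> (b t (fst p) - b' t (snd p)) \<partial>\<pi>) = (\<integral>p. - 2 * \<zeta> t * ?V p \<partial>\<pi>)"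
    proof (rule integral_cong_AE)
      show "(\<lambda>p. (fst p - snd p) \<bullet> (b t (fst p) - b' t (snd p))) \<in> borel_measurable \<pi>"
        by (intro borel_measurable_couplings[OF \<pi>] borel_measurable_continuous_onI continuous_intros
            continuous_on_compose2[OF E.continuous_on_field[OF t, of UNIV]]
            continuous_on_compose2[OF E'.continuous_on_field[OF t, of UNIV]]) auto
      show "(\<lambda>p. - 2 * \<zeta> t * ?V p) \<in> borel_measurable \<pi>"
        unfolding A.grad_Phi_eq[OF t] B.grad_Phi_eq[OF t]
        by (intro borel_measurable_couplings[OF \<pi>] borel_measurable_continuous_onI continuous_intros
            continuous_on_compose2[OF A.Phi_grad_continuous[OF t, of UNIV]]
            continuous_on_compose2[OF B.Phi_grad_continuous[OF t, of UNIV]]) auto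
      show "AE p in \<pi>. (fst p - snd p) \<bullet> (b t (fst p) - b' t (snd p)) = - 2 * \<zeta> t * ?V p"
        using AE_couplings[OF \<pi> A.K \<rho>(1)[OF t] \<rho>bar(1)]
      proof eventually_elim
        case (elim p)
        then show ?case
          unfolding b(2)[OF t conjunct1[OF elim]] b'(2)[OF t conjunct2[OF elim]] scaleR_diff_right[symmetric] by simp
      qed
    qed
    also have "\<dots> = - 2 * \<zeta> t * (\<integral>p. ?V p \<partial>\<pi>)" by simp
    also have "\<dots> \<le> - 2 * \<zeta> t * (\<kappa> * (\<integral>p. (norm (fst p - snd p))\<^sup>2 \<partial>\<pi>))"
    proof (rule mult_left_mono_neg)
      show "\<kappa> * (\<integral>p. (norm (fst p - snd p))\<^sup>2 \<partial>\<pi>) \<le> (\<integral>p. ?V p \<partial>\<pi>)"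
        using monotone \<rho>(1)[OF t] trapped t \<pi> by blast
      show "- 2 * \<zeta> t \<le> 0" using lr t by (simp add: learning_rate_def)
    qed
    finally show ?thesis by (simp add: mult_ac)
  qed
  have sq: "(W2 (\<rho> t) \<rho>bar)\<^sup>2 \<le> exp (- 4 * \<kappa> * integral {0..t} \<zeta>) * (W2 (\<rho> 0) \<rho>bar)\<^sup>2" if t: "0 \<le> t" for t
  proof (rule W2_contraction_from_couplings[OF A.K \<rho>(1) \<rho>bar(1) \<rho>(1)[OF t] \<rho>bar(1)])
    show "\<exists>\<pi>'\<in>couplings (\<rho> t) \<rho>bar. (\<integral>p. (norm (fst p - snd p))\<^sup>2 \<partial>\<pi>')
        \<le> exp (- 4 * \<kappa> * integral {0..t} \<zeta>) * (\<integral>p. (norm (fst p - snd p))\<^sup>2 \<partial>\<pi>)"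
      if "\<pi> \<in> couplings (\<rho> 0) \<rho>bar" for \<pi>
      using coupled_flow_contraction[OF eq eq' that mono learning_rate_continuous[OF lr] t] by simp
  qed auto
  have root: "W2 (\<rho> t) \<rho>bar \<le> W2 (\<rho> 0) \<rho>bar * exp (- 2 * \<kappa> * integral {0..t} \<zeta>)" if t: "0 \<le> t" for t
  proof (rule power2_le_imp_le)
    have "(exp (- 2 * \<kappa> * integral {0..t} \<zeta>))\<^sup>2 = exp (- 4 * \<kappa> * integral {0..t} \<zeta>)"
      by (simp add: power2_eq_square exp_add[symmetric])
    then show "(W2 (\<rho> t) \<rho>bar)\<^sup>2 \<le> (W2 (\<rho> 0) \<rho>bar * exp (- 2 * \<kappa> * integral {0..t} \<zeta>))\<^sup>2"
      using sq[OF t] by (simp add: power_mult_distrib mult.commute)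
  qed (simp add: W2_nonneg)
  have "W2 (\<rho> t) \<rho>bar \<le> W2 (\<rho> 0) \<rho>bar * exp (- 2 * \<kappa> * \<zeta>min * t)"
    if \<zeta>min: "\<forall>t\<ge>0. \<zeta> t \<ge> \<zeta>min" and t: "0 \<le> t" for \<zeta>min t
  proof -
    \<comment> \<open>A lower bound on the learning rate makes its integral at least linear in t,
      which turns the decay into exponential decay.\<close>
    have "integral {0..t} (\<lambda>_. \<zeta>min) \<le> integral {0..t} \<zeta>"
      using \<zeta>min by (intro integral_le integrable_continuous_real continuous_on_const
          continuous_on_subset[OF learning_rate_continuous[OF lr]]) auto
    then have "\<kappa> * (\<zeta>min * t) \<le> \<kappa> * integral {0..t} \<zeta>"
      using \<kappa>_pos t by (intro mult_left_mono) (simp_all add: mult.commute)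
    then have "W2 (\<rho> 0) \<rho>bar * exp (- 2 * \<kappa> * integral {0..t} \<zeta>) \<le> W2 (\<rho> 0) \<rho>bar * exp (- 2 * \<kappa> * \<zeta>min * t)"
      by (intro mult_left_mono W2_nonneg) (simp add: mult_ac)
    with root[OF t] show ?thesis by linarith
  qed
  with sq root show ?thesis by (simp add: mult.commute)
qed

end
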